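(* Let $\mu_1,\mu_2,\mu_3>0$, $\epsilon_1,\epsilon_2,\epsilon_3\in\{1,-1\}$, $c\in\mathbb{R}$, and let $0\le j_{12}\le j_{123}$ be integers. Put $j_{(12)3}=j_{123}-j_{12}$, $\mu_{12}=\mu_1+\mu_2+j_{12}+\tfrac12$, $\epsilon_{12}=\epsilon_1\epsilon_2(-1)^{j_{12}}$, $\mu_{123}=\mu_1+\mu_2+\mu_3+1+j_{123}$, and, for $0\le j_{23}\le j_{123}$, $j_{1(23)}=j_{123}-j_{23}$, $\mu_{23}=\mu_2+\mu_3+j_{23}+\tfrac12$, $\epsilon_{23}=\epsilon_2\epsilon_3(-1)^{j_{23}}$. Then for real $\lambda_1,\lambda_2,\lambda_3$ with $|\lambda_3|>|\lambda_2|>|\lambda_1|>|c|$, $$K_{j_{12}}^{\epsilon_1\epsilon_2}(\lambda_2;\mu_2,\mu_1;c)\,J_{j_{12}}\Big(\tfrac{\epsilon_2\lambda_1}{\lambda_2};2\mu_2,2\mu_1,-\tfrac{c\epsilon_1\epsilon_2}{\lambda_2}\Big)\,K_{j_{(12)3}}^{\epsilon_{12}\epsilon_3}(\lambda_3;\mu_3,\mu_{12};c)\,J_{j_{(12)3}}\Big(\tfrac{\epsilon_3\lambda_2}{\lambda_3};2\mu_3,2\mu_{12},-\tfrac{c\epsilon_{12}\epsilon_3}{\lambda_3}\Big)$$ $$=\sum_{j_{23}=0}^{j_{123}}(-1)^{\varphi}\,\epsilon_3^{j_{12}}\sqrt{\frac{w_{j_{23}}}{h_{j_{12}}}}\;B_{j_{12}}(x_{j_{23}};\rho_1,\rho_2,r_1,r_2)\;K_{j_{23}}^{\epsilon_2\epsilon_3}(\lambda_3;\mu_3,\mu_2;\lambda_1)\,J_{j_{23}}\Big(\tfrac{\epsilon_3\lambda_2}{\lambda_3};2\mu_3,2\mu_2,-\tfrac{\lambda_1\epsilon_2\epsilon_3}{\lambda_3}\Big)$$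 $$\qquad\times K_{j_{1(23)}}^{\epsilon_1\epsilon_{23}}(\lambda_3;\mu_{23},\mu_1;c)\,J_{j_{1(23)}}\Big(\tfrac{\epsilon_{23}\lambda_1}{\lambda_3};2\mu_{23},2\mu_1,-\tfrac{c\epsilon_1\epsilon_{23}}{\lambda_3}\Big),$$ where $$\rho_1=\tfrac{\mu_2+\mu_3}2,\quad \rho_2=\tfrac{\mu_1+(-1)^{j_{123}}\mu_{123}}2,\quad r_1=\tfrac{\mu_3-\mu_2}2,\quad r_2=\tfrac{(-1)^{j_{123}}\mu_{123}-\mu_1}2,$$ $$\varphi=j_{123}\frac{(j_{12}-1)j_{12}}2+(j_{123}+1)\Big(j_{23}+\frac{(j_{12}+1)j_{12}}2\Big).$$
   Context: Notation: $(a)_n=a(a+1)\cdots(a+n-1)$. Big $-1$ Jacobi polynomials $J_n(x;a,b,c)$: with $y=\frac{1-x^2}{1-c^2}$, for $n$ even $$J_n={}_2F_1\big(-\tfrac n2,\tfrac{n+a+b+2}2;\tfrac{a+1}2;y\big)+\tfrac{n(1-x)}{(1+c)(a+1)}\,{}_2F_1\big(1-\tfrac n2,\tfrac{n+a+b+2}2;\tfrac{a+3}2;y\big),$$ and for $n$ odd $$J_n={}_2F_1\big(-\tfrac{n-1}2,\tfrac{n+a+b+1}2;\tfrac{a+1}2;y\big)-\tfrac{(n+a+b+1)(1-x)}{(1+c)(a+1)}\,{}_2F_1\big(-\tfrac{n-1}2,\tfrac{n+a+b+3}2;\tfrac{a+3}2;y\big)$$ (for $n=0$ the second term is zero, $J_0=1$).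 Put $$\mathsf h_n(a,b)=\frac{2\,\Gamma(\frac{n+b+1}2)\Gamma(\frac{n+a+3}2)(\frac n2)!}{(n+a+1)\Gamma(\frac{n+a+b+2}2)\big((\frac{a+1}2)_{n/2}\big)^2}\ (n\text{ even}),\qquad \mathsf h_n(a,b)=\frac{(n+a+b+1)\Gamma(\frac{n+b+2}2)\Gamma(\frac{n+a+2}2)(\frac{n-1}2)!}{2\,\Gamma(\frac{n+a+b+3}2)\big((\frac{a+1}2)_{(n+1)/2}\big)^2}\ (n\text{ odd}).$$ For $\alpha,\beta>0$, $\sigma\in\{1,-1\}$, $|\lambda|>|c|$ put $$K_j^{\sigma}(\lambda;\beta,\alpha;c)=\sqrt{\Big(\frac{\lambda^2-c^2}2\Big)^j\Big(\frac{\lambda-c\sigma}{\lambda-(-1)^jc\sigma}\Big)\frac{\Gamma(\alpha+\frac12)\Gamma(\beta+\frac12)}{\Gamma(\alpha+\beta+j+1)\,\mathsf h_j(2\beta,2\alpha)}}.$$ Bannai-Ito polynomials $B_n(x)=B_n(x;\rho_1,\rho_2,r_1,r_2)$: monic, with $g=\rho_1+\rho_2-r_1-r_2$, $B_{-1}=0$, $B_0=1$ and $$xB_n(x)=B_{n+1}(x)+(\rho_1-A_n-C_n)B_n(x)+A_{n-1}C_nB_{n-1}(x),$$ $$A_n=\frac{(n+2\rho_1-2r_1+1)(n+2\rho_1-2r_2+1)}{4(n+g+1)}\ (n\text{ even}),\qquad A_n=\frac{(n+2g+1)(n+2\rho_1+2\rho_2+1)}{4(n+g+1)}\ (n\text{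 odd}),$$ $$C_n=-\frac{n(n-2r_1-2r_2)}{4(n+g)}\ (n\text{ even}),\qquad C_n=-\frac{(n+2\rho_2-2r_2)(n+2\rho_2-2r_1)}{4(n+g)}\ (n\text{ odd}).$$ Every nonnegative integer $n$ is written $n=2n_e+n_p$ with $n_p\in\{0,1\}$ (likewise for $k$ and $N$). For the parameters in the claim put $N=j_{123}$; then $r_2-\rho_1=\frac{N+1}2$ if $N$ is even and $\rho_1+\rho_2=-\frac{N+1}2$ if $N$ is odd. For $0\le k\le N$, $$x_k=(-1)^k\big(\tfrac k2+\rho_1+\tfrac14\big)-\tfrac14,$$ $$w_k=\frac{(-1)^k}{k_e!}\,\frac{(\rho_1-r_1+\frac12)_{k_e+k_p}(\rho_1-r_2+\frac12)_{k_e+k_p}(\rho_1+\rho_2+1)_{k_e}(2\rho_1+1)_{k_e}}{(\rho_1+r_1+\frac12)_{k_e+k_p}(\rho_1+r_2+\frac12)_{k_e+k_p}(\rho_1-\rho_2+1)_{k_e}}.$$ The normalization factors $h_n$ (those of the orthogonality relation $\sum_{k=0}^{N}w_kB_n(x_k)B_m(x_k)=h_n\delta_{nm}$) are, for $N$ even, $$h_n=\frac{n_e!\,N_e!\,(1+2\rho_1)_{N_e}(1+\rho_1+\rho_2)_{n_e}(1+n_e+g)_{N_e-n_e}(\frac12+\rho_1-r_1)_{n_e+n_p}(\frac12+\rho_2-r_1)_{n_e+n_p}}{(N_e-n_e-n_p)!\,(\frac12+\rho_1+r_1)_{N_e-n_e}(\frac12+n_e+n_p+\rho_2-r_2)_{N_e-n_e-n_p}\big((1+n+g)_{n_e+n_p}\big)^2},$$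 and, for $N$ odd, $$h_n=\frac{n_e!\,N_e!\,(1+2\rho_1)_{N_e+1}(1-r_1-r_2)_{n_e}(1+n_e+g)_{N_e+1-n_e}(\frac12+\rho_1-r_1)_{n_e+n_p}(\frac12+\rho_1-r_2)_{n_e+n_p}}{(N_e-n_e)!\,(\frac12+\rho_1+r_1)_{N_e+1-n_e-n_p}(\frac12+n_e+n_p+\rho_2-r_2)_{N_e+1-n_e-n_p}\big((1+n+g)_{n_e+n_p}\big)^2}.$$
   Formalization: In h_n the squared factor is ((1+n_e+g)_{n_e+n_p})^2 instead of the printed ((1+n+g)_{n_e+n_p})^2, as orthogonality requires, and the right-hand side carries an extra factor sgn(λ_2λ_3)^{j_{12}}, without which the identity fails for odd j_{12} and λ_2λ_3<0. *)

theory Defs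
  imports "HOL-Analysis.Analysis" "HOL-Computational_Algebra.Formal_Power_Series"
begin

text \<open>
  The Gauss hypergeometric function. It is only used below with a first parameter that is a
  nonpositive integer, so that the series terminates, or with a coefficient \<open>0\<close> in front of it.
\<close>

definition hyp2F1 :: "real \<Rightarrow> real \<Rightarrow> real \<Rightarrow> real \<Rightarrow> real" where
  "hyp2F1 a b c z = eval_fps (fps_hypergeo [a, b] [c] 1) z"

definition bigJ :: "nat \<Rightarrow> real \<Rightarrow> real \<Rightarrow> real \<Rightarrow> real \<Rightarrow> real" where
  "bigJ n x a b c =
    (let y = (1 - x^2) / (1 - c^2); m = real n in
     if even n then
       hyp2F1 (- m / 2) ((m + a + b + 2) / 2) ((a + 1) / 2) y
       + m * (1 - x) / ((1 + c) * (a + 1))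
         * hyp2F1 (1 - m / 2) ((m + a + b + 2) / 2) ((a + 3) / 2) y
     else
       hyp2F1 (- (m - 1) / 2) ((m + a + b + 1) / 2) ((a + 1) / 2) y
       - (m + a + b + 1) * (1 - x) / ((1 + c) * (a + 1))
         * hyp2F1 (- (m - 1) / 2) ((m + a + b + 3) / 2) ((a + 3) / 2) y)"

definition bigJ_h :: "nat \<Rightarrow> real \<Rightarrow> real \<Rightarrow> real" where
  "bigJ_h n a b =
    (let m = real n in
     if even n then
       2 * Gamma ((m + b + 1) / 2) * Gamma ((m + a + 3) / 2) * fact (n div 2)
       / ((m + a + 1) * Gamma ((m + a + b + 2) / 2) * (pochhammer ((a + 1) / 2) (n div 2))^2)
     else
       (m + a + b + 1) * Gamma ((m + b + 2) / 2) * Gamma ((m + a + 2) / 2) * fact ((n - 1) div 2)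
       / (2 * Gamma ((m + a + b + 3) / 2) * (pochhammer ((a + 1) / 2) ((n + 1) div 2))^2))"

text \<open>
  \<open>bigJ_K j \<sigma> \<Lambda> \<beta> \<alpha> c\<close> is the normalization factor
  \<open>K\<close> with lower index \<open>j\<close>, upper index \<open>\<sigma>\<close> and arguments \<open>(\<Lambda>; \<beta>, \<alpha>; c)\<close>, for
  \<open>\<bar>\<Lambda>\<bar> > \<bar>c\<bar>\<close>. The radicand is then positive and the square root is the nonnegative one. For
  odd \<open>j\<close> the \<open>\<Lambda>\<close>-dependent part of \<open>K\<close> is a power of \<open>\<Lambda>\<^sup>2 - c\<^sup>2\<close> times
  \<open>\<bar>\<Lambda> - c \<sigma>\<bar>\<close>, not \<open>\<Lambda> - c \<sigma>\<close>, so that \<open>K\<close> loses the sign of \<open>\<Lambda>\<close>; relations between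
  products of \<open>K\<close> at arguments of opposite signs therefore need an explicit sign.
\<close>

definition bigJ_K :: "nat \<Rightarrow> real \<Rightarrow> real \<Rightarrow> real \<Rightarrow> real \<Rightarrow> real \<Rightarrow> real" where
  "bigJ_K j \<sigma> \<Lambda> \<beta> \<alpha> c =
    sqrt (((\<Lambda>^2 - c^2) / 2) ^ j
      * ((\<Lambda> - c * \<sigma>) / (\<Lambda> - (-1) ^ j * c * \<sigma>))
      * (Gamma (\<alpha> + 1/2) * Gamma (\<beta> + 1/2)
         / (Gamma (\<alpha> + \<beta> + real j + 1) * bigJ_h j (2 * \<beta>) (2 * \<alpha>))))"

definition BI_A :: "real \<Rightarrow> real \<Rightarrow> real \<Rightarrow> real \<Rightarrow> nat \<Rightarrow> real" where
  "BI_A \<rho>1 \<rho>2 r1 r2 n =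
    (let g = \<rho>1 + \<rho>2 - r1 - r2; m = real n in
     if even n then (m + 2 * \<rho>1 - 2 * r1 + 1) * (m + 2 * \<rho>1 - 2 * r2 + 1) / (4 * (m + g + 1))
     else (m + 2 * g + 1) * (m + 2 * \<rho>1 + 2 * \<rho>2 + 1) / (4 * (m + g + 1)))"

definition BI_C :: "real \<Rightarrow> real \<Rightarrow> real \<Rightarrow> real \<Rightarrow> nat \<Rightarrow> real" where
  "BI_C \<rho>1 \<rho>2 r1 r2 n =
    (let g = \<rho>1 + \<rho>2 - r1 - r2; m = real n in
     if even n then - (m * (m - 2 * r1 - 2 * r2) / (4 * (m + g)))
     else - ((m + 2 * \<rho>2 - 2 * r2) * (m + 2 * \<rho>2 - 2 * r1) / (4 * (m + g))))"

fun BI :: "real \<Rightarrow> real \<Rightarrow> real \<Rightarrow> real \<Rightarrow> nat \<Rightarrow> real \<Rightarrow> real" where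
  "BI \<rho>1 \<rho>2 r1 r2 0 x = 1"
| "BI \<rho>1 \<rho>2 r1 r2 (Suc 0) x = x - (\<rho>1 - BI_A \<rho>1 \<rho>2 r1 r2 0 - BI_C \<rho>1 \<rho>2 r1 r2 0)"
| "BI \<rho>1 \<rho>2 r1 r2 (Suc (Suc n)) x =
     (x - (\<rho>1 - BI_A \<rho>1 \<rho>2 r1 r2 (Suc n) - BI_C \<rho>1 \<rho>2 r1 r2 (Suc n))) * BI \<rho>1 \<rho>2 r1 r2 (Suc n) x
     - BI_A \<rho>1 \<rho>2 r1 r2 n * BI_C \<rho>1 \<rho>2 r1 r2 (Suc n) * BI \<rho>1 \<rho>2 r1 r2 n x"

definition BI_x :: "real \<Rightarrow> nat \<Rightarrow> real" where
  "BI_x \<rho>1 k = (-1) ^ k * (real k / 2 + \<rho>1 + 1/4) - 1/4"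

definition BI_w :: "real \<Rightarrow> real \<Rightarrow> real \<Rightarrow> real \<Rightarrow> nat \<Rightarrow> real" where
  "BI_w \<rho>1 \<rho>2 r1 r2 k =
    (let ke = k div 2; kp = k mod 2 in
     (-1) ^ k / fact ke
     * ((pochhammer (\<rho>1 - r1 + 1/2) (ke + kp) * pochhammer (\<rho>1 - r2 + 1/2) (ke + kp)
          * pochhammer (\<rho>1 + \<rho>2 + 1) ke * pochhammer (2 * \<rho>1 + 1) ke)
        / (pochhammer (\<rho>1 + r1 + 1/2) (ke + kp) * pochhammer (\<rho>1 + r2 + 1/2) (ke + kp)
          * pochhammer (\<rho>1 - \<rho>2 + 1) ke)))"

text \<open>
  The normalization factors of the orthogonality relation
  \<open>(\<Sum>k\<le>N. w k * B n (x k) * B m (x k)) = (if n = m then h n else 0)\<close> under the truncation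
  condition \<open>r2 - \<rho>1 = (N + 1) / 2\<close> (\<open>N\<close> even) or \<open>\<rho>1 + \<rho>2 = - (N + 1) / 2\<close> (\<open>N\<close> odd). The squared
  Pochhammer symbol in the denominator starts at \<open>1 + ne + g\<close> with \<open>ne = n div 2\<close>. The variant
  starting at \<open>1 + n + g\<close>, which is also found in print, already contradicts the orthogonality
  relation for \<open>N = n = 1\<close>.
\<close>

definition BI_h :: "nat \<Rightarrow> real \<Rightarrow> real \<Rightarrow> real \<Rightarrow> real \<Rightarrow> nat \<Rightarrow> real" where
  "BI_h N \<rho>1 \<rho>2 r1 r2 n =
    (let g = \<rho>1 + \<rho>2 - r1 - r2; ne = n div 2; np = n mod 2; Ne = N div 2 in
     if even N then
       (fact ne * fact Ne * pochhammer (1 + 2 * \<rho>1) Ne * pochhammer (1 + \<rho>1 + \<rho>2) ne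
         * pochhammer (1 + real ne + g) (Ne - ne)
         * pochhammer (1/2 + \<rho>1 - r1) (ne + np) * pochhammer (1/2 + \<rho>2 - r1) (ne + np))
       / (fact (Ne - ne - np) * pochhammer (1/2 + \<rho>1 + r1) (Ne - ne)
         * pochhammer (1/2 + real ne + real np + \<rho>2 - r2) (Ne - ne - np)
         * (pochhammer (1 + real ne + g) (ne + np))^2)
     else
       (fact ne * fact Ne * pochhammer (1 + 2 * \<rho>1) (Ne + 1) * pochhammer (1 - r1 - r2) ne
         * pochhammer (1 + real ne + g) (Ne + 1 - ne)
         * pochhammer (1/2 + \<rho>1 - r1) (ne + np) * pochhammer (1/2 + \<rho>1 - r2) (ne + np))
       / (fact (Ne - ne) * pochhammer (1/2 + \<rho>1 + r1) (Ne + 1 - ne - np)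
         * pochhammer (1/2 + real ne + real np + \<rho>2 - r2) (Ne + 1 - ne - np)
         * (pochhammer (1 + real ne + g) (ne + np))^2))"

end

theory Submission
  imports Defs
begin

text \<open>
  Up to normalization, \<open>J\<^sub>n\<close> is a homogeneous polynomial \<open>p\<^sub>n(x2; x1, x0)\<close> of degree \<open>n\<close>, and after
  absorbing the signs \<open>\<epsilon>\<^sub>i\<close> into the variables the claim is an identity between products of two such
  polynomials. Both sides are functions of the middle variable \<open>t = x2\<close>. The first-order differential
  reflection operator in \<open>t\<close> whose eigenfunctions are the polynomials \<open>p\<^sub>k(x3; t, x1)\<close>, with
  eigenvalues \<open>x\<^sub>k\<close> up to a shift, acts on the left-hand sides as a three-term operator in
  \<open>j12\<close>, and its coefficients are those of the recurrence of the Bannai-Ito polynomials. So the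
  identity propagates from \<open>j12 = 0\<close>. There the Newton-type expansion of \<open>p\<^sub>n\<close> with nodes
  \<open>y\<^sub>k = (-1)\<^sup>k (k + s - 1/2)\<close> reduces it to the vanishing of the divided differences of the constant
  \<open>1\<close>.
\<close>

section \<open>Homogeneous Jacobi polynomials in two variables\<close>

text \<open>Let F(c; w) be the sum of w^i / (i! (c)_i). \<open>jacS m c d p q\<close> is the
  coefficient of z^m in F(c; -qz) F(d; pz), a multiple of (p + q)^m P_m((p - q)/(p + q)) with Jacobi
  parameters c - 1, d - 1. Likewise \<open>jacp n\<close> is the coefficient of z^n in the product
  of F(c; -qz^2) - (x2 - x1)(z/c) F(c + 1; -qz^2) and F(d; pz^2) + (x1 - x0)(z/d) F(d + 1; pz^2),
  where p = x1^2 - x0^2 and q = x2^2 - x1^2. In this form the structure relations reduce to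
  contiguous relations of F. On the right t occurs in one factor only. On the left it stands first
  in one factor and second in the other, so raising and lowering relations are needed for both
  places; their factors t + z and t - z, with z = (-1)^n x0, match and disappear. Square roots are
  identified by comparing squares of positive closed forms, and the signs of the two remaining
  coefficients multiply to (-1)^\<phi>. As K is a nonnegative root, it loses the sign of its
  argument in odd degree, which is the source of sgn (\<Lambda>2 * \<Lambda>3) ^ j12.\<close>

definition jacS :: "nat \<Rightarrow> real \<Rightarrow> real \<Rightarrow> real \<Rightarrow> real \<Rightarrow> real" where
  "jacS m c d p q =
    (\<Sum>i\<le>m. (- q) ^ i * p ^ (m - i)
       / (fact i * fact (m - i) * pochhammer c i * pochhammer d (m - i)))"

text \<open>
  Index \<open>m - 1\<close>, with value \<open>0\<close> at \<open>m = 0\<close>, so that no contiguous relation needs a case distinction.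
\<close>

definition jacS_prev :: "nat \<Rightarrow> real \<Rightarrow> real \<Rightarrow> real \<Rightarrow> real \<Rightarrow> real" where
  "jacS_prev m c d p q = (if m = 0 then 0 else jacS (m - 1) c d p q)"

section \<open>Contiguous relations of the homogeneous Jacobi polynomials\<close>

lemma jacS_0 [simp]: "jacS 0 c d p q = 1"
  by (simp add: jacS_def)

text \<open>The weight i implements q d/dq, and differentiating F(c; -qz) in q gives -z/c times F(c
  + 1; -qz): the degree drops by one and c rises by one.\<close>

lemma jacS_weighted_left:
  assumes "c > 0" "d > 0"
  shows "(\<Sum>i\<le>m. real i * ((- q) ^ i * p ^ (m - i)
       / (fact i * fact (m - i) * pochhammer c i * pochhammer d (m - i))))
     = - q * jacS_prev m (c + 1) d p q / c"
proof (cases m)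
  case (Suc n)
  have "(\<Sum>i\<le>Suc n. real i * ((- q) ^ i * p ^ (Suc n - i)
       / (fact i * fact (Suc n - i) * pochhammer c i * pochhammer d (Suc n - i))))
     = (\<Sum>i\<le>n. real (Suc i) * ((- q) ^ Suc i * p ^ (n - i)
       / (fact (Suc i) * fact (n - i) * pochhammer c (Suc i) * pochhammer d (n - i))))"
    by (subst sum.atMost_Suc_shift) simp
  also have "\<dots> = (\<Sum>i\<le>n. - q / c * ((- q) ^ i * p ^ (n - i)
       / (fact i * fact (n - i) * pochhammer (c + 1) i * pochhammer d (n - i))))"
  proof (rule sum.cong[OF refl])
    fix i
    have "real (Suc i) * ((- q) ^ Suc i * p ^ (n - i) / (fact (Suc i) * X * (c * P) * Y))
        = - q / c * ((- q) ^ i * p ^ (n - i) / (fact i * X * P * Y))" for X P Y :: real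
      by (simp add: field_simps del: of_nat_Suc)
    thus "real (Suc i) * ((- q) ^ Suc i * p ^ (n - i)
       / (fact (Suc i) * fact (n - i) * pochhammer c (Suc i) * pochhammer d (n - i)))
       = - q / c * ((- q) ^ i * p ^ (n - i)
       / (fact i * fact (n - i) * pochhammer (c + 1) i * pochhammer d (n - i)))"
      by (simp only: pochhammer_rec)
  qed
  also have "\<dots> = - q * jacS n (c + 1) d p q / c"
    by (simp only: jacS_def sum_distrib_left[symmetric]) simp
  finally show ?thesis by (simp add: Suc jacS_prev_def)
qed (simp add: jacS_prev_def)

text \<open>The sum read backwards; this is the symmetry x -> -x of Jacobi polynomials, which
  exchanges the two parameters. It supplies the mirror image of each relation proved for c.\<close>

lemma jacS_swap: "jacS m c d p q = jacS m d c (- q) (- p)"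
  unfolding jacS_def
  by (rule sum.reindex_bij_witness[of _ "\<lambda>i. m - i" "\<lambda>i. m - i"]) (auto simp: mult_ac)

lemma jacS_prev_swap: "jacS_prev m c d p q = jacS_prev m d c (- q) (- p)"
  unfolding jacS_prev_def using jacS_swap by auto

lemma jacS_weighted_right:
  assumes "c > 0" "d > 0"
  shows "(\<Sum>i\<le>m. real (m - i) * ((- q) ^ i * p ^ (m - i)
       / (fact i * fact (m - i) * pochhammer c i * pochhammer d (m - i))))
     = p * jacS_prev m c (d + 1) p q / d"
proof -
  have "(\<Sum>i\<le>m. real (m - i) * ((- q) ^ i * p ^ (m - i)
       / (fact i * fact (m - i) * pochhammer c i * pochhammer d (m - i))))
    = (\<Sum>i\<le>m. real i * ((- (- p)) ^ i * (- q) ^ (m - i)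
       / (fact i * fact (m - i) * pochhammer d i * pochhammer c (m - i))))"
    by (rule sum.reindex_bij_witness[of _ "\<lambda>i. m - i" "\<lambda>i. m - i"]) (auto simp: mult_ac)
  also have "\<dots> = p * jacS_prev m (d + 1) c (- q) (- p) / d"
    using jacS_weighted_left[OF assms(2,1), where m = m and q = "- p" and p = "- q"] by simp
  also have "jacS_prev m (d + 1) c (- q) (- p) = jacS_prev m c (d + 1) p q"
    by (rule jacS_prev_swap[symmetric])
  finally show ?thesis .
qed

text \<open>Euler's identity for a homogeneous polynomial of degree m: writing m = i + (m - i) in
  each term gives q d/dq + p d/dp.\<close>

lemma jacS_euler:
  assumes "c > 0" "d > 0"
  shows "real m * jacS m c d p q
    = p * jacS_prev m c (d + 1) p q / d - q * jacS_prev m (c + 1) d p q / c"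
proof -
  have "real m * jacS m c d p q
     = (\<Sum>i\<le>m. real (m - i) * ((- q) ^ i * p ^ (m - i)
       / (fact i * fact (m - i) * pochhammer c i * pochhammer d (m - i))))
     + (\<Sum>i\<le>m. real i * ((- q) ^ i * p ^ (m - i)
       / (fact i * fact (m - i) * pochhammer c i * pochhammer d (m - i))))"
    unfolding jacS_def sum.distrib[symmetric] sum_distrib_left
    by (rule sum.cong[OF refl], simp only: ring_distribs(2)[symmetric] of_nat_add[symmetric]) simp
  thus ?thesis
    by (simp only: jacS_weighted_left[OF assms] jacS_weighted_right[OF assms])
qed

text \<open>Termwise this is 1/(c)_i = (1 + i/c)/(c + 1)_i, the contiguous relation between F(c) and
  F(c + 1).\<close>

lemma jacS_shift_left:
  assumes "c > 0" "d > 0"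
  shows "jacS m c d p q = jacS m (c + 1) d p q - q * jacS_prev m (c + 2) d p q / (c * (c + 1))"
proof -
  have "jacS m c d p q = jacS m (c + 1) d p q
     + (\<Sum>i\<le>m. real i * ((- q) ^ i * p ^ (m - i)
       / (fact i * fact (m - i) * pochhammer (c + 1) i * pochhammer d (m - i)))) / c"
    unfolding jacS_def sum.distrib[symmetric] sum_divide_distrib
  proof (rule sum.cong[OF refl])
    fix i
    have P: "pochhammer c i * (c + real i) = c * pochhammer (c + 1) i"
      by (metis pochhammer_Suc pochhammer_rec)
    have pos: "pochhammer c i > 0" "pochhammer (c + 1) i > 0" "c + real i > 0"
      using assms by (auto intro!: pochhammer_pos)
    have *: "pochhammer c i = c * pochhammer (c + 1) i / (c + real i)"
      using P pos by (simp add: field_simps)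
    show "(- q) ^ i * p ^ (m - i) / (fact i * fact (m - i) * pochhammer c i * pochhammer d (m - i))
      = (- q) ^ i * p ^ (m - i)
          / (fact i * fact (m - i) * pochhammer (c + 1) i * pochhammer d (m - i))
        + real i * ((- q) ^ i * p ^ (m - i)
          / (fact i * fact (m - i) * pochhammer (c + 1) i * pochhammer d (m - i))) / c"
      unfolding * using assms pos by (simp add: divide_simps) (simp add: algebra_simps)
  qed
  also have "(\<Sum>i\<le>m. real i * ((- q) ^ i * p ^ (m - i)
       / (fact i * fact (m - i) * pochhammer (c + 1) i * pochhammer d (m - i))))
      = - q * jacS_prev m (c + 2) d p q / (c + 1)"
    using jacS_weighted_left[of "c + 1" d, where m = m and q = q and p = p] assms by (simp add: add.assoc)
  finally show ?thesis using assms by (simp add: field_simps)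
qed

lemma jacS_shift_right:
  assumes "c > 0" "d > 0"
  shows "jacS m c d p q = jacS m c (d + 1) p q + p * jacS_prev m c (d + 2) p q / (d * (d + 1))"
  using jacS_shift_left[OF assms(2,1), of m "- q" "- p"]
  by (simp add: jacS_swap[of m c] jacS_prev_swap[of m c])

text \<open>Euler's identity at d + 1 produces a term in p with d + 2; the shift relation in d
  absorbs it, so that only a term with both parameters raised once remains.\<close>

lemma jacS_weight_right:
  assumes "c > 0" "d > 0"
  shows "(real m + d) * jacS m c (d + 1) p q / d
    = jacS m c d p q - q * jacS_prev m (c + 1) (d + 1) p q / (c * d)"
proof -
  have e: "real m * jacS m c (d + 1) p q
    = p * jacS_prev m c (d + 2) p q / (d + 1) - q * jacS_prev m (c + 1) (d + 1) p q / c"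
    using jacS_euler[of c "d + 1" m p q] assms by (simp add: add.assoc)
  have "(real m + d) * jacS m c (d + 1) p q / d
      = real m * jacS m c (d + 1) p q / d + jacS m c (d + 1) p q"
    using assms by (simp add: field_simps)
  also have "\<dots> = jacS m c d p q - q * jacS_prev m (c + 1) (d + 1) p q / (c * d)"
    unfolding e jacS_shift_right[OF assms, of m p q]
    by (simp add: diff_divide_distrib mult.commute)
  finally show ?thesis .
qed

lemma jacS_weight_left:
  assumes "c > 0" "d > 0"
  shows "(real m + c) * jacS m (c + 1) d p q / c
    = jacS m c d p q + p * jacS_prev m (c + 1) (d + 1) p q / (c * d)"
  using jacS_weight_right[OF assms(2,1), of m "- q" "- p"]
  by (simp add: jacS_swap[of m c] jacS_swap[of m "c + 1"] jacS_prev_swap[of m "c + 1"] mult_ac)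

text \<open>The right-hand side is the derivative of the polynomial of degree m + 1 along the lines
  p + q = const. So this is the classical formula by which differentiation raises both Jacobi
  parameters.\<close>

lemma jacS_next:
  assumes "c > 0" "d > 0"
  shows "(c + d + real m) * jacS m (c + 1) (d + 1) p q / (c * d)
    = jacS m c (d + 1) p q / d + jacS m (c + 1) d p q / c"
proof -
  have a: "jacS m c (d + 1) p q = jacS m (c + 1) (d + 1) p q
      - q * jacS_prev m (c + 2) (d + 1) p q / (c * (c + 1))"
    using jacS_shift_left[of c "d + 1" m p q] assms by simp
  have b: "jacS m (c + 1) d p q = jacS m (c + 1) (d + 1) p q
      + p * jacS_prev m (c + 1) (d + 2) p q / (d * (d + 1))"
    using jacS_shift_right[of "c + 1" d m p q] assms by simp
  have e: "real m * jacS m (c + 1) (d + 1) p q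
    = p * jacS_prev m (c + 1) (d + 2) p q / (d + 1) - q * jacS_prev m (c + 2) (d + 1) p q / (c + 1)"
    using jacS_euler[of "c + 1" "d + 1" m p q] assms by (simp add: add.assoc)
  have "jacS m c (d + 1) p q / d + jacS m (c + 1) d p q / c
     = (c + d) * jacS m (c + 1) (d + 1) p q / (c * d) + (p * jacS_prev m (c + 1) (d + 2) p q / (d + 1)
       - q * jacS_prev m (c + 2) (d + 1) p q / (c + 1)) / (c * d)"
    unfolding a b using assms by (simp add: divide_simps) (simp add: algebra_simps)
  also have "\<dots> = (c + d + real m) * jacS m (c + 1) (d + 1) p q / (c * d)"
    unfolding e[symmetric] by (simp add: add_divide_distrib algebra_simps)
  finally show ?thesis by simp
qed

lemma jacS_deriv:
  assumes "c > 0" "d > 0"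
    and "(p has_real_derivative p') (at t)" "(q has_real_derivative q') (at t)"
  shows "((\<lambda>t. jacS m c d (p t) (q t)) has_real_derivative
      p' * jacS_prev m c (d + 1) (p t) (q t) / d - q' * jacS_prev m (c + 1) d (p t) (q t) / c) (at t)"
proof (cases m)
  case (Suc n)
  have "((\<lambda>t. jacS m c d (p t) (q t)) has_real_derivative
     (\<Sum>i\<le>m. (real i * (- q t) ^ (i - 1) * (- q') * p t ^ (m - i)
        + (- q t) ^ i * (real (m - i) * p t ^ (m - i - 1) * p'))
       / (fact i * fact (m - i) * pochhammer c i * pochhammer d (m - i)))) (at t)"
    unfolding jacS_def
  proof (rule DERIV_sum, rule DERIV_cdivide)
    fix i
    show "((\<lambda>t. (- q t) ^ i * p t ^ (m - i)) has_real_derivative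
      real i * (- q t) ^ (i - 1) * (- q') * p t ^ (m - i)
        + (- q t) ^ i * (real (m - i) * p t ^ (m - i - 1) * p')) (at t)"
      by (rule derivative_eq_intros assms refl)+ (simp add: algebra_simps)
  qed
  also have "(\<Sum>i\<le>m. (real i * (- q t) ^ (i - 1) * (- q') * p t ^ (m - i)
        + (- q t) ^ i * (real (m - i) * p t ^ (m - i - 1) * p'))
       / (fact i * fact (m - i) * pochhammer c i * pochhammer d (m - i)))
     = p' * (\<Sum>i\<le>m. real (m - i) * ((- q t) ^ i * p t ^ (m - i - 1)
         / (fact i * fact (m - i) * pochhammer c i * pochhammer d (m - i))))
     - q' * (\<Sum>i\<le>m. real i * ((- q t) ^ (i - 1) * p t ^ (m - i)
         / (fact i * fact (m - i) * pochhammer c i * pochhammer d (m - i))))"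
    unfolding sum_distrib_left sum_subtractf[symmetric]
    by (rule sum.cong[OF refl]) (simp add: divide_inverse algebra_simps)
  also have "(\<Sum>i\<le>m. real (m - i) * ((- q t) ^ i * p t ^ (m - i - 1)
         / (fact i * fact (m - i) * pochhammer c i * pochhammer d (m - i))))
     = jacS_prev m c (d + 1) (p t) (q t) / d"
  proof -
    have "(\<Sum>i\<le>m. real (m - i) * ((- q t) ^ i * p t ^ (m - i - 1)
         / (fact i * fact (m - i) * pochhammer c i * pochhammer d (m - i))))
       = (\<Sum>i\<le>n. (- q t) ^ i * p t ^ (n - i)
         / (fact i * fact (n - i) * pochhammer c i * pochhammer (d + 1) (n - i)) / d)"
      unfolding Suc sum.atMost_Suc diff_self_eq_0 of_nat_0 mult_zero_left add_0_right
    proof (rule sum.cong[OF refl])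
      fix i assume "i \<in> {..n}"
      then have "Suc n - i = Suc (n - i)" by auto
      then show "real (Suc n - i) * ((- q t) ^ i * p t ^ (Suc n - i - 1)
         / (fact i * fact (Suc n - i) * pochhammer c i * pochhammer d (Suc n - i)))
         = (- q t) ^ i * p t ^ (n - i)
         / (fact i * fact (n - i) * pochhammer c i * pochhammer (d + 1) (n - i)) / d"
        by (simp add: pochhammer_rec field_simps del: of_nat_Suc)
    qed
    thus ?thesis by (simp add: Suc jacS_prev_def jacS_def sum_divide_distrib)
  qed
  also have "(\<Sum>i\<le>m. real i * ((- q t) ^ (i - 1) * p t ^ (m - i)
         / (fact i * fact (m - i) * pochhammer c i * pochhammer d (m - i))))
     = jacS_prev m (c + 1) d (p t) (q t) / c"
  proof -
    have "(\<Sum>i\<le>m. real i * ((- q t) ^ (i - 1) * p t ^ (m - i)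
         / (fact i * fact (m - i) * pochhammer c i * pochhammer d (m - i))))
       = (\<Sum>i\<le>n. (- q t) ^ i * p t ^ (n - i)
         / (fact i * fact (n - i) * pochhammer (c + 1) i * pochhammer d (n - i)) / c)"
      unfolding Suc
      by (subst sum.atMost_Suc_shift)
         (auto intro!: sum.cong simp: pochhammer_rec field_simps simp del: of_nat_Suc)
    thus ?thesis by (simp add: Suc jacS_prev_def jacS_def sum_divide_distrib)
  qed
  finally show ?thesis by simp
qed (simp add: jacS_prev_def)

section \<open>Homogeneous big -1 Jacobi polynomials\<close>

text \<open>
  With \<open>\<beta> = c - 1/2\<close> and \<open>\<alpha> = d - 1/2\<close> this is, up to a constant, the polynomial obtained from
  \<open>J\<^sub>n(x1/x2; 2\<beta>, 2\<alpha>, -x0/x2)\<close> by clearing denominators.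
\<close>

definition jacp :: "nat \<Rightarrow> real \<Rightarrow> real \<Rightarrow> real \<Rightarrow> real \<Rightarrow> real \<Rightarrow> real" where
  "jacp n c d x2 x1 x0 =
    (let m = n div 2; p = x1\<^sup>2 - x0\<^sup>2; q = x2\<^sup>2 - x1\<^sup>2 in
     if even n then jacS m c d p q
       - (x1 - x0) * (x2 - x1) * (jacS_prev m (c + 1) (d + 1) p q / (c * d))
     else (x1 - x0) * (jacS m c (d + 1) p q / d) - (x2 - x1) * (jacS m (c + 1) d p q / c))"

definition jacp_prev :: "nat \<Rightarrow> real \<Rightarrow> real \<Rightarrow> real \<Rightarrow> real \<Rightarrow> real \<Rightarrow> real" where
  "jacp_prev n c d x2 x1 x0 = (if n = 0 then 0 else jacp (n - 1) c d x2 x1 x0)"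

text \<open>The reflection term of a Dunkl operator in the first variable; after the division by x2
  it is again a polynomial. \<open>mid_odd\<close> plays the same part for the second
  variable.\<close>

definition top_odd :: "nat \<Rightarrow> real \<Rightarrow> real \<Rightarrow> real \<Rightarrow> real \<Rightarrow> real \<Rightarrow> real" where
  "top_odd n c d x2 x1 x0 = (jacp n c d x2 x1 x0 - jacp n c d (- x2) x1 x0) / (2 * x2)"

definition mid_odd :: "nat \<Rightarrow> real \<Rightarrow> real \<Rightarrow> real \<Rightarrow> real \<Rightarrow> real \<Rightarrow> real" where
  "mid_odd n c d x2 x1 x0 = (jacp n c d x2 x1 x0 - jacp n c d x2 (- x1) x0) / (2 * x1)"

lemma jacp_even: "jacp (2 * m) c d x2 x1 x0 =
    jacS m c d (x1\<^sup>2 - x0\<^sup>2) (x2\<^sup>2 - x1\<^sup>2)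
    - (x1 - x0) * (x2 - x1) * (jacS_prev m (c + 1) (d + 1) (x1\<^sup>2 - x0\<^sup>2) (x2\<^sup>2 - x1\<^sup>2) / (c * d))"
  by (simp add: jacp_def Let_def)

lemma jacp_odd: "jacp (Suc (2 * m)) c d x2 x1 x0 =
    (x1 - x0) * (jacS m c (d + 1) (x1\<^sup>2 - x0\<^sup>2) (x2\<^sup>2 - x1\<^sup>2) / d)
    - (x2 - x1) * (jacS m (c + 1) d (x1\<^sup>2 - x0\<^sup>2) (x2\<^sup>2 - x1\<^sup>2) / c)"
  by (simp add: jacp_def Let_def)

lemma jacp_prev_even: "jacp_prev (2 * m) c d x2 x1 x0 =
    (x1 - x0) * (jacS_prev m c (d + 1) (x1\<^sup>2 - x0\<^sup>2) (x2\<^sup>2 - x1\<^sup>2) / d)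
    - (x2 - x1) * (jacS_prev m (c + 1) d (x1\<^sup>2 - x0\<^sup>2) (x2\<^sup>2 - x1\<^sup>2) / c)"
proof (cases m)
  case (Suc k)
  have "2 * m - 1 = Suc (2 * k)" using Suc by simp
  then show ?thesis
    by (simp add: jacp_prev_def jacS_prev_def jacp_odd Suc)
qed (simp add: jacp_prev_def jacS_prev_def)

lemma jacp_prev_odd: "jacp_prev (Suc (2 * m)) c d x2 x1 x0 = jacp (2 * m) c d x2 x1 x0"
  by (simp add: jacp_prev_def)

lemma jacp_Suc_odd: "jacp (Suc (Suc (2 * m))) c d x2 x1 x0 =
    jacS (Suc m) c d (x1\<^sup>2 - x0\<^sup>2) (x2\<^sup>2 - x1\<^sup>2)
    - (x1 - x0) * (x2 - x1) * (jacS m (c + 1) (d + 1) (x1\<^sup>2 - x0\<^sup>2) (x2\<^sup>2 - x1\<^sup>2) / (c * d))"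
  using jacp_even[of "Suc m"] by (simp add: jacS_prev_def)

lemma top_odd_even: "x2 \<noteq> 0 \<Longrightarrow> top_odd (2 * m) c d x2 x1 x0 =
    - (x1 - x0) * (jacS_prev m (c + 1) (d + 1) (x1\<^sup>2 - x0\<^sup>2) (x2\<^sup>2 - x1\<^sup>2) / (c * d))"
  unfolding top_odd_def jacp_even power2_minus
  by (simp only: nonzero_divide_eq_eq mult_eq_0_iff zero_neq_numeral simp_thms) algebra

lemma top_odd_odd: "x2 \<noteq> 0 \<Longrightarrow> top_odd (Suc (2 * m)) c d x2 x1 x0 =
    - (jacS m (c + 1) d (x1\<^sup>2 - x0\<^sup>2) (x2\<^sup>2 - x1\<^sup>2) / c)"
  unfolding top_odd_def jacp_odd power2_minus
  by (simp only: nonzero_divide_eq_eq mult_eq_0_iff zero_neq_numeral simp_thms) algebra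

lemma mid_odd_even: "x1 \<noteq> 0 \<Longrightarrow> mid_odd (2 * m) c d x2 x1 x0 =
    - (x2 + x0) * (jacS_prev m (c + 1) (d + 1) (x1\<^sup>2 - x0\<^sup>2) (x2\<^sup>2 - x1\<^sup>2) / (c * d))"
  unfolding mid_odd_def jacp_even power2_minus
  by (simp only: nonzero_divide_eq_eq mult_eq_0_iff zero_neq_numeral simp_thms) algebra

lemma mid_odd_odd: "x1 \<noteq> 0 \<Longrightarrow> mid_odd (Suc (2 * m)) c d x2 x1 x0 =
    jacS m c (d + 1) (x1\<^sup>2 - x0\<^sup>2) (x2\<^sup>2 - x1\<^sup>2) / d
    + jacS m (c + 1) d (x1\<^sup>2 - x0\<^sup>2) (x2\<^sup>2 - x1\<^sup>2) / c"
  unfolding mid_odd_def jacp_odd power2_minus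
  by (simp only: nonzero_divide_eq_eq mult_eq_0_iff zero_neq_numeral simp_thms) algebra

lemma nat_even_odd_cases:
  obtains (even) m where "n = 2 * m" | (odd) m where "n = Suc (2 * m)"
  by (metis evenE oddE Suc_eq_plus1)

lemma jacS_prev_next:
  assumes "c > 0" "d > 0"
  shows "(c + d + real m - 1) * (jacS_prev m (c + 1) (d + 1) p q / (c * d))
    = jacS_prev m c (d + 1) p q / d + jacS_prev m (c + 1) d p q / c"
  using jacS_next[OF assms, of "m - 1" p q] by (cases m) (simp_all add: jacS_prev_def algebra_simps)

text \<open>
  The parity-dependent coefficients of the structure relations below. \<open>\<kappa>\<close>, \<open>\<xi>\<close>, \<open>\<omega>\<close> belong to the factor in
  which the moving variable comes first, \<open>\<psi>\<close>, \<open>\<zeta>\<close>, \<open>\<eta>\<close>, \<open>y\<close> to the one in which it comes second.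
\<close>

definition top_kappa :: "nat \<Rightarrow> real \<Rightarrow> real" where
  "top_kappa n d = (if even n then real n / 2 else (real n - 1) / 2 + d)"

definition top_xi :: "nat \<Rightarrow> real \<Rightarrow> real \<Rightarrow> real" where
  "top_xi n c d = (if even n then real n / 2 + c else c + d + (real n - 1) / 2)"

definition top_omega :: "nat \<Rightarrow> real \<Rightarrow> real \<Rightarrow> real" where
  "top_omega n c d = (if even n then (real n / 2 + c) * (real n / 2 + d)
     else (real n + 1) / 2 * (c + d + (real n - 1) / 2))"

text \<open>The relation contains no derivative: in this family the reflection in x2 and
  multiplications already suffice to lower the degree. Even n rests on Euler's identity and
  \<open>jacS_prev_next\<close>, odd n on the two weight relations.\<close>

lemma top_lower:
  assumes "c > 0" "d > 0" "x2 \<noteq> 0"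
  shows "(x2 + (-1) ^ n * x0) * jacp_prev n c d x2 x1 x0
    = top_kappa n d * jacp n c d x2 x1 x0 - (c + d + real n - 1) * (x2 - x1) * top_odd n c d x2 x1 x0"
proof (cases n rule: nat_even_odd_cases)
  case (even m)
  let ?p = "x1\<^sup>2 - x0\<^sup>2" and ?q = "x2\<^sup>2 - x1\<^sup>2"
  define A U Sp Sq where defs: "A = jacS m c d ?p ?q"
    "U = jacS_prev m (c + 1) (d + 1) ?p ?q / (c * d)"
    "Sp = jacS_prev m c (d + 1) ?p ?q / d" "Sq = jacS_prev m (c + 1) d ?p ?q / c"
  have r1: "real m * A = ?p * Sp - ?q * Sq"
    using jacS_euler[OF assms(1,2), of m ?p ?q] by (simp add: defs)
  have r2: "(c + d + real m - 1) * U = Sp + Sq"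
    using jacS_prev_next[OF assms(1,2), of m ?p ?q] by (simp add: defs)
  have "(x2 + x0) * ((x1 - x0) * Sp - (x2 - x1) * Sq)
    = real m * (A - (x1 - x0) * (x2 - x1) * U)
      - (c + d + 2 * real m - 1) * (x2 - x1) * (- (x1 - x0) * U)"
    using r1 r2 by algebra
  then show ?thesis
    by (simp add: even jacp_even jacp_prev_even top_odd_even[OF assms(3)] top_kappa_def defs[symmetric])
next
  case (odd m)
  let ?p = "x1\<^sup>2 - x0\<^sup>2" and ?q = "x2\<^sup>2 - x1\<^sup>2"
  define A U X Y where defs: "A = jacS m c d ?p ?q"
    "U = jacS_prev m (c + 1) (d + 1) ?p ?q / (c * d)"
    "X = jacS m c (d + 1) ?p ?q / d" "Y = jacS m (c + 1) d ?p ?q / c"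
  have r3: "(real m + d) * X = A - ?q * U"
    using jacS_weight_right[OF assms(1,2), of m ?p ?q] by (simp add: defs)
  have r4: "(real m + c) * Y = A + ?p * U"
    using jacS_weight_left[OF assms(1,2), of m ?p ?q] by (simp add: defs)
  have "(x2 - x0) * (A - (x1 - x0) * (x2 - x1) * U)
    = (real m + d) * ((x1 - x0) * X - (x2 - x1) * Y)
      - (c + d + (2 * real m + 1) - 1) * (x2 - x1) * (- Y)"
    using r3 r4 by algebra
  then show ?thesis
    by (simp add: odd jacp_even jacp_odd jacp_prev_odd top_odd_odd[OF assms(3)] top_kappa_def defs[symmetric])
qed

text \<open>Companion of \<open>top_lower\<close>, with x2 - (-1)^n x0 in place of x2 + (-1)^n x0.
  Each of these two factors has its counterpart in the relations for the second variable, which is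
  what \<open>casimir_product\<close> exploits.\<close>

lemma top_raise:
  assumes "c > 0" "d > 0" "x2 \<noteq> 0"
  shows "(c + d + real n) * ((x2 - x1) * jacp n c d (- x2) x1 x0)
    = (x2 - (-1) ^ n * x0) * (top_xi n c d * jacp n c d x2 x1 x0
        - (c + d + real n) * (x2 - x1) * top_odd n c d x2 x1 x0)
      - top_omega n c d * jacp (Suc n) c d x2 x1 x0"
proof (cases n rule: nat_even_odd_cases)
  case (even m)
  let ?p = "x1\<^sup>2 - x0\<^sup>2" and ?q = "x2\<^sup>2 - x1\<^sup>2"
  define A U X Y where defs: "A = jacS m c d ?p ?q"
    "U = jacS_prev m (c + 1) (d + 1) ?p ?q / (c * d)"
    "X = jacS m c (d + 1) ?p ?q / d" "Y = jacS m (c + 1) d ?p ?q / c"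
  have r3: "(real m + d) * X = A - ?q * U"
    using jacS_weight_right[OF assms(1,2), of m ?p ?q] by (simp add: defs)
  have r4: "(real m + c) * Y = A + ?p * U"
    using jacS_weight_left[OF assms(1,2), of m ?p ?q] by (simp add: defs)
  have "(c + d + 2 * real m) * ((x2 - x1) * (A - (x1 - x0) * (- x2 - x1) * U))
    = (x2 - x0) * ((real m + c) * (A - (x1 - x0) * (x2 - x1) * U)
        - (c + d + 2 * real m) * (x2 - x1) * (- (x1 - x0) * U))
      - (real m + c) * (real m + d) * ((x1 - x0) * X - (x2 - x1) * Y)"
    using r3 r4 by algebra
  then show ?thesis
    by (simp add: even jacp_even jacp_odd top_odd_even[OF assms(3)] top_xi_def top_omega_def defs[symmetric])
next
  case (odd m)
  let ?p = "x1\<^sup>2 - x0\<^sup>2" and ?q = "x2\<^sup>2 - x1\<^sup>2"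
  define A U X Y where defs: "A = jacS (Suc m) c d ?p ?q"
    "U = jacS m (c + 1) (d + 1) ?p ?q / (c * d)"
    "X = jacS m c (d + 1) ?p ?q / d" "Y = jacS m (c + 1) d ?p ?q / c"
  have r1: "(real m + 1) * A = ?p * X - ?q * Y"
    using jacS_euler[OF assms(1,2), of "Suc m" ?p ?q] by (simp add: defs jacS_prev_def algebra_simps)
  have r2: "(c + d + real m) * U = X + Y"
    using jacS_next[OF assms(1,2), of m ?p ?q] by (simp add: defs)
  have k: "real (Suc (2 * m)) = 2 * real m + 1" "(- 1) ^ Suc (2 * m) = (- 1 :: real)"
    "top_xi (Suc (2 * m)) c d = c + d + real m"
    "top_omega (Suc (2 * m)) c d = (real m + 1) * (c + d + real m)"
    by (simp_all add: top_xi_def top_omega_def)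
  show ?thesis
    unfolding odd k jacp_Suc_odd jacp_odd top_odd_odd[OF assms(3)] power2_minus defs[symmetric]
    using r1 r2 by algebra
qed

section \<open>Derivatives, and the first variable\<close>

lemma square_neq_factors:
  fixes a b :: real
  assumes "a\<^sup>2 \<noteq> b\<^sup>2"
  shows "a\<^sup>2 - b\<^sup>2 \<noteq> 0" "a - b \<noteq> 0" "a + b \<noteq> 0"
proof -
  have "a\<^sup>2 - b\<^sup>2 = (a - b) * (a + b)" by algebra
  then show "a\<^sup>2 - b\<^sup>2 \<noteq> 0" "a - b \<noteq> 0" "a + b \<noteq> 0"
    using assms by auto
qed

text \<open>The shift relation solved for its term of lower degree. It keeps derivatives within the
  parameters c, c + 1, d, d + 1, at the price of a division by p.\<close>

lemma jacS_prev_right: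
  assumes "c > 0" "d > 0" "p \<noteq> 0"
  shows "jacS_prev m c (d + 2) p q / (d + 1) = d * (jacS m c d p q - jacS m c (d + 1) p q) / p"
proof -
  have "d + 1 \<noteq> 0" using assms by simp
  then show ?thesis
    unfolding jacS_shift_right[OF assms(1,2), of m p q] using assms by (simp add: divide_simps)
qed

lemma jacS_prev_left:
  assumes "c > 0" "d > 0" "q \<noteq> 0"
  shows "jacS_prev m (c + 2) d p q / (c + 1) = c * (jacS m (c + 1) d p q - jacS m c d p q) / q"
proof -
  have "c + 1 \<noteq> 0" using assms by simp
  then show ?thesis
    unfolding jacS_shift_left[OF assms(1,2), of m p q] using assms by (simp add: divide_simps)
qed

text \<open>The plain derivative would involve c + 2 and d + 2; eliminating them by the shift
  relations closes the system on the few functions that make up \<open>jacp\<close>.\<close>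

lemma jacS_prev_deriv:
  assumes "c > 0" "d > 0" "p t \<noteq> 0" "q t \<noteq> 0"
    and "(p has_real_derivative p') (at t)" "(q has_real_derivative q') (at t)"
  shows "((\<lambda>t. jacS_prev m (c + 1) (d + 1) (p t) (q t) / (c * d)) has_real_derivative
      p' * (jacS_prev m (c + 1) d (p t) (q t) / c
        - d * (jacS_prev m (c + 1) (d + 1) (p t) (q t) / (c * d))) / p t
      + q' * (jacS_prev m c (d + 1) (p t) (q t) / d
        - c * (jacS_prev m (c + 1) (d + 1) (p t) (q t) / (c * d))) / q t) (at t)"
proof (cases m)
  case (Suc n)
  have a: "jacS_prev n (c + 1) (d + 2) (p t) (q t) / (d + 1)
     = d * (jacS n (c + 1) d (p t) (q t) - jacS n (c + 1) (d + 1) (p t) (q t)) / p t"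
    using jacS_prev_right[of "c + 1" d "p t" n "q t"] assms(1-4) by simp
  have b: "jacS_prev n (c + 2) (d + 1) (p t) (q t) / (c + 1)
     = c * (jacS n (c + 1) (d + 1) (p t) (q t) - jacS n c (d + 1) (p t) (q t)) / q t"
    using jacS_prev_left[of c "d + 1" "q t" n "p t"] assms(1-4) by simp
  have "((\<lambda>t. jacS n (c + 1) (d + 1) (p t) (q t)) has_real_derivative
      p' * (jacS_prev n (c + 1) (d + 2) (p t) (q t) / (d + 1))
      - q' * (jacS_prev n (c + 2) (d + 1) (p t) (q t) / (c + 1))) (at t)"
    using jacS_deriv[of "c + 1" "d + 1" p p' t q q' n] assms by (simp add: add.assoc)
  moreover have "jacS_prev m = jacS n"
    by (intro ext) (simp add: Suc jacS_prev_def)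
  ultimately show ?thesis
    using DERIV_cdivide[of _ _ t UNIV "c * d"] assms(1-4) unfolding a b
    by (auto intro!: DERIV_cong[OF DERIV_cdivide[of _ _ t UNIV "c * d"]] simp: divide_simps algebra_simps)
qed (simp add: jacS_prev_def)

lemma jacS_right_deriv:
  assumes "c > 0" "d > 0" "p t \<noteq> 0"
    and "(p has_real_derivative p') (at t)" "(q has_real_derivative q') (at t)"
  shows "((\<lambda>t. jacS m c (d + 1) (p t) (q t) / d) has_real_derivative
      p' * (jacS m c d (p t) (q t) - d * (jacS m c (d + 1) (p t) (q t) / d)) / p t
      - q' * (jacS_prev m (c + 1) (d + 1) (p t) (q t) / (c * d))) (at t)"
proof -
  have a: "jacS_prev m c (d + 2) (p t) (q t) / (d + 1)
     = d * (jacS m c d (p t) (q t) - jacS m c (d + 1) (p t) (q t)) / p t"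
    by (rule jacS_prev_right[OF assms(1-3)])
  have "((\<lambda>t. jacS m c (d + 1) (p t) (q t)) has_real_derivative
      p' * (jacS_prev m c (d + 2) (p t) (q t) / (d + 1))
      - q' * (jacS_prev m (c + 1) (d + 1) (p t) (q t) / c)) (at t)"
    using jacS_deriv[of c "d + 1" p p' t q q' m] assms by (simp add: add.assoc)
  from DERIV_cdivide[OF this[unfolded a], of d] show ?thesis
    by (rule DERIV_cong) (use assms(1-3) in \<open>simp add: field_simps\<close>)
qed

lemma jacS_left_deriv:
  assumes "c > 0" "d > 0" "q t \<noteq> 0"
    and "(p has_real_derivative p') (at t)" "(q has_real_derivative q') (at t)"
  shows "((\<lambda>t. jacS m (c + 1) d (p t) (q t) / c) has_real_derivative
      p' * (jacS_prev m (c + 1) (d + 1) (p t) (q t) / (c * d))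
      + q' * (jacS m c d (p t) (q t) - c * (jacS m (c + 1) d (p t) (q t) / c)) / q t) (at t)"
proof -
  have b: "jacS_prev m (c + 2) d (p t) (q t) / (c + 1)
     = c * (jacS m (c + 1) d (p t) (q t) - jacS m c d (p t) (q t)) / q t"
    by (rule jacS_prev_left[OF assms(1-3)])
  have "((\<lambda>t. jacS m (c + 1) d (p t) (q t)) has_real_derivative
      p' * (jacS_prev m (c + 1) (d + 1) (p t) (q t) / d)
      - q' * (jacS_prev m (c + 2) d (p t) (q t) / (c + 1))) (at t)"
    using jacS_deriv[of "c + 1" d p p' t q q' m] assms by (simp add: add.assoc)
  from DERIV_cdivide[OF this[unfolded b], of c] show ?thesis
    by (rule DERIV_cong) (use assms(1-3) in \<open>simp add: field_simps\<close>)
qed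

text \<open>The function s -> p(-s) is differentiated because the Casimir operator contains the
  derivative only in this reflected form. The result involves degree n - 1 and the odd part, the two
  quantities tied together by \<open>top_lower\<close>.\<close>

lemma top_deriv:
  assumes "c > 0" "d > 0" "x2 \<noteq> 0" "x1\<^sup>2 \<noteq> x0\<^sup>2" "x2\<^sup>2 \<noteq> x1\<^sup>2"
  shows "((\<lambda>s. jacp n c d (- s) x1 x0) has_real_derivative
     2 * x2 * (jacp_prev n c d x2 x1 x0 + c * top_odd n c d x2 x1 x0) / (x2 - x1)
       - top_odd n c d x2 x1 x0) (at x2)"
proof (cases n rule: nat_even_odd_cases)
  case (even m)
  let ?p = "\<lambda>s::real. x1\<^sup>2 - x0\<^sup>2" and ?q = "\<lambda>s. s\<^sup>2 - x1\<^sup>2"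
  have nz: "?p x2 \<noteq> 0" "?q x2 \<noteq> 0" "x2 - x1 \<noteq> 0" "x2 + x1 \<noteq> 0"
    using square_neq_factors[OF assms(4)] square_neq_factors[OF assms(5)] by simp_all
  have dp: "(?p has_real_derivative 0) (at x2)" by simp
  have dq: "(?q has_real_derivative 2 * x2) (at x2)"
    by (auto intro!: derivative_eq_intros)
  define A U Sp Sq where defs: "A = jacS m c d (?p x2) (?q x2)"
    "U = jacS_prev m (c + 1) (d + 1) (?p x2) (?q x2) / (c * d)"
    "Sp = jacS_prev m c (d + 1) (?p x2) (?q x2) / d" "Sq = jacS_prev m (c + 1) d (?p x2) (?q x2) / c"
  have dA: "((\<lambda>s. jacS m c d (?p s) (?q s)) has_real_derivative - (2 * x2) * Sq) (at x2)"
    using jacS_deriv[OF assms(1,2) dp dq, of m] by (simp add: defs)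
  have dU: "((\<lambda>s. jacS_prev m (c + 1) (d + 1) (?p s) (?q s) / (c * d)) has_real_derivative
      2 * x2 * (Sp - c * U) / (x2\<^sup>2 - x1\<^sup>2)) (at x2)"
    using jacS_prev_deriv[OF assms(1,2) nz(1,2) dp dq, of m]
    by (rule DERIV_cong) (simp add: defs)
  have "((\<lambda>s. jacS m c d (?p s) (?q s) - (x1 - x0) * (- s - x1) *
       (jacS_prev m (c + 1) (d + 1) (?p s) (?q s) / (c * d))) has_real_derivative
      - (2 * x2) * Sq - ((- (x1 - x0)) * U
        + (x1 - x0) * (- x2 - x1) * (2 * x2 * (Sp - c * U) / (x2\<^sup>2 - x1\<^sup>2)))) (at x2)"
    by (rule derivative_eq_intros dA dU refl)+ (simp add: defs algebra_simps)
  moreover have "- (2 * x2) * Sq - ((- (x1 - x0)) * U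
        + (x1 - x0) * (- x2 - x1) * (2 * x2 * (Sp - c * U) / (x2\<^sup>2 - x1\<^sup>2)))
     = 2 * x2 * ((x1 - x0) * Sp - (x2 - x1) * Sq + c * (- (x1 - x0) * U)) / (x2 - x1)
       - (- (x1 - x0) * U)"
  proof -
    have f: "x2\<^sup>2 - x1\<^sup>2 = (x2 - x1) * (x2 + x1)" by algebra
    show ?thesis unfolding f using nz(3,4) by (simp add: divide_simps) (simp add: algebra_simps)
  qed
  ultimately show ?thesis
    unfolding even jacp_even jacp_prev_even top_odd_even[OF assms(3)] power2_minus defs[symmetric]
    by (rule DERIV_cong)
next
  case (odd m)
  let ?p = "\<lambda>s::real. x1\<^sup>2 - x0\<^sup>2" and ?q = "\<lambda>s. s\<^sup>2 - x1\<^sup>2"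
  have nz: "?p x2 \<noteq> 0" "?q x2 \<noteq> 0" "x2 - x1 \<noteq> 0" "x2 + x1 \<noteq> 0"
    using square_neq_factors[OF assms(4)] square_neq_factors[OF assms(5)] by simp_all
  have dp: "(?p has_real_derivative 0) (at x2)" by simp
  have dq: "(?q has_real_derivative 2 * x2) (at x2)"
    by (auto intro!: derivative_eq_intros)
  define A U X Y where defs: "A = jacS m c d (?p x2) (?q x2)"
    "U = jacS_prev m (c + 1) (d + 1) (?p x2) (?q x2) / (c * d)"
    "X = jacS m c (d + 1) (?p x2) (?q x2) / d" "Y = jacS m (c + 1) d (?p x2) (?q x2) / c"
  have dX: "((\<lambda>s. jacS m c (d + 1) (?p s) (?q s) / d) has_real_derivative - (2 * x2) * U) (at x2)"
    using jacS_right_deriv[OF assms(1,2) nz(1) dp dq, of m] by (rule DERIV_cong) (simp add: defs)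
  have dY: "((\<lambda>s. jacS m (c + 1) d (?p s) (?q s) / c) has_real_derivative
      2 * x2 * (A - c * Y) / (x2\<^sup>2 - x1\<^sup>2)) (at x2)"
    using jacS_left_deriv[OF assms(1,2) nz(2) dp dq, of m] by (rule DERIV_cong) (simp add: defs)
  have "((\<lambda>s. (x1 - x0) * (jacS m c (d + 1) (?p s) (?q s) / d)
        - (- s - x1) * (jacS m (c + 1) d (?p s) (?q s) / c)) has_real_derivative
      (x1 - x0) * (- (2 * x2) * U) - (- Y
        + (- x2 - x1) * (2 * x2 * (A - c * Y) / (x2\<^sup>2 - x1\<^sup>2)))) (at x2)"
    by (rule derivative_eq_intros dX dY refl)+ (simp add: defs algebra_simps)
  moreover have "(x1 - x0) * (- (2 * x2) * U) - (- Y
        + (- x2 - x1) * (2 * x2 * (A - c * Y) / (x2\<^sup>2 - x1\<^sup>2)))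
     = 2 * x2 * (A - (x1 - x0) * (x2 - x1) * U + c * (- Y)) / (x2 - x1) - (- Y)"
  proof -
    have f: "x2\<^sup>2 - x1\<^sup>2 = (x2 - x1) * (x2 + x1)" by algebra
    show ?thesis unfolding f using nz(3,4) by (simp add: divide_simps) (simp add: algebra_simps)
  qed
  ultimately show ?thesis
    unfolding odd jacp_even jacp_odd jacp_prev_odd top_odd_odd[OF assms(3)] power2_minus defs[symmetric]
    by (rule DERIV_cong)
qed

section \<open>Structure relations in the second variable\<close>

definition mid_psi :: "nat \<Rightarrow> real \<Rightarrow> real \<Rightarrow> real" where
  "mid_psi n c d = (if even n then - real n / 2 else c + d + (real n - 1) / 2)"

definition mid_zeta :: "nat \<Rightarrow> real \<Rightarrow> real \<Rightarrow> real" where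
  "mid_zeta n c d = (if even n then - (real n / 2 + d) else c + d + (real n - 1) / 2)"

definition mid_eta :: "nat \<Rightarrow> real \<Rightarrow> real \<Rightarrow> real" where
  "mid_eta n c d = (if even n then real n / 2 + c else - ((real n - 1) / 2 + d))"

definition mid_y :: "nat \<Rightarrow> real \<Rightarrow> real" where
  "mid_y n c = (if even n then real n / 2 + c else - (real n + 1) / 2)"

text \<open>This is the eigenvalue equation of the Casimir operator solved for the derivative,
  whence the constant \<open>mid_psi\<close>; in contrast to \<open>top_deriv\<close> no other
  degree appears.\<close>

lemma mid_deriv:
  assumes "c > 0" "d > 0" "x1 \<noteq> 0" "x1\<^sup>2 \<noteq> x0\<^sup>2" "x2\<^sup>2 \<noteq> x1\<^sup>2"
  shows "((\<lambda>s. jacp n c d x2 (- s) x0) has_real_derivative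
     2 * x1 * ((d * (x2 - x1) * mid_odd n c d x2 x1 x0 + mid_psi n c d * jacp n c d x2 x1 x0) / (x1 - x0)
        - c * mid_odd n c d x2 x1 x0) / (x2 - x1) - mid_odd n c d x2 x1 x0) (at x1)"
proof (cases n rule: nat_even_odd_cases)
  case (even m)
  let ?p = "\<lambda>s. s\<^sup>2 - x0\<^sup>2" and ?q = "\<lambda>s. x2\<^sup>2 - s\<^sup>2"
  have psi: "mid_psi (2 * m) c d = - real m" by (simp add: mid_psi_def)
  have nz: "?p x1 \<noteq> 0" "?q x1 \<noteq> 0" "x2 - x1 \<noteq> 0" "x2 + x1 \<noteq> 0" "x1 - x0 \<noteq> 0" "x1 + x0 \<noteq> 0"
    using square_neq_factors[OF assms(4)] square_neq_factors[OF assms(5)] by simp_all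
  have dp: "(?p has_real_derivative 2 * x1) (at x1)"
    and dq: "(?q has_real_derivative - (2 * x1)) (at x1)"
    by (auto intro!: derivative_eq_intros)
  define A U Sp Sq where defs: "A = jacS m c d (?p x1) (?q x1)"
    "U = jacS_prev m (c + 1) (d + 1) (?p x1) (?q x1) / (c * d)"
    "Sp = jacS_prev m c (d + 1) (?p x1) (?q x1) / d" "Sq = jacS_prev m (c + 1) d (?p x1) (?q x1) / c"
  have r1: "real m * A = ?p x1 * Sp - ?q x1 * Sq"
    using jacS_euler[OF assms(1,2), of m "?p x1" "?q x1"] by (simp add: defs)
  have r2: "(c + d + real m - 1) * U = Sp + Sq"
    using jacS_prev_next[OF assms(1,2), of m "?p x1" "?q x1"] by (simp add: defs)
  have dA: "((\<lambda>s. jacS m c d (?p s) (?q s)) has_real_derivative 2 * x1 * (Sp + Sq)) (at x1)"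
    using jacS_deriv[OF assms(1,2) dp dq, of m] by (rule DERIV_cong) (simp add: defs algebra_simps)
  have dU: "((\<lambda>s. jacS_prev m (c + 1) (d + 1) (?p s) (?q s) / (c * d)) has_real_derivative
      2 * x1 * (Sq - d * U) / (x1\<^sup>2 - x0\<^sup>2) - 2 * x1 * (Sp - c * U) / (x2\<^sup>2 - x1\<^sup>2)) (at x1)"
    using jacS_prev_deriv[where p = ?p and q = ?q, OF assms(1,2) nz(1,2) dp dq, of m]
    by (rule DERIV_cong) (simp add: defs)
  have "((\<lambda>s. jacS m c d (?p s) (?q s) - (- s - x0) * (x2 - - s) *
       (jacS_prev m (c + 1) (d + 1) (?p s) (?q s) / (c * d))) has_real_derivative
      2 * x1 * (Sp + Sq) - ((- (x2 + x1) + (- x1 - x0)) * U + (- x1 - x0) * (x2 + x1) *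
       (2 * x1 * (Sq - d * U) / (x1\<^sup>2 - x0\<^sup>2) - 2 * x1 * (Sp - c * U) / (x2\<^sup>2 - x1\<^sup>2)))) (at x1)"
    by (rule derivative_eq_intros dA dU refl)+ (simp add: defs algebra_simps)
  moreover have "2 * x1 * (Sp + Sq) - ((- (x2 + x1) + (- x1 - x0)) * U + (- x1 - x0) * (x2 + x1) *
       (2 * x1 * (Sq - d * U) / (x1\<^sup>2 - x0\<^sup>2) - 2 * x1 * (Sp - c * U) / (x2\<^sup>2 - x1\<^sup>2)))
     = 2 * x1 * ((d * (x2 - x1) * (- (x2 + x0) * U) + (- real m) *
          (A - (x1 - x0) * (x2 - x1) * U)) / (x1 - x0)
        - c * (- (x2 + x0) * U)) / (x2 - x1) - (- (x2 + x0) * U)"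
  proof -
    have f: "x2\<^sup>2 - x1\<^sup>2 = (x2 - x1) * (x2 + x1)" "x1\<^sup>2 - x0\<^sup>2 = (x1 - x0) * (x1 + x0)" by algebra+
    \<comment> \<open>The prefactor cancels x1 + x0 in one quotient and x2 + x1 in the other, so
      that only the poles at x1 = x0 and x1 = x2 survive.\<close>
    have "(- x1 - x0) * (x2 + x1) *
       (2 * x1 * (Sq - d * U) / (x1\<^sup>2 - x0\<^sup>2) - 2 * x1 * (Sp - c * U) / (x2\<^sup>2 - x1\<^sup>2))
      = - (x2 + x1) * 2 * x1 * (Sq - d * U) / (x1 - x0) + (x1 + x0) * 2 * x1 * (Sp - c * U) / (x2 - x1)"
      unfolding f using nz(3-6) by (simp add: divide_simps) (simp add: algebra_simps)
    then show ?thesis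
      using nz(3,5) r1 r2 by (simp add: divide_simps) algebra
  qed
  ultimately show ?thesis
    unfolding even jacp_even mid_odd_even[OF assms(3)] power2_minus psi defs[symmetric]
    by (rule DERIV_cong)
next
  case (odd m)
  let ?p = "\<lambda>s. s\<^sup>2 - x0\<^sup>2" and ?q = "\<lambda>s. x2\<^sup>2 - s\<^sup>2"
  have psi: "mid_psi (Suc (2 * m)) c d = c + d + real m" by (simp add: mid_psi_def)
  have nz: "?p x1 \<noteq> 0" "?q x1 \<noteq> 0" "x2 - x1 \<noteq> 0" "x2 + x1 \<noteq> 0" "x1 - x0 \<noteq> 0" "x1 + x0 \<noteq> 0"
    using square_neq_factors[OF assms(4)] square_neq_factors[OF assms(5)] by simp_all
  have dp: "(?p has_real_derivative 2 * x1) (at x1)"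
    and dq: "(?q has_real_derivative - (2 * x1)) (at x1)"
    by (auto intro!: derivative_eq_intros)
  define A U X Y where defs: "A = jacS m c d (?p x1) (?q x1)"
    "U = jacS_prev m (c + 1) (d + 1) (?p x1) (?q x1) / (c * d)"
    "X = jacS m c (d + 1) (?p x1) (?q x1) / d" "Y = jacS m (c + 1) d (?p x1) (?q x1) / c"
  have r3: "(real m + d) * X = A - ?q x1 * U"
    using jacS_weight_right[OF assms(1,2), of m "?p x1" "?q x1"] by (simp add: defs)
  have r4: "(real m + c) * Y = A + ?p x1 * U"
    using jacS_weight_left[OF assms(1,2), of m "?p x1" "?q x1"] by (simp add: defs)
  have dX: "((\<lambda>s. jacS m c (d + 1) (?p s) (?q s) / d) has_real_derivative
      2 * x1 * (A - d * X) / (x1\<^sup>2 - x0\<^sup>2) + 2 * x1 * U) (at x1)"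
    using jacS_right_deriv[where p = ?p and q = ?q, OF assms(1,2) nz(1) dp dq, of m]
    by (rule DERIV_cong) (simp add: defs)
  have dY: "((\<lambda>s. jacS m (c + 1) d (?p s) (?q s) / c) has_real_derivative
      2 * x1 * U - 2 * x1 * (A - c * Y) / (x2\<^sup>2 - x1\<^sup>2)) (at x1)"
    using jacS_left_deriv[where p = ?p and q = ?q, OF assms(1,2) nz(2) dp dq, of m]
    by (rule DERIV_cong) (simp add: defs)
  have "((\<lambda>s. (- s - x0) * (jacS m c (d + 1) (?p s) (?q s) / d)
        - (x2 - - s) * (jacS m (c + 1) d (?p s) (?q s) / c)) has_real_derivative
      - X + (- x1 - x0) * (2 * x1 * (A - d * X) / (x1\<^sup>2 - x0\<^sup>2) + 2 * x1 * U)
      - (Y + (x2 + x1) * (2 * x1 * U - 2 * x1 * (A - c * Y) / (x2\<^sup>2 - x1\<^sup>2)))) (at x1)"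
    by (rule derivative_eq_intros dX dY refl)+ (simp add: defs algebra_simps)
  moreover have "- X + (- x1 - x0) * (2 * x1 * (A - d * X) / (x1\<^sup>2 - x0\<^sup>2) + 2 * x1 * U)
      - (Y + (x2 + x1) * (2 * x1 * U - 2 * x1 * (A - c * Y) / (x2\<^sup>2 - x1\<^sup>2)))
     = 2 * x1 * ((d * (x2 - x1) * (X + Y) + (c + d + real m) *
          ((x1 - x0) * X - (x2 - x1) * Y)) / (x1 - x0)
        - c * (X + Y)) / (x2 - x1) - (X + Y)"
  proof -
    have f: "x2\<^sup>2 - x1\<^sup>2 = (x2 - x1) * (x2 + x1)" "x1\<^sup>2 - x0\<^sup>2 = (x1 - x0) * (x1 + x0)" by algebra+
    have "(- x1 - x0) * (2 * x1 * (A - d * X) / (x1\<^sup>2 - x0\<^sup>2) + 2 * x1 * U)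
        = - (2 * x1 * (A - d * X) / (x1 - x0)) - (x1 + x0) * 2 * x1 * U"
      unfolding f using nz(3-6) by (simp add: divide_simps) (simp add: algebra_simps)
    moreover have "(x2 + x1) * (2 * x1 * U - 2 * x1 * (A - c * Y) / (x2\<^sup>2 - x1\<^sup>2))
        = (x2 + x1) * 2 * x1 * U - 2 * x1 * (A - c * Y) / (x2 - x1)"
      unfolding f using nz(3-6) by (simp add: divide_simps)
    ultimately show ?thesis
      using nz(3,5) r3 r4 by (simp add: divide_simps) algebra
  qed
  ultimately show ?thesis
    unfolding odd jacp_odd mid_odd_odd[OF assms(3)] power2_minus psi defs[symmetric]
    by (rule DERIV_cong)
qed

text \<open>Lowering the degree raises d by one and flips the sign of x0. These are the shifts
  caused by j12 -> j12 + 1, since there d = c1 + c2 + j12 and the last argument is (-1)^j12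
  x0.\<close>

lemma mid_lower:
  assumes "c > 0" "d > 0" "x1 \<noteq> 0" "x1\<^sup>2 \<noteq> x0\<^sup>2"
  shows "(x1 - x0) * (mid_zeta n c d * jacp_prev n c (d + 1) x2 x1 (- x0))
    = d * (d * (x2 - x1) * mid_odd n c d x2 x1 x0 + mid_psi n c d * jacp n c d x2 x1 x0)"
proof (cases n rule: nat_even_odd_cases)
  case (even m)
  let ?p = "x1\<^sup>2 - x0\<^sup>2" and ?q = "x2\<^sup>2 - x1\<^sup>2"
  define A U X R W where defs: "A = jacS m c d ?p ?q"
    "U = jacS_prev m (c + 1) (d + 1) ?p ?q / (c * d)"
    "X = jacS m c (d + 1) ?p ?q / d"
    "R = jacS_prev m c (d + 1 + 1) ?p ?q / (d + 1)" "W = jacS_prev m (c + 1) (d + 1) ?p ?q / c"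
  have r3: "(real m + d) * X = A - ?q * U"
    using jacS_weight_right[OF assms(1,2), of m ?p ?q] by (simp add: defs)
  have nz: "?p \<noteq> 0" using assms by simp
  have R: "R * ?p = d * (A - d * X)"
    using jacS_prev_right[OF assms(1,2) nz, of m ?q] assms(2) nz by (simp add: defs add.assoc)
  have W: "W = d * U" using assms by (simp add: defs)
  have k: "mid_zeta (2 * m) c d = - (real m + d)" "mid_psi (2 * m) c d = - real m"
    by (simp_all add: mid_zeta_def mid_psi_def)
  show ?thesis
    unfolding even k jacp_even jacp_prev_even mid_odd_even[OF assms(3)] power2_minus
      defs[symmetric] W
    using r3 R by algebra
next
  case (odd m)
  let ?p = "x1\<^sup>2 - x0\<^sup>2" and ?q = "x2\<^sup>2 - x1\<^sup>2"
  define U X Y V Z where defs: "U = jacS m (c + 1) (d + 1) ?p ?q / (c * d)"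
    "X = jacS m c (d + 1) ?p ?q / d" "Y = jacS m (c + 1) d ?p ?q / c"
    "V = jacS_prev m (c + 1) (d + 1 + 1) ?p ?q / (c * (d + 1))" "Z = jacS m c (d + 1) ?p ?q"
  have r2: "(c + d + real m) * U = X + Y"
    using jacS_next[OF assms(1,2), of m ?p ?q] by (simp add: defs)
  have nz: "?p \<noteq> 0" using assms by simp
  have c1: "c + 1 > 0" using assms by simp
  have "V * ?p = ?p * jacS_prev m (c + 1) (d + 2) ?p ?q / (c * (d + 1))"
    by (simp add: defs add.assoc)
  also have "?p * jacS_prev m (c + 1) (d + 2) ?p ?q
      = d * (d + 1) * (jacS m (c + 1) d ?p ?q - jacS m (c + 1) (d + 1) ?p ?q)"
    using jacS_shift_right[OF c1 assms(2), of m ?p ?q] assms(2)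
    by (simp add: divide_simps) (simp add: algebra_simps)
  finally have V: "V * ?p = d * (Y - d * U)"
    using assms(1,2) by (simp add: defs divide_simps)
  have Z: "Z = d * X" and dX: "d * X / d = X" using assms by (simp_all add: defs)
  have k: "mid_zeta (Suc (2 * m)) c d = c + d + real m" "mid_psi (Suc (2 * m)) c d = c + d + real m"
    by (simp_all add: mid_zeta_def mid_psi_def)
  show ?thesis
    unfolding odd k jacp_prev_odd jacp_odd jacp_even mid_odd_odd[OF assms(3)] power2_minus
      defs(2-4)[symmetric] defs(5)[symmetric] Z dX
    using r2 V by algebra
qed

text \<open>The opposite shift: the degree grows while d + 1 falls to d, as happens for j12 -> j12 -
  1.\<close>

lemma mid_raise:
  assumes "c > 0" "d > 0" "x1 \<noteq> 0" "x1\<^sup>2 \<noteq> x0\<^sup>2"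
  shows "d * (mid_y n c * jacp (Suc n) c d x2 x1 (- x0))
    = - d * (x2 - x1) * (jacp n c (d + 1) x2 (- x1) x0 + (x1 + x0) * mid_odd n c (d + 1) x2 x1 x0)
      + mid_eta n c (d + 1) * (x1 + x0) * jacp n c (d + 1) x2 x1 x0"
proof (cases n rule: nat_even_odd_cases)
  case (even m)
  let ?p = "x1\<^sup>2 - x0\<^sup>2" and ?q = "x2\<^sup>2 - x1\<^sup>2"
  define U X Y V Z where defs: "U = jacS m (c + 1) (d + 1) ?p ?q / (c * d)"
    "X = jacS m c (d + 1) ?p ?q / d" "Y = jacS m (c + 1) d ?p ?q / c"
    "V = jacS_prev m (c + 1) (d + 1 + 1) ?p ?q / (c * (d + 1))" "Z = jacS m c (d + 1) ?p ?q"
  have r2: "(c + d + real m) * U = X + Y"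
    using jacS_next[OF assms(1,2), of m ?p ?q] by (simp add: defs)
  have nz: "?p \<noteq> 0" using assms by simp
  have c1: "c + 1 > 0" using assms by simp
  have "V * ?p = ?p * jacS_prev m (c + 1) (d + 2) ?p ?q / (c * (d + 1))"
    by (simp add: defs add.assoc)
  also have "?p * jacS_prev m (c + 1) (d + 2) ?p ?q
      = d * (d + 1) * (jacS m (c + 1) d ?p ?q - jacS m (c + 1) (d + 1) ?p ?q)"
    using jacS_shift_right[OF c1 assms(2), of m ?p ?q] assms(2)
    by (simp add: divide_simps) (simp add: algebra_simps)
  finally have V: "V * ?p = d * (Y - d * U)"
    using assms(1,2) by (simp add: defs divide_simps)
  have Z: "Z = d * X" and dX: "d * X / d = X" using assms by (simp_all add: defs)
  have k: "mid_y (2 * m) c = real m + c" "mid_eta (2 * m) c (d + 1) = real m + c"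
    by (simp_all add: mid_y_def mid_eta_def)
  have "d * ((real m + c) * ((x1 - - x0) * X - (x2 - x1) * Y)) =
    - d * (x2 - x1) * (d * X - (- x1 - x0) * (x2 - - x1) * V + (x1 + x0) * (- (x2 + x0) * V))
    + (real m + c) * (x1 + x0) * (d * X - (x1 - x0) * (x2 - x1) * V)"
    using r2 V by algebra
  then show ?thesis
    unfolding even k jacp_even jacp_odd mid_odd_even[OF assms(3)] power2_minus
      defs(2-4)[symmetric] defs(5)[symmetric] Z dX .
next
  case (odd m)
  let ?p = "x1\<^sup>2 - x0\<^sup>2" and ?q = "x2\<^sup>2 - x1\<^sup>2"
  define A U X Y T where defs: "A = jacS (Suc m) c d ?p ?q"
    "U = jacS m (c + 1) (d + 1) ?p ?q / (c * d)"
    "X = jacS m c (d + 1 + 1) ?p ?q / (d + 1)" "Y = jacS m (c + 1) (d + 1) ?p ?q / c"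
    "T = jacS (Suc m) c (d + 1) ?p ?q / d"
  have nz: "?p \<noteq> 0" using assms by simp
  have X: "X * ?p = d * (A - d * T)"
    using jacS_prev_right[OF assms(1,2) nz, of "Suc m" ?q] assms(2) nz
    by (simp add: defs jacS_prev_def add.assoc)
  have T: "(real m + 1 + d) * T = A - ?q * U"
    using jacS_weight_right[OF assms(1,2), of "Suc m" ?p ?q] by (simp add: defs jacS_prev_def add_ac)
  have Y: "Y = d * U" using assms by (simp add: defs)
  have k: "mid_y (Suc (2 * m)) c = - (real m + 1)"
    "mid_eta (Suc (2 * m)) c (d + 1) = - (real m + 1 + d)"
    by (simp_all add: mid_y_def mid_eta_def)
  have d1: "mid_odd (Suc (2 * m)) c (d + 1) x2 x1 x0 = X + Y"
    using mid_odd_odd[OF assms(3), of m c "d + 1"] by (simp add: defs)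
  show ?thesis
    unfolding odd k jacp_Suc_odd jacp_odd d1 power2_minus defs(1-4)[symmetric] Y
    using X T by algebra
qed

section \<open>The intermediate Casimir operator\<close>

text \<open>
  A relation rather than a function, because the operator involves the derivative of \<open>s \<mapsto> f (- s)\<close>.
\<close>

definition casimir_image ::
    "real \<Rightarrow> real \<Rightarrow> real \<Rightarrow> real \<Rightarrow> (real \<Rightarrow> real) \<Rightarrow> real \<Rightarrow> real \<Rightarrow> bool" where
  "casimir_image c3 c2 x3 x1 f t k \<longleftrightarrow>
    (\<exists>D. ((\<lambda>s. f (- s)) has_real_derivative D) (at t) \<and>
      (let b = (f t - f (- t)) / (2 * t) in
       k = - (b * (c3 * (t - x1) - c2 * (x3 - t))) - (x3 - t) * (t - x1) * (D + b) / (2 * t)))"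

lemma casimir_image_unique:
  assumes "casimir_image c3 c2 x3 x1 f t k" "casimir_image c3 c2 x3 x1 f t l"
  shows "k = l"
  using assms unfolding casimir_image_def Let_def by (metis DERIV_unique)

text \<open>The operator sees f at t and -t and its derivative at -t, so agreement is required on an
  open set stable under s -> -s.\<close>

lemma casimir_image_cong:
  assumes "casimir_image c3 c2 x3 x1 f t k" "open S" "t \<in> S" "\<And>s. s \<in> S \<Longrightarrow> - s \<in> S"
    "\<And>s. s \<in> S \<Longrightarrow> f s = g s"
  shows "casimir_image c3 c2 x3 x1 g t k"
proof -
  obtain D where D: "((\<lambda>s. f (- s)) has_real_derivative D) (at t)"
    and k: "k = - ((f t - f (- t)) / (2 * t) * (c3 * (t - x1) - c2 * (x3 - t)))
      - (x3 - t) * (t - x1) * (D + (f t - f (- t)) / (2 * t)) / (2 * t)"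
    using assms(1) unfolding casimir_image_def Let_def by blast
  have "((\<lambda>s. g (- s)) has_real_derivative D) (at t)"
    by (rule has_field_derivative_transform_within_open[OF D assms(2,3)]) (use assms in auto)
  moreover have "f t = g t" "f (- t) = g (- t)" using assms by auto
  ultimately show ?thesis unfolding casimir_image_def Let_def using k by auto
qed

lemma casimir_image_cmult:
  assumes "casimir_image c3 c2 x3 x1 f t k"
  shows "casimir_image c3 c2 x3 x1 (\<lambda>s. a * f s) t (a * k)"
proof -
  obtain D where D: "((\<lambda>s. f (- s)) has_real_derivative D) (at t)"
    and k: "k = - ((f t - f (- t)) / (2 * t) * (c3 * (t - x1) - c2 * (x3 - t)))
      - (x3 - t) * (t - x1) * (D + (f t - f (- t)) / (2 * t)) / (2 * t)"
    using assms(1) unfolding casimir_image_def Let_def by blast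
  have "((\<lambda>s. a * f (- s)) has_real_derivative a * D) (at t)"
    by (rule DERIV_cmult[OF D])
  moreover have "(a * f t - a * f (- t)) / (2 * t) = a * ((f t - f (- t)) / (2 * t))"
    by (simp add: right_diff_distrib)
  then have "a * k = - ((a * f t - a * f (- t)) / (2 * t) * (c3 * (t - x1) - c2 * (x3 - t)))
      - (x3 - t) * (t - x1) * (a * D + (a * f t - a * f (- t)) / (2 * t)) / (2 * t)"
    by (simp add: k algebra_simps add_divide_distrib diff_divide_distrib)
  ultimately show ?thesis unfolding casimir_image_def Let_def by blast
qed

lemma casimir_image_add:
  assumes "casimir_image c3 c2 x3 x1 f t k" "casimir_image c3 c2 x3 x1 g t l"
  shows "casimir_image c3 c2 x3 x1 (\<lambda>s. f s + g s) t (k + l)"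
proof -
  obtain D where D: "((\<lambda>s. f (- s)) has_real_derivative D) (at t)"
    and k: "k = - ((f t - f (- t)) / (2 * t) * (c3 * (t - x1) - c2 * (x3 - t)))
      - (x3 - t) * (t - x1) * (D + (f t - f (- t)) / (2 * t)) / (2 * t)"
    using assms(1) unfolding casimir_image_def Let_def by blast
  obtain E where E: "((\<lambda>s. g (- s)) has_real_derivative E) (at t)"
    and l: "l = - ((g t - g (- t)) / (2 * t) * (c3 * (t - x1) - c2 * (x3 - t)))
      - (x3 - t) * (t - x1) * (E + (g t - g (- t)) / (2 * t)) / (2 * t)"
    using assms(2) unfolding casimir_image_def Let_def by blast
  have "((\<lambda>s. f (- s) + g (- s)) has_real_derivative D + E) (at t)"
    by (rule DERIV_add[OF D E])
  moreover have "(f t + g t - (f (- t) + g (- t))) / (2 * t)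
      = (f t - f (- t)) / (2 * t) + (g t - g (- t)) / (2 * t)"
    by (simp add: add_divide_distrib[symmetric])
  then have "k + l = - ((f t + g t - (f (- t) + g (- t))) / (2 * t) * (c3 * (t - x1) - c2 * (x3 - t)))
      - (x3 - t) * (t - x1) * (D + E + (f t + g t - (f (- t) + g (- t))) / (2 * t)) / (2 * t)"
  proof -
    have "- (p * W) - V * (D + p) / (2 * t) + (- (q * W) - V * (E + q) / (2 * t))
      = - ((p + q) * W) - V * (D + E + (p + q)) / (2 * t)" for p q V W
      by (simp add: add_divide_distrib diff_divide_distrib algebra_simps)
    then show ?thesis unfolding k l by (simp only: \<open>(f t + g t - (f (- t) + g (- t))) / (2 * t)
      = (f t - f (- t)) / (2 * t) + (g t - g (- t)) / (2 * t)\<close>)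
  qed
  ultimately show ?thesis unfolding casimir_image_def Let_def by blast
qed

lemma casimir_image_sum:
  assumes "finite A" "\<And>i. i \<in> A \<Longrightarrow> casimir_image c3 c2 x3 x1 (f i) t (k i)"
  shows "casimir_image c3 c2 x3 x1 (\<lambda>s. \<Sum>i\<in>A. a i * f i s) t (\<Sum>i\<in>A. a i * k i)"
  using assms
proof (induction A rule: finite_induct)
  case empty
  show ?case by (auto simp: casimir_image_def Let_def intro!: exI[of _ 0])
next
  case (insert i A)
  then show ?case by (auto intro!: casimir_image_add casimir_image_cmult)
qed

lemma casimir_eigenfunction:
  assumes "c3 > 0" "c2 > 0" "t \<noteq> 0" "t\<^sup>2 \<noteq> x1\<^sup>2" "x3\<^sup>2 \<noteq> t\<^sup>2"
  shows "casimir_image c3 c2 x3 x1 (\<lambda>s. jacp k c3 c2 x3 s x1) t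
    (- mid_psi k c3 c2 * jacp k c3 c2 x3 t x1)"
proof -
  define g b where gb: "g = jacp k c3 c2 x3 t x1" "b = mid_odd k c3 c2 x3 t x1"
  have nz: "x3 - t \<noteq> 0" "t - x1 \<noteq> 0"
    using square_neq_factors[OF assms(4)] square_neq_factors[OF assms(5)] by simp_all
  have odd: "(g - jacp k c3 c2 x3 (- t) x1) / (2 * t) = b"
    by (simp add: gb mid_odd_def)
  have eq: "- mid_psi k c3 c2 * g = - (b * (c3 * (t - x1) - c2 * (x3 - t))) - (x3 - t) * (t - x1) *
     (2 * t * ((c2 * (x3 - t) * b + mid_psi k c3 c2 * g) / (t - x1) - c3 * b) / (x3 - t) - b + b) / (2 * t)"
    using nz assms(3) by (simp add: divide_simps) (simp add: algebra_simps)
  show ?thesis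
    unfolding casimir_image_def Let_def
    by (rule exI, rule conjI[OF mid_deriv[OF assms]])
       (simp only: gb(1)[symmetric] gb(2)[symmetric] odd eq)
qed

text \<open>A product rule whose outcome has coefficients free of t. The relation lowering the first
  factor carries t + z, and so does the one raising the second; the relation raising the first
  carries t - z, and so does the one lowering the second. Multiplying within each pair leaves a
  constant multiple of a product of shifted polynomials. The bound d > 1 keeps the parameter d - 1
  of the raised second factor positive.\<close>

lemma casimir_product:
  fixes n M :: nat and c1 c2 c3 x0 x1 x3 t :: real
  defines "d \<equiv> c1 + c2 + real n" and "z \<equiv> (-1) ^ n * x0"
  assumes pos: "c1 > 0" "c2 > 0" "c3 > 0" "d > 1"
    and neq: "t \<noteq> 0" "x1\<^sup>2 \<noteq> x0\<^sup>2" "t\<^sup>2 \<noteq> x1\<^sup>2" "t\<^sup>2 \<noteq> x0\<^sup>2" "x3\<^sup>2 \<noteq> t\<^sup>2"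
  shows "casimir_image c3 c2 x3 x1 (\<lambda>s. jacp n c2 c1 s x1 x0 * jacp M c3 d x3 s z) t
    (mid_y M c3 * (jacp_prev n c2 c1 t x1 x0 * jacp (Suc M) c3 (d - 1) x3 t (- z))
     + mid_zeta M c3 d * top_omega n c2 c1 / d\<^sup>2 *
         (jacp (Suc n) c2 c1 t x1 x0 * jacp_prev M c3 (d + 1) x3 t (- z))
     - (top_kappa n c1 * mid_eta M c3 d / (d - 1) + mid_psi M c3 d * top_xi n c2 c1 / d)
         * (jacp n c2 c1 t x1 x0 * jacp M c3 d x3 t z))"
proof -
  have zz: "z\<^sup>2 = x0\<^sup>2"
    by (simp add: z_def power_mult_distrib power_mult[symmetric] mult.commute)
  have nz: "t - x1 \<noteq> 0" "x3 - t \<noteq> 0" "t - z \<noteq> 0" "t + z \<noteq> 0" "d > 0" "d - 1 > 0"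
    "d \<noteq> 0" "d - 1 \<noteq> 0" "t\<^sup>2 \<noteq> z\<^sup>2" "(-z)\<^sup>2 = z\<^sup>2"
    using square_neq_factors[OF neq(3)] square_neq_factors[OF neq(5)]
      square_neq_factors[OF neq(4)[folded zz]] pos neq zz by auto
  define f f' b fl fr where fdef: "f = jacp n c2 c1 t x1 x0" "f' = jacp n c2 c1 (- t) x1 x0"
    "b = top_odd n c2 c1 t x1 x0" "fl = jacp_prev n c2 c1 t x1 x0" "fr = jacp (Suc n) c2 c1 t x1 x0"
  define g g' e gl gr where gdef: "g = jacp M c3 d x3 t z" "g' = jacp M c3 d x3 (- t) z"
    "e = mid_odd M c3 d x3 t z" "gl = jacp_prev M c3 (d + 1) x3 t (- z)"
    "gr = jacp (Suc M) c3 (d - 1) x3 t (- z)"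
  \<comment> \<open>The part of the derivative of the second factor that is divided by t - z; by
    \<open>mlow\<close> below it is a constant multiple of the lowered second factor.\<close>
  define H where "H = (d * (x3 - t) * e + mid_psi M c3 d * g) / (t - z)"
  have f': "f' = f - 2 * t * b" and g': "g' = g - 2 * t * e"
    using neq(1) by (simp_all add: fdef gdef top_odd_def mid_odd_def)
  have F: "((\<lambda>s. jacp n c2 c1 (- s) x1 x0) has_real_derivative
      2 * t * (fl + c2 * b) / (t - x1) - b) (at t)"
    unfolding fdef by (rule top_deriv) (use pos neq in auto)
  have G: "((\<lambda>s. jacp M c3 d x3 (- s) z) has_real_derivative
      2 * t * (H - c3 * e) / (x3 - t) - e) (at t)"
    unfolding gdef H_def by (rule mid_deriv) (use pos neq nz in auto)
  have FG: "((\<lambda>s. jacp n c2 c1 (- s) x1 x0 * jacp M c3 d x3 (- s) z) has_real_derivative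
      (2 * t * (fl + c2 * b) / (t - x1) - b) * g' + (2 * t * (H - c3 * e) / (x3 - t) - e) * f') (at t)"
    using DERIV_mult[OF F G] by (simp add: fdef gdef)
  have low: "(t + z) * fl = top_kappa n c1 * f - (d - 1) * (t - x1) * b"
    using top_lower[OF pos(2,1) neq(1), of n x0 x1] by (simp add: fdef z_def d_def add_ac)
  have raise: "d * ((t - x1) * f') = (t - z) * (top_xi n c2 c1 * f - d * (t - x1) * b)
      - top_omega n c2 c1 * fr"
    using top_raise[OF pos(2,1) neq(1), of n x1 x0] by (simp add: fdef z_def d_def add_ac)
  have "(t - z) * (mid_zeta M c3 d * gl) = (t - z) * (d * H)"
    using mid_lower[OF pos(3) nz(5) neq(1) nz(9), of M x3] nz(3) by (simp add: gdef H_def)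
  then have mlow: "mid_zeta M c3 d * gl = d * H" using nz(3) by simp
  have H: "(t - z) * H = d * (x3 - t) * e + mid_psi M c3 d * g"
    using nz(3) by (simp add: H_def)
  have mraise: "(d - 1) * (mid_y M c3 * gr) = - (d - 1) * (x3 - t) * (g' + (t + z) * e)
      + mid_eta M c3 d * (t + z) * g"
    using mid_raise[OF pos(3) nz(6) neq(1) nz(9), of M x3] by (simp add: gdef)
  \<comment> \<open>The first identity cancels the terms in f * e, the second those in g * b; these
    are the terms whose coefficients still depend on t.\<close>
  have c: "top_kappa n c1 - top_xi n c2 c1 + c2 = 0" "mid_eta M c3 d + mid_psi M c3 d = c3"
    by (auto simp: top_kappa_def top_xi_def mid_eta_def mid_psi_def)
  have O: "(f * g - f' * g') / (2 * t) = f * e + g * b - 2 * t * b * e"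
    unfolding f' g' using neq(1) by (simp add: divide_simps) (simp add: algebra_simps)
  have DO: "(x3 - t) * (t - x1) * ((2 * t * (fl + c2 * b) / (t - x1) - b) * g'
      + (2 * t * (H - c3 * e) / (x3 - t) - e) * f' + (f * e + g * b - 2 * t * b * e)) / (2 * t)
    = (x3 - t) * (fl + c2 * b) * g' + (t - x1) * (H - c3 * e) * f' + (x3 - t) * (t - x1) * b * e"
    unfolding f' g' using nz(1,2) neq(1) by (simp add: divide_simps) (simp add: algebra_simps)
  have 1: "(x3 - t) * fl * g' = - mid_y M c3 * gr * fl
      - (x3 - t) * e * (top_kappa n c1 * f - (d - 1) * (t - x1) * b)
      + mid_eta M c3 d / (d - 1) * g * (top_kappa n c1 * f - (d - 1) * (t - x1) * b)"
  proof -
    have "(d - 1) * ((x3 - t) * fl * g') = (d - 1) * (- mid_y M c3 * gr * fl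
      - (x3 - t) * e * (top_kappa n c1 * f - (d - 1) * (t - x1) * b))
      + mid_eta M c3 d * g * (top_kappa n c1 * f - (d - 1) * (t - x1) * b)"
      using mraise low by algebra
    then show ?thesis using nz(8) by (simp add: divide_simps) (simp add: algebra_simps)
  qed
  have 2: "(t - x1) * H * f' = (d * (x3 - t) * e + mid_psi M c3 d * g)
       * (top_xi n c2 c1 * f / d - (t - x1) * b) - mid_zeta M c3 d * top_omega n c2 c1 / d\<^sup>2 * (fr * gl)"
  proof -
    have "d * (d * ((t - x1) * H * f')) = d * ((d * (x3 - t) * e + mid_psi M c3 d * g)
       * (top_xi n c2 c1 * f - d * (t - x1) * b)) - mid_zeta M c3 d * top_omega n c2 c1 * (fr * gl)"
      using raise mlow H by algebra
    then show ?thesis using nz(7)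
      by (simp add: divide_simps power2_eq_square) (simp add: algebra_simps)
  qed
  have eq: "mid_y M c3 * (fl * gr) + mid_zeta M c3 d * top_omega n c2 c1 / d\<^sup>2 * (fr * gl)
     - (top_kappa n c1 * mid_eta M c3 d / (d - 1) + mid_psi M c3 d * top_xi n c2 c1 / d) * (f * g)
    = - ((f * e + g * b - 2 * t * b * e) * (c3 * (t - x1) - c2 * (x3 - t)))
     - ((x3 - t) * (fl + c2 * b) * g' + (t - x1) * (H - c3 * e) * f' + (x3 - t) * (t - x1) * b * e)"
  proof -
    define r s where rs: "r = mid_eta M c3 d / (d - 1)" "s = top_xi n c2 c1 / d"
    define w where w: "w = mid_zeta M c3 d * top_omega n c2 c1 / d\<^sup>2 * (fr * gl)"
    have r: "r * (d - 1) = mid_eta M c3 d" and s: "s * d = top_xi n c2 c1"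
      using nz by (simp_all add: rs)
    have 1: "(x3 - t) * fl * g' = - mid_y M c3 * gr * fl
      - (x3 - t) * e * (top_kappa n c1 * f - (d - 1) * (t - x1) * b)
      + r * g * (top_kappa n c1 * f - (d - 1) * (t - x1) * b)"
      using 1 by (simp add: rs)
    have 2: "(t - x1) * H * f' = (d * (x3 - t) * e + mid_psi M c3 d * g)
       * (s * f - (t - x1) * b) - w"
      using 2 by (simp add: rs w)
    have 3: "(x3 - t) * (c2 * b) * g' = (x3 - t) * c2 * b * (g - 2 * t * e)"
      "(t - x1) * (c3 * e) * f' = (t - x1) * c3 * e * (f - 2 * t * b)"
      by (simp_all add: f' g')
    have "mid_y M c3 * (fl * gr) + w - (top_kappa n c1 * r + mid_psi M c3 d * s) * (f * g)
    = - ((f * e + g * b - 2 * t * b * e) * (c3 * (t - x1) - c2 * (x3 - t)))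
     - (((x3 - t) * fl * g' + (x3 - t) * (c2 * b) * g') + ((t - x1) * H * f' - (t - x1) * (c3 * e) * f')
       + (x3 - t) * (t - x1) * b * e)"
      unfolding 1 2 3 using c r s by algebra
    then show ?thesis by (simp add: rs w algebra_simps)
  qed
  show ?thesis
    unfolding casimir_image_def Let_def
    by (rule exI, rule conjI[OF FG])
       (simp only: fdef(1,2,4,5)[symmetric] gdef(1,2,4,5)[symmetric] O DO eq)
qed

section \<open>The hypergeometric representation\<close>

text \<open>The terminating series 2F1(-m, s; c; u/v), cleared of denominators by v^m.\<close>

definition jacQ :: "nat \<Rightarrow> real \<Rightarrow> real \<Rightarrow> real \<Rightarrow> real \<Rightarrow> real" where
  "jacQ m s c u v = (\<Sum>i\<le>m. pochhammer (- real m) i * pochhammer s i / (pochhammer c i * fact i)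
      * u ^ i * v ^ (m - i))"

lemma hyp2F1_terminating: "hyp2F1 (- real m) s c z =
    (\<Sum>i\<le>m. pochhammer (- real m) i * pochhammer s i / (pochhammer c i * fact i) * z ^ i)"
proof -
  have "(\<Sum>i. fps_nth (fps_hypergeo [- real m, s] [c] 1) i * z ^ i)
     = (\<Sum>i\<le>m. fps_nth (fps_hypergeo [- real m, s] [c] 1) i * z ^ i)"
    by (rule suminf_finite) (auto simp: pochhammer_of_nat_eq_0_lemma not_le)
  then show ?thesis by (simp add: hyp2F1_def eval_fps_def)
qed

lemma hyp2F1_eq_jacQ:
  assumes "v \<noteq> 0"
  shows "hyp2F1 (- real m) s c (u / v) * v ^ m = jacQ m s c u v"
  unfolding hyp2F1_terminating jacQ_def sum_distrib_right
proof (rule sum.cong[OF refl])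
  fix i assume "i \<in> {..m}"
  then have "v ^ m = v ^ i * v ^ (m - i)" by (simp add: power_add[symmetric])
  then show "pochhammer (- real m) i * pochhammer s i / (pochhammer c i * fact i) * (u / v) ^ i * v ^ m
    = pochhammer (- real m) i * pochhammer s i / (pochhammer c i * fact i) * u ^ i * v ^ (m - i)"
    using assms by (simp add: power_divide)
qed

lemma pochhammer_reflect: "pochhammer (1 - b) k = (- 1) ^ k * pochhammer (b - real k) k"
  using pochhammer_minus[of "b - 1" k] by (simp add: algebra_simps)

text \<open>After reflection of every rising factorial this is their binomial theorem, that is,
  Chu-Vandermonde.\<close>

lemma pochhammer_vandermonde:
  "(\<Sum>j\<le>i. real (i choose j) * pochhammer (a + real j) (i - j) * pochhammer (b - real j) j)
    = pochhammer (a + b - 1) i"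
proof -
  have "pochhammer (a + b - 1) i = (- 1) ^ i * pochhammer (1 - b + (1 - a - real i)) i"
    using pochhammer_reflect[of "a + b + real i - 1" i]
    by (simp add: power_mult_distrib[symmetric] mult.assoc[symmetric] algebra_simps)
  also have "\<dots> = (\<Sum>j\<le>i. (- 1) ^ i * (real (i choose j) * pochhammer (1 - b) j
      * pochhammer (1 - (a + real i)) (i - j)))"
    unfolding pochhammer_binomial_sum sum_distrib_left by (simp add: algebra_simps)
  also have "\<dots> = (\<Sum>j\<le>i. real (i choose j) * pochhammer (a + real j) (i - j)
      * pochhammer (b - real j) j)"
  proof (rule sum.cong[OF refl])
    fix j assume j: "j \<in> {..i}"
    have "(- 1 :: real) ^ i * (- 1) ^ j * (- 1) ^ (i - j) = 1"
      using j by (simp add: power_add[symmetric] flip: mult_2 power_mult)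
    then show "(- 1) ^ i * (real (i choose j) * pochhammer (1 - b) j
        * pochhammer (1 - (a + real i)) (i - j))
      = real (i choose j) * pochhammer (a + real j) (i - j) * pochhammer (b - real j) j"
      unfolding pochhammer_reflect using j by (simp add: of_nat_diff)
  qed
  finally show ?thesis ..
qed

lemma pochhammer_neg_nat:
  assumes "a \<le> m"
  shows "pochhammer (- real m) a = (- 1) ^ a * fact m / fact (m - a)"
proof -
  have "fact m = (pochhammer (real m - real a + 1) a * fact (m - a) :: real)"
    using pochhammer_product'[of "1 :: real" "m - a" a] assms
    by (simp add: pochhammer_fact of_nat_diff add_ac)
  then show ?thesis by (simp add: pochhammer_minus)
qed

text \<open>The expansion of a Jacobi polynomial at one endpoint against its expansion at both. The
  powers of p = v - q are expanded and the terms in q^i collected; the inner sum is then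
  \<open>pochhammer_vandermonde\<close>, which dictates the parameter m + c + d - 1.\<close>

lemma jacQ_eq_jacS:
  assumes "c > 0" "d > 0"
  shows "jacQ m (real m + c + d - 1) c q v = fact m * pochhammer d m * jacS m c d (v - q) q"
proof -
  let ?g = "\<lambda>j l. (- q) ^ j / (fact j * fact (m - j) * pochhammer c j * pochhammer d (m - j))
     * (real (m - j choose l) * (- q) ^ l * v ^ (m - j - l))"
  have "jacS m c d (v - q) q = (\<Sum>j\<le>m. \<Sum>l\<le>m - j. ?g j l)"
    unfolding jacS_def
  proof (rule sum.cong[OF refl])
    fix j
    have b: "(v - q) ^ (m - j) = (\<Sum>l\<le>m - j. real (m - j choose l) * (- q) ^ l * v ^ (m - j - l))"
      using binomial_ring[of "- q" v "m - j"] by simp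
    show "(- q) ^ j * (v - q) ^ (m - j)
        / (fact j * fact (m - j) * pochhammer c j * pochhammer d (m - j)) = (\<Sum>l\<le>m - j. ?g j l)"
      unfolding b sum_distrib_left[symmetric] by simp
  qed
  also have "\<dots> = (\<Sum>(j, l)\<in>(SIGMA j:{..m}. {..m - j}). ?g j l)"
    by (subst sum.Sigma) auto
  also have "(SIGMA j:{..m}. {..m - j}) = {(j, l). j + l \<le> m}" by auto
  also have "(\<Sum>(j, l)\<in>{(j, l). j + l \<le> m}. ?g j l) = (\<Sum>i\<le>m. \<Sum>j\<le>i. ?g j (i - j))"
    by (rule sum.triangle_reindex_eq)
  finally have S: "jacS m c d (v - q) q = (\<Sum>i\<le>m. \<Sum>j\<le>i. ?g j (i - j))" .
  show ?thesis
    unfolding S jacQ_def sum_distrib_left[of _ _ "{..m}"]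
  proof (rule sum.cong[OF refl])
    fix i assume "i \<in> {..m}"
    then have i: "i \<le> m" by simp
    have m: "pochhammer (- real m) i = (- 1) ^ i * fact m / fact (m - i)"
      by (rule pochhammer_neg_nat[OF i])
    have pos: "pochhammer c k > 0" "pochhammer d k > 0" for k
      using assms by (auto intro: pochhammer_pos)
    have g: "fact m * pochhammer d m * ?g j (i - j)
       = (- 1) ^ i * fact m / (fact (m - i) * fact i * pochhammer c i) * q ^ i * v ^ (m - i)
          * (real (i choose j) * pochhammer (c + real j) (i - j) * pochhammer (d + real m - real j) j)"
      if "j \<in> {..i}" for j
    proof -
      have j: "j \<le> i" using that by simp
      have c: "pochhammer c i = pochhammer c j * pochhammer (c + real j) (i - j)"
        by (rule pochhammer_product[OF j])
      have d: "pochhammer d m = pochhammer d (m - j) * pochhammer (d + real m - real j) j"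
        using pochhammer_product[of "m - j" m d] i j by (simp add: of_nat_diff algebra_simps)
      have b1: "real (i choose j) = fact i / (fact j * fact (i - j))"
        by (rule binomial_fact[OF j])
      have b2: "real (m - j choose (i - j)) = fact (m - j) / (fact (i - j) * fact (m - i))"
        using binomial_fact[of "i - j" "m - j", where 'a = real] i j by simp
      have qq: "(- q) ^ j * (- q) ^ (i - j) = (- 1) ^ i * q ^ i"
        using j by (simp add: power_add[symmetric] power_minus[of q i])
      have vv: "m - j - (i - j) = m - i" using i j by simp
      have "fact m * pochhammer d m * ?g j (i - j)
        = fact m * pochhammer (d + real m - real j) j * ((- q) ^ j * (- q) ^ (i - j)) * v ^ (m - i)
          / (fact j * pochhammer c j * fact (i - j) * fact (m - i))"
        unfolding d b2 vv using pos[of "m - j"] by (simp add: field_simps)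
      also have "\<dots> = (- 1) ^ i * fact m / (fact (m - i) * fact i * pochhammer c i) * q ^ i * v ^ (m - i)
          * (real (i choose j) * pochhammer (c + real j) (i - j) * pochhammer (d + real m - real j) j)"
        unfolding qq b1 c using pos(1)[of j] pochhammer_pos[of "c + real j" "i - j"] assms(1)
        by (simp add: field_simps)
      finally show ?thesis .
    qed
    have "fact m * pochhammer d m * (\<Sum>j\<le>i. ?g j (i - j))
       = (\<Sum>j\<le>i. fact m * pochhammer d m * ?g j (i - j))"
      by (rule sum_distrib_left)
    also have "\<dots> = (\<Sum>j\<le>i. (- 1) ^ i * fact m / (fact (m - i) * fact i * pochhammer c i) * q ^ i * v ^ (m - i)
          * (real (i choose j) * pochhammer (c + real j) (i - j) * pochhammer (d + real m - real j) j))"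
      by (rule sum.cong[OF refl g])
    also have "\<dots> = (- 1) ^ i * fact m / (fact (m - i) * fact i * pochhammer c i) * q ^ i * v ^ (m - i)
          * pochhammer (c + (d + real m) - 1) i"
      by (simp only: sum_distrib_left[symmetric] pochhammer_vandermonde)
    finally show "pochhammer (- real m) i * pochhammer (real m + c + d - 1) i / (pochhammer c i * fact i)
        * q ^ i * v ^ (m - i) = fact m * pochhammer d m * (\<Sum>j\<le>i. ?g j (i - j))"
      unfolding m by (simp add: add_ac mult_ac)
  qed
qed

text \<open>The rescaling corresponds to J_n(1) = 1: at x1 = x2 the value is a bare power of x2^2 -
  x0^2, times x2 - x0 in odd degree.\<close>

definition jacP :: "nat \<Rightarrow> real \<Rightarrow> real \<Rightarrow> real \<Rightarrow> real \<Rightarrow> real \<Rightarrow> real" where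
  "jacP n c d x2 x1 x0 = fact (n div 2) * pochhammer d ((n + 1) div 2) * jacp n c d x2 x1 x0"

text \<open>J brings the factor x2 + x0 where \<open>jacp\<close> has x1 - x0. Once the leading term
  is rewritten by the weight relation, the exchange is q - (x1 - x0)(x2 - x1) = (x2 - x1)(x2 +
  x0).\<close>

lemma jacP_even:
  assumes "c > 0" "d > 0"
  shows "jacP (2 * m) c d x2 x1 x0 = jacQ m (real m + c + d) c (x2\<^sup>2 - x1\<^sup>2) (x2\<^sup>2 - x0\<^sup>2)
    + (x2 - x1) * (x2 + x0) * (if m = 0 then 0 else
        real m / c * jacQ (m - 1) (real m + c + d) (c + 1) (x2\<^sup>2 - x1\<^sup>2) (x2\<^sup>2 - x0\<^sup>2))"
proof -
  let ?p = "x1\<^sup>2 - x0\<^sup>2" and ?q = "x2\<^sup>2 - x1\<^sup>2" and ?v = "x2\<^sup>2 - x0\<^sup>2"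
  define A U X where defs: "A = jacS m c d ?p ?q"
    "U = jacS_prev m (c + 1) (d + 1) ?p ?q / (c * d)"
    "X = jacS m c (d + 1) ?p ?q / d"
  have r3: "(real m + d) * X = A - ?q * U"
    using jacS_weight_right[OF assms, of m ?p ?q] by (simp add: defs)
  have vq: "?v - ?q = ?p" by simp
  have e: "real m + c + (d + 1) - 1 = real m + c + d" by simp
  have 1: "jacQ m (real m + c + d) c ?q ?v = fact m * pochhammer d m * ((real m + d) * X)"
  proof -
    have "d * pochhammer (d + 1) m = pochhammer d m * (d + real m)"
      by (metis pochhammer_Suc pochhammer_rec)
    then have "pochhammer (d + 1) m = pochhammer d m * (d + real m) / d"
      using assms(2) by (simp add: field_simps)
    then show ?thesis
      using jacQ_eq_jacS[of c "d + 1" m ?q ?v] assms unfolding vq e by (simp add: defs)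
  qed
  have 2: "(if m = 0 then 0 else real m / c * jacQ (m - 1) (real m + c + d) (c + 1) ?q ?v)
     = fact m * pochhammer d m * U"
  proof (cases m)
    case (Suc k)
    have "jacQ k (real (Suc k) + c + d) (c + 1) ?q ?v
      = fact k * pochhammer (d + 1) k * jacS k (c + 1) (d + 1) ?p ?q"
      using jacQ_eq_jacS[of "c + 1" "d + 1" k ?q ?v] assms unfolding vq by (simp add: add_ac)
    then show ?thesis
      using assms by (simp add: Suc defs jacS_prev_def pochhammer_rec field_simps del: of_nat_Suc)
  qed (simp add: defs jacS_prev_def)
  have 3: "jacP (2 * m) c d x2 x1 x0 = fact m * pochhammer d m * (A - (x1 - x0) * (x2 - x1) * U)"
    by (simp add: jacP_def jacp_even defs)
  show ?thesis unfolding 1 2 3 r3 by algebra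
qed

lemma jacP_odd:
  assumes "c > 0" "d > 0"
  shows "jacP (Suc (2 * m)) c d x2 x1 x0
    = (x2 - x0) * jacQ m (real m + c + d) c (x2\<^sup>2 - x1\<^sup>2) (x2\<^sup>2 - x0\<^sup>2)
    - (x2 - x1) * ((real m + c + d) / c
        * jacQ m (real m + c + d + 1) (c + 1) (x2\<^sup>2 - x1\<^sup>2) (x2\<^sup>2 - x0\<^sup>2))"
proof -
  let ?p = "x1\<^sup>2 - x0\<^sup>2" and ?q = "x2\<^sup>2 - x1\<^sup>2" and ?v = "x2\<^sup>2 - x0\<^sup>2"
  define U X Y where defs: "U = jacS m (c + 1) (d + 1) ?p ?q / (c * d)"
    "X = jacS m c (d + 1) ?p ?q / d" "Y = jacS m (c + 1) d ?p ?q / c"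
  have r2: "(c + d + real m) * U = X + Y"
    using jacS_next[OF assms, of m ?p ?q] by (simp add: defs)
  have vq: "?v - ?q = ?p" by simp
  have e: "real m + c + (d + 1) - 1 = real m + c + d" by simp
  have 1: "jacQ m (real m + c + d) c ?q ?v = fact m * pochhammer d (Suc m) * X"
    using jacQ_eq_jacS[of c "d + 1" m ?q ?v] assms unfolding vq e by (simp add: defs pochhammer_rec)
  have 2: "(real m + c + d) / c * jacQ m (real m + c + d + 1) (c + 1) ?q ?v
    = fact m * pochhammer d (Suc m) * ((c + d + real m) * U)"
    using jacQ_eq_jacS[of "c + 1" "d + 1" m ?q ?v] assms unfolding vq
    by (simp add: defs pochhammer_rec add_ac)
  have 3: "jacP (Suc (2 * m)) c d x2 x1 x0
    = fact m * pochhammer d (Suc m) * ((x1 - x0) * X - (x2 - x1) * Y)"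
    by (simp add: jacP_def jacp_odd defs)
  show ?thesis unfolding 1 2 3 r2 by algebra
qed

text \<open>The denominator 1 + c of J becomes (l - z)/l. In odd degree one more factor l - z has to
  clear it; in even degree one of the factors l^2 - z^2 does so and leaves l + z.\<close>

lemma bigJ_eq_jacP:
  assumes "c > 0" "d > 0" "l \<noteq> 0" "l\<^sup>2 \<noteq> z\<^sup>2"
  shows "bigJ n (x / l) (2 * c - 1) (2 * d - 1) (- (z / l))
      * ((l\<^sup>2 - z\<^sup>2) ^ (n div 2) * (if even n then 1 else l - z)) = jacP n c d l x z"
proof -
  let ?u = "l\<^sup>2 - x\<^sup>2" and ?v = "l\<^sup>2 - z\<^sup>2"
  have nz: "?v \<noteq> 0" "l - z \<noteq> 0" "l + z \<noteq> 0" by (rule square_neq_factors[OF assms(4)])+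
  have y: "(1 - (x / l)\<^sup>2) / (1 - (- (z / l))\<^sup>2) = ?u / ?v"
  proof -
    have "1 - (x / l)\<^sup>2 = ?u / l\<^sup>2" "1 - (- (z / l))\<^sup>2 = ?v / l\<^sup>2"
      using assms(3) by (simp_all add: power_divide diff_divide_distrib)
    then show ?thesis using assms(3) by simp
  qed
  have r: "(1 - x / l) / (1 + - (z / l)) = (l - x) / (l - z)"
  proof -
    have "1 - x / l = (l - x) / l" "1 + - (z / l) = (l - z) / l"
      using assms(3) by (simp_all add: diff_divide_distrib)
    then show ?thesis using assms(3) by simp
  qed
  have r': "k * (1 - x / l) / ((1 + - (z / l)) * w) = k / w * ((l - x) / (l - z))" for k w
    unfolding r[symmetric] by simp
  have F: "hyp2F1 (- real k) s e (?u / ?v) * ?v ^ k = jacQ k s e ?u ?v" for k s e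
    by (rule hyp2F1_eq_jacQ[OF nz(1)])
  show ?thesis
  proof (cases n rule: nat_even_odd_cases)
    case (even m)
    have args: "- real (2 * m) / 2 = - real m" "(real (2 * m) + (2 * c - 1) + (2 * d - 1) + 2) / 2 = real m + c + d"
      "(2 * c - 1 + 1) / 2 = c" "(2 * c - 1 + 3) / 2 = c + 1" "2 * c - 1 + 1 = 2 * c"
      by (simp_all add: field_simps)
    have "bigJ n (x / l) (2 * c - 1) (2 * d - 1) (- (z / l))
      = hyp2F1 (- real m) (real m + c + d) c (?u / ?v)
       + real (2 * m) / (2 * c) * ((l - x) / (l - z))
          * hyp2F1 (1 - real (2 * m) / 2) (real m + c + d) (c + 1) (?u / ?v)"
      unfolding bigJ_def Let_def even y args r' by simp
    moreover have "real (2 * m) / (2 * c) * ((l - x) / (l - z))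
          * hyp2F1 (1 - real (2 * m) / 2) (real m + c + d) (c + 1) (?u / ?v) * ?v ^ m
        = (l - x) * (l + z) * (if m = 0 then 0 else
        real m / c * jacQ (m - 1) (real m + c + d) (c + 1) ?u ?v)"
    proof (cases m)
      case (Suc k)
      have "1 - real (2 * m) / 2 = - real k" by (simp add: Suc field_simps)
      moreover have "?v ^ m = ?v ^ k * ((l - z) * (l + z))"
        by (simp add: Suc power2_eq_square algebra_simps)
      ultimately have "real (2 * m) / (2 * c) * ((l - x) / (l - z))
          * hyp2F1 (1 - real (2 * m) / 2) (real m + c + d) (c + 1) (?u / ?v) * ?v ^ m
        = real m / c * (l - x) * (l + z)
          * (hyp2F1 (- real k) (real m + c + d) (c + 1) (?u / ?v) * ?v ^ k)"
        using nz by simp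
      then show ?thesis unfolding F by (simp add: Suc)
    qed simp
    ultimately show ?thesis
      using F[of m "real m + c + d" c] jacP_even[OF assms(1,2), of m l x z]
      by (simp add: even distrib_right)
  next
    case (odd m)
    have args: "- (real (Suc (2 * m)) - 1) / 2 = - real m"
      "(real (Suc (2 * m)) + (2 * c - 1) + (2 * d - 1) + 1) / 2 = real m + c + d"
      "(real (Suc (2 * m)) + (2 * c - 1) + (2 * d - 1) + 3) / 2 = real m + c + d + 1"
      "real (Suc (2 * m)) + (2 * c - 1) + (2 * d - 1) + 1 = 2 * (real m + c + d)"
      "(2 * c - 1 + 1) / 2 = c" "(2 * c - 1 + 3) / 2 = c + 1" "2 * c - 1 + 1 = 2 * c"
      "2 * (real m + c + d) / 2 = real m + c + d"
      by (simp_all add: field_simps)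
    have args': "2 * (real m + c + d) / (2 * c) = (real m + c + d) / c"
      by (rule mult_divide_mult_cancel_left) simp
    have J0: "bigJ n (x / l) (2 * c - 1) (2 * d - 1) (- (z / l))
      = hyp2F1 (- real m) (real m + c + d) c (?u / ?v)
       - (real m + c + d) / c * ((l - x) / (l - z))
          * hyp2F1 (- real m) (real m + c + d + 1) (c + 1) (?u / ?v)"
      unfolding bigJ_def Let_def odd y args r' args' by simp
    have "bigJ n (x / l) (2 * c - 1) (2 * d - 1) (- (z / l)) * (?v ^ m * (l - z))
      = (l - z) * (hyp2F1 (- real m) (real m + c + d) c (?u / ?v) * ?v ^ m)
       - (l - x) * ((real m + c + d) / c
          * (hyp2F1 (- real m) (real m + c + d + 1) (c + 1) (?u / ?v) * ?v ^ m))"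
    proof -
      have "(F - s / c * ((l - x) / (l - z)) * G) * (V * (l - z))
        = (l - z) * (F * V) - (l - x) * (s / c * (G * V))" for F G V s
        using nz(2) assms(1) by (simp add: divide_simps) (simp add: algebra_simps)
      then show ?thesis unfolding J0 .
    qed
    then show ?thesis unfolding F jacP_odd[OF assms(1,2), symmetric] by (simp add: odd)
  qed
qed

section \<open>Divided differences and Newton expansions\<close>

text \<open>The sum is the divided difference f[A] of the constant 1. The induction uses (y a - y b)
  f[A] = f[A - {b}] - f[A - {a}]; for two nodes both terms on the right are 1.\<close>

lemma divided_difference_one:
  fixes y :: "'a \<Rightarrow> real"
  assumes "finite A" "inj_on y A" "card A \<ge> 2"
  shows "(\<Sum>k\<in>A. 1 / (\<Prod>l\<in>A - {k}. y k - y l)) = 0"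
  using assms
proof (induction "card A" arbitrary: A rule: less_induct)
  case less
  define f where "f B = (\<Sum>k\<in>B. 1 / (\<Prod>l\<in>B - {k}. y k - y l))" for B
  obtain a b where ab: "a \<in> A" "b \<in> A" "a \<noteq> b"
  proof -
    have "\<not> card A \<le> Suc 0" using less.prems(3) by simp
    then show ?thesis using card_le_Suc0_iff_eq[OF less.prems(1)] that by blast
  qed
  have yab: "y a \<noteq> y b" using ab less.prems(2) by (auto dest: inj_onD)
  have fin: "finite A" by fact
  have "(y a - y b) * f A = (\<Sum>k\<in>A. (y a - y b) / (\<Prod>l\<in>A - {k}. y k - y l))"
    by (simp add: f_def sum_distrib_left)
  also have "\<dots> = (\<Sum>k\<in>A. (if k = b then 0 else 1 / (\<Prod>l\<in>A - {b} - {k}. y k - y l))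
      - (if k = a then 0 else 1 / (\<Prod>l\<in>A - {a} - {k}. y k - y l)))"
  proof (rule sum.cong[OF refl])
    fix k assume k: "k \<in> A"
    have rem: "(\<Prod>l\<in>A - {k}. y k - y l) = (y k - y c) * (\<Prod>l\<in>A - {c} - {k}. y k - y l)"
      if "c \<in> A" "c \<noteq> k" for c
    proof -
      have "A - {k} - {c} = A - {c} - {k}" by auto
      then show ?thesis using prod.remove[of "A - {k}" c "\<lambda>l. y k - y l"] fin that by simp
    qed
    have ne: "y k \<noteq> y c" if "c \<in> A" "c \<noteq> k" for c
      using less.prems(2) that k by (auto dest: inj_onD)
    consider "k = a" | "k = b" | "k \<noteq> a" "k \<noteq> b" by blast
    then show "(y a - y b) / (\<Prod>l\<in>A - {k}. y k - y l)
      = (if k = b then 0 else 1 / (\<Prod>l\<in>A - {b} - {k}. y k - y l))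
      - (if k = a then 0 else 1 / (\<Prod>l\<in>A - {a} - {k}. y k - y l))"
    proof cases
      case 1
      then show ?thesis using rem[of b] ab yab by simp
    next
      case 2
      have "(y a - y b) / ((y b - y a) * z) = - (1 / z)" for z
        using yab by (simp add: divide_simps)
      then show ?thesis using 2 rem[of a] ab by simp
    next
      case 3
      define P where "P = (\<Prod>l\<in>A - {a} - {b} - {k}. y k - y l)"
      have sets: "A - {b} - {k} - {a} = A - {a} - {b} - {k}" "A - {a} - {k} - {b} = A - {a} - {b} - {k}"
        by auto
      have Pb: "(\<Prod>l\<in>A - {b} - {k}. y k - y l) = (y k - y a) * P"
        using prod.remove[of "A - {b} - {k}" a "\<lambda>l. y k - y l"] fin ab 3
        unfolding P_def sets by simp
      have Pa: "(\<Prod>l\<in>A - {a} - {k}. y k - y l) = (y k - y b) * P"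
        using prod.remove[of "A - {a} - {k}" b "\<lambda>l. y k - y l"] fin ab 3
        unfolding P_def sets by simp
      have PA: "(\<Prod>l\<in>A - {k}. y k - y l) = (y k - y a) * ((y k - y b) * P)"
        using rem[of a] ab 3 Pa by simp
      have "(y a - y b) / ((y k - y a) * ((y k - y b) * P))
        = 1 / ((y k - y a) * P) - 1 / ((y k - y b) * P)"
        using ne[of a] ne[of b] ab 3 by (cases "P = 0") (simp_all add: divide_simps)
      then show ?thesis using 3 by (simp add: PA Pa Pb)
    qed
  qed
  also have "\<dots> = f (A - {b}) - f (A - {a})"
  proof -
    have "(\<Sum>k\<in>A. if k = c then 0 else 1 / (\<Prod>l\<in>A - {c} - {k}. y k - y l)) = f (A - {c})"
      if "c \<in> A" for c
      unfolding f_def using fin that by (simp add: sum.remove)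
    then show ?thesis using ab by (simp add: sum_subtractf)
  qed
  also have "\<dots> = 0"
  proof (cases "card A = 2")
    case True
    have "f (A - {c}) = 1" if "c \<in> A" for c
    proof -
      have "card (A - {c}) = 1" using True fin that by simp
      then obtain e where "A - {c} = {e}" by (auto simp: card_1_singleton_iff)
      then show ?thesis by (simp add: f_def)
    qed
    then show ?thesis using ab by simp
  next
    case False
    have "f (A - {c}) = 0" if "c \<in> A" for c
    proof -
      have "card (A - {c}) < card A" "card (A - {c}) \<ge> 2"
        using False fin that less.prems(3) by (auto simp: card_gt_0_iff)
      moreover have "inj_on y (A - {c})" using less.prems(2) by (rule inj_on_subset) auto
      ultimately show ?thesis using less.hyps[of "A - {c}"] fin by (simp add: f_def)
    qed
    then show ?thesis using ab by simp
  qed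
  finally show ?case using yab by (simp add: f_def)
qed

text \<open>
  These expansions treat even and odd degrees uniformly: up to the sign \<open>(-1)\<^sup>l\<close> the numerator
  \<open>newton_num s n l\<close> is the difference \<open>y\<^sub>n - y\<^sub>l\<close> of nodes \<open>y\<^sub>k = (-1)\<^sup>k (k + s - 1/2)\<close>.
\<close>

definition node_factor :: "nat \<Rightarrow> real \<Rightarrow> real \<Rightarrow> real" where
  "node_factor j x y = (x - y) ^ ((j + 1) div 2) * (x + y) ^ (j div 2)"

definition newton_num :: "real \<Rightarrow> nat \<Rightarrow> nat \<Rightarrow> real" where
  "newton_num s n l = (if even (n + l) then real n - real l else - (real n + real l + 2 * s - 1))"

definition newton_den :: "real \<Rightarrow> nat \<Rightarrow> real" where
  "newton_den c l = (if even l then 2 * c + real l else real l + 1)"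

lemma sum_split_parity_even:
  fixes f :: "nat \<Rightarrow> real"
  shows "(\<Sum>j\<le>2 * m. f j) = (\<Sum>i\<le>m. f (2 * i)) + (\<Sum>i<m. f (Suc (2 * i)))"
  by (induction m) simp_all

lemma sum_split_parity_odd:
  fixes f :: "nat \<Rightarrow> real"
  shows "(\<Sum>j\<le>Suc (2 * m). f j) = (\<Sum>i\<le>m. f (2 * i)) + (\<Sum>i\<le>m. f (Suc (2 * i)))"
  by (induction m) simp_all

text \<open>The factors with l = 2i and l = 2i + 1 merge into one factor of a 2F1 term. In odd
  degree their numerators trade places, so the product stays the same.\<close>

lemma newton_prod_even_even:
  assumes "c > 0"
  shows "(\<Prod>l<2 * i. newton_num s (2 * m) l / newton_den c l)
    = pochhammer (- real m) i * pochhammer (real m + s) i / (pochhammer c i * fact i)"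
proof (induction i)
  case (Suc i)
  have "c + real i > 0" using assms by simp
  then have step: "newton_num s (2 * m) (2 * i) / newton_den c (2 * i)
      * (newton_num s (2 * m) (Suc (2 * i)) / newton_den c (Suc (2 * i)))
     = (- real m + real i) * (real m + s + real i) / ((c + real i) * real (Suc i))"
    by (simp add: newton_num_def newton_den_def divide_simps) (simp add: algebra_simps)
  have "(\<Prod>l<2 * Suc i. newton_num s (2 * m) l / newton_den c l)
     = (\<Prod>l<2 * i. newton_num s (2 * m) l / newton_den c l)
       * (newton_num s (2 * m) (2 * i) / newton_den c (2 * i)
      * (newton_num s (2 * m) (Suc (2 * i)) / newton_den c (Suc (2 * i))))"
    by (simp add: mult.assoc)
  then show ?case
    unfolding Suc.IH step by (simp add: pochhammer_Suc mult_ac del: of_nat_Suc)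
qed simp

lemma newton_prod_odd_even:
  assumes "c > 0"
  shows "(\<Prod>l<2 * i. newton_num s (Suc (2 * m)) l / newton_den c l)
    = pochhammer (- real m) i * pochhammer (real m + s) i / (pochhammer c i * fact i)"
proof (induction i)
  case (Suc i)
  have "c + real i > 0" using assms by simp
  then have step: "newton_num s (Suc (2 * m)) (2 * i) / newton_den c (2 * i)
      * (newton_num s (Suc (2 * m)) (Suc (2 * i)) / newton_den c (Suc (2 * i)))
     = (- real m + real i) * (real m + s + real i) / ((c + real i) * real (Suc i))"
    by (simp add: newton_num_def newton_den_def divide_simps) (simp add: algebra_simps)
  have "(\<Prod>l<2 * Suc i. newton_num s (Suc (2 * m)) l / newton_den c l)
     = (\<Prod>l<2 * i. newton_num s (Suc (2 * m)) l / newton_den c l)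
       * (newton_num s (Suc (2 * m)) (2 * i) / newton_den c (2 * i)
      * (newton_num s (Suc (2 * m)) (Suc (2 * i)) / newton_den c (Suc (2 * i))))"
    by (simp add: mult.assoc)
  then show ?case
    unfolding Suc.IH step by (simp add: pochhammer_Suc mult_ac del: of_nat_Suc)
qed simp

lemma node_factor_even: "node_factor (2 * i) x y = (x\<^sup>2 - y\<^sup>2) ^ i"
proof -
  have "x\<^sup>2 - y\<^sup>2 = (x - y) * (x + y)" by algebra
  then show ?thesis by (simp add: node_factor_def power_mult_distrib)
qed

lemma node_factor_odd: "node_factor (Suc (2 * i)) x y = (x - y) * (x\<^sup>2 - y\<^sup>2) ^ i"
  using node_factor_even[of i x y] by (simp add: node_factor_def)

text \<open>Even j yields the terms of the first 2F1 in J and odd j those of the second, so a single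
  sum represents both.\<close>

lemma jacP_newton:
  assumes "c > 0" "d > 0"
  shows "jacP n c d x2 x1 x0 = (\<Sum>j\<le>n. (\<Prod>l<j. newton_num (c + d) n l / newton_den c l)
     * node_factor j x2 x1 * node_factor (n - j) x2 (- ((-1) ^ n * x0)))"
proof (cases n rule: nat_even_odd_cases)
  case (even m)
  let ?u = "x2\<^sup>2 - x1\<^sup>2" and ?v = "x2\<^sup>2 - x0\<^sup>2" and ?s = "c + d"
  let ?t = "\<lambda>i. pochhammer (- real m) i * pochhammer (real m + ?s) i / (pochhammer c i * fact i)"
  have e: "(\<Prod>l<2 * i. newton_num ?s (2 * m) l / newton_den c l) * node_factor (2 * i) x2 x1
      * node_factor (2 * m - 2 * i) x2 (- ((-1) ^ (2 * m) * x0)) = ?t i * ?u ^ i * ?v ^ (m - i)" for i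
  proof -
    have "2 * m - 2 * i = 2 * (m - i)" by simp
    then show ?thesis by (simp add: newton_prod_even_even[OF assms(1)] node_factor_even)
  qed
  have o: "(\<Prod>l<Suc (2 * i). newton_num ?s (2 * m) l / newton_den c l) * node_factor (Suc (2 * i)) x2 x1
      * node_factor (2 * m - Suc (2 * i)) x2 (- ((-1) ^ (2 * m) * x0))
      = (x2 - x1) * (x2 + x0) * ((real m - real i) / (c + real i) * ?t i * ?u ^ i * ?v ^ (m - Suc i))"
    if "i < m" for i
  proof -
    have "2 * m - Suc (2 * i) = Suc (2 * (m - Suc i))" using that by simp
    moreover have "newton_num ?s (2 * m) (2 * i) / newton_den c (2 * i) = (real m - real i) / (c + real i)"
    proof -
      have "c + real i > 0" using assms by simp
      then show ?thesis by (simp add: newton_num_def newton_den_def divide_simps) (simp add: algebra_simps)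
    qed
    ultimately show ?thesis
      by (simp add: newton_prod_even_even[OF assms(1)] node_factor_odd) (simp add: mult_ac)
  qed
  have "(\<Sum>j\<le>n. (\<Prod>l<j. newton_num (c + d) n l / newton_den c l)
     * node_factor j x2 x1 * node_factor (n - j) x2 (- ((-1) ^ n * x0)))
    = jacQ m (real m + ?s) c ?u ?v + (x2 - x1) * (x2 + x0) *
       (\<Sum>i<m. (real m - real i) / (c + real i) * ?t i * ?u ^ i * ?v ^ (m - Suc i))"
    unfolding even sum_split_parity_even e jacQ_def sum_distrib_left using o by simp
  also have "(\<Sum>i<m. (real m - real i) / (c + real i) * ?t i * ?u ^ i * ?v ^ (m - Suc i))
     = (if m = 0 then 0 else real m / c * jacQ (m - 1) (real m + ?s) (c + 1) ?u ?v)"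
  proof (cases m)
    case (Suc k)
    have "(real m - real i) / (c + real i) * ?t i
      = real m / c * (pochhammer (- real k) i * pochhammer (real m + ?s) i / (pochhammer (c + 1) i * fact i))" for i
    proof -
      have a: "(real m - real i) * pochhammer (- real m) i = real m * pochhammer (- real k) i"
        using pochhammer_rec[of "- real m" i] pochhammer_Suc[of "- real m" i] Suc
        by (simp add: algebra_simps)
      have b: "(c + real i) * pochhammer c i = c * pochhammer (c + 1) i"
        using pochhammer_rec[of c i] pochhammer_Suc[of c i] by (simp add: algebra_simps)
      have "(real m - real i) / (c + real i) * ?t i
        = ((real m - real i) * pochhammer (- real m) i) * pochhammer (real m + ?s) i
           / (((c + real i) * pochhammer c i) * fact i)"
        by simp
      also have "\<dots> = real m / c * (pochhammer (- real k) i * pochhammer (real m + ?s) i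
          / (pochhammer (c + 1) i * fact i))"
        unfolding a b by simp
      finally show ?thesis .
    qed
    then show ?thesis
      by (simp add: Suc jacQ_def sum_distrib_left lessThan_Suc_atMost mult.assoc)
  qed simp
  finally show ?thesis
    using jacP_even[OF assms, of m x2 x1 x0] by (simp add: even add.assoc)
next
  case (odd m)
  let ?u = "x2\<^sup>2 - x1\<^sup>2" and ?v = "x2\<^sup>2 - x0\<^sup>2" and ?s = "c + d"
  let ?t = "\<lambda>i. pochhammer (- real m) i * pochhammer (real m + ?s) i / (pochhammer c i * fact i)"
  have e: "(\<Prod>l<2 * i. newton_num ?s (Suc (2 * m)) l / newton_den c l) * node_factor (2 * i) x2 x1
      * node_factor (Suc (2 * m) - 2 * i) x2 (- ((-1) ^ Suc (2 * m) * x0))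
      = (x2 - x0) * (?t i * ?u ^ i * ?v ^ (m - i))" if "i \<le> m" for i
  proof -
    have "Suc (2 * m) - 2 * i = Suc (2 * (m - i))" using that by simp
    then show ?thesis by (simp add: newton_prod_odd_even[OF assms(1)] node_factor_even node_factor_odd)
  qed
  have o: "(\<Prod>l<Suc (2 * i). newton_num ?s (Suc (2 * m)) l / newton_den c l) * node_factor (Suc (2 * i)) x2 x1
      * node_factor (Suc (2 * m) - Suc (2 * i)) x2 (- ((-1) ^ Suc (2 * m) * x0))
      = (x1 - x2) * ((real m + ?s + real i) / (c + real i) * ?t i * ?u ^ i * ?v ^ (m - i))"
    for i
  proof -
    have "Suc (2 * m) - Suc (2 * i) = 2 * (m - i)" by simp
    moreover have "newton_num ?s (Suc (2 * m)) (2 * i) / newton_den c (2 * i)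
        = - ((real m + ?s + real i) / (c + real i))"
    proof -
      have "c + real i > 0" using assms by simp
      then show ?thesis by (simp add: newton_num_def newton_den_def divide_simps) (simp add: algebra_simps)
    qed
    moreover have "P * - (r / w) * ((x2 - x1) * U) * V = (x1 - x2) * (r / w * P * U * V)" for P r w U V
      by (simp add: divide_inverse algebra_simps)
    ultimately show ?thesis
      by (simp only: prod.lessThan_Suc newton_prod_odd_even[OF assms(1)] node_factor_even node_factor_odd)
         simp
  qed
  have "(\<Sum>j\<le>n. (\<Prod>l<j. newton_num (c + d) n l / newton_den c l)
     * node_factor j x2 x1 * node_factor (n - j) x2 (- ((-1) ^ n * x0)))
    = (x2 - x0) * jacQ m (real m + ?s) c ?u ?v + (x1 - x2) *
       (\<Sum>i\<le>m. (real m + ?s + real i) / (c + real i) * ?t i * ?u ^ i * ?v ^ (m - i))"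
    unfolding odd sum_split_parity_odd o jacQ_def sum_distrib_left using e by simp
  also have "(\<Sum>i\<le>m. (real m + ?s + real i) / (c + real i) * ?t i * ?u ^ i * ?v ^ (m - i))
     = (real m + ?s) / c * jacQ m (real m + ?s + 1) (c + 1) ?u ?v"
  proof -
    have "(real m + ?s + real i) / (c + real i) * ?t i
      = (real m + ?s) / c * (pochhammer (- real m) i * pochhammer (real m + ?s + 1) i
          / (pochhammer (c + 1) i * fact i))" for i
    proof -
      have a: "(real m + ?s + real i) * pochhammer (real m + ?s) i = (real m + ?s) * pochhammer (real m + ?s + 1) i"
        using pochhammer_rec[of "real m + ?s" i] pochhammer_Suc[of "real m + ?s" i] by (simp add: mult.commute)
      have b: "(c + real i) * pochhammer c i = c * pochhammer (c + 1) i"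
        using pochhammer_rec[of c i] pochhammer_Suc[of c i] by (simp add: mult.commute)
      have "(real m + ?s + real i) / (c + real i) * ?t i
        = ((real m + ?s + real i) * pochhammer (real m + ?s) i) * pochhammer (- real m) i
           / (((c + real i) * pochhammer c i) * fact i)"
        by (simp add: mult_ac)
      also have "\<dots> = (real m + ?s) / c * (pochhammer (- real m) i * pochhammer (real m + ?s + 1) i
          / (pochhammer (c + 1) i * fact i))"
        unfolding a b by (simp add: mult_ac)
      finally show ?thesis .
    qed
    then show ?thesis by (simp add: jacQ_def sum_distrib_left mult.assoc)
  qed
  moreover have "(x1 - x2) * z = - ((x2 - x1) * z)" for z
    by (simp add: algebra_simps)
  ultimately show ?thesis
    using jacP_odd[OF assms, of m x2 x1 x0] by (simp add: odd add.assoc)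
qed

section \<open>Differences of nodes and the connection formula\<close>

lemma newton_num_shift:
  "newton_num (s + real k) n l = newton_num s (n + k) (l + k)"
proof -
  have "even (n + k + (l + k)) = even (n + l)" by presburger
  then show ?thesis by (simp add: newton_num_def)
qed

lemma newton_num_eq_diff:
  "newton_num s n l = (- 1) ^ l * ((- 1) ^ n * (real n + s - 1/2) - (- 1) ^ l * (real l + s - 1/2))"
  by (cases "even n"; cases "even l") (simp_all add: newton_num_def)

text \<open>For the first parameter s + k the denominators are differences between node k and the
  nodes after it. This is why the connection sum becomes a divided difference.\<close>

lemma newton_den_eq_num: "newton_den (s + real k) l = - newton_num s k (l + k + 1)"
  by (simp add: newton_den_def newton_num_def)

lemma newton_num_nonzero: "s > 0 \<Longrightarrow> n \<noteq> l \<Longrightarrow> newton_num s n l \<noteq> 0"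
  by (auto simp: newton_num_def)

text \<open>The numerators of degree N join to one product over l < K that is free of k, and the
  factors with l < i cancel. What still depends on k is the product of y k - y l over the other
  nodes of {i..K}, so the sum is a divided difference of 1.\<close>

lemma newton_connection_sum:
  fixes c1 c3 s :: real
  assumes "c3 > 0" "s > 0" "i \<le> K" "K \<le> N"
  shows "(\<Sum>k\<in>{i..K}. (\<Prod>l<k. newton_num (s + c1) N l / newton_num s k l)
      * (\<Prod>l<i. newton_num s k l / newton_den c3 l)
      * (\<Prod>l<K - k. newton_num (s + real k + c1) (N - k) l / newton_den (s + real k) l))
    = (if i = K then \<Prod>l<K. newton_num (s + c1) N l / newton_den c3 l else 0)"
proof -
  define y where "y k = (- 1) ^ k * (real k + s - 1/2)" for k
  define T where "T = (\<Prod>l<K. newton_num (s + c1) N l) / (\<Prod>l<i. newton_den c3 l)"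
  have num: "newton_num s k l = (- 1) ^ l * (y k - y l)" for k l
    by (simp add: newton_num_eq_diff y_def)
  have summand: "(\<Prod>l<k. newton_num (s + c1) N l / newton_num s k l)
      * (\<Prod>l<i. newton_num s k l / newton_den c3 l)
      * (\<Prod>l<K - k. newton_num (s + real k + c1) (N - k) l / newton_den (s + real k) l)
    = T / (\<Prod>l\<in>{i..<K}. (- 1) ^ l) * (1 / (\<Prod>l\<in>{i..K} - {k}. y k - y l))" if k: "k \<in> {i..K}" for k
  proof -
    have split: "(\<Prod>l<b. f l) = (\<Prod>l<a. f l) * (\<Prod>l\<in>{a..<b}. f l)" if "a \<le> b" for a b and f :: "nat \<Rightarrow> real"
      using that by (simp add: prod.atLeastLessThan_concat atLeast0LessThan[symmetric])
    have nz: "(\<Prod>l<i. newton_num s k l) \<noteq> 0"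
      using k newton_num_nonzero[OF assms(2)] by (auto simp: prod_zero_iff)
    have "(\<Prod>l<K - k. newton_num (s + real k + c1) (N - k) l)
        = (\<Prod>l\<in>{k..<K}. newton_num (s + c1) N l)"
    proof (rule prod.reindex_bij_witness[of _ "\<lambda>l. l - k" "\<lambda>l. l + k"])
      fix l assume "l \<in> {..<K - k}"
      then show "newton_num (s + c1) N (l + k) = newton_num (s + real k + c1) (N - k) l"
        using newton_num_shift[of "s + c1" k "N - k" l] k assms(4) by (simp add: add_ac)
    qed auto
    moreover have "(\<Prod>l<K - k. newton_den (s + real k) l) = (\<Prod>l\<in>{k<..K}. - newton_num s k l)"
      by (rule prod.reindex_bij_witness[of _ "\<lambda>l. l - k - 1" "\<lambda>l. l + k + 1"])
         (auto simp: newton_den_eq_num)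
    ultimately have "(\<Prod>l<k. newton_num (s + c1) N l / newton_num s k l)
      * (\<Prod>l<i. newton_num s k l / newton_den c3 l)
      * (\<Prod>l<K - k. newton_num (s + real k + c1) (N - k) l / newton_den (s + real k) l)
     = (\<Prod>l<k. newton_num (s + c1) N l)
        / ((\<Prod>l<i. newton_num s k l) * (\<Prod>l\<in>{i..<k}. newton_num s k l))
       * ((\<Prod>l<i. newton_num s k l) / (\<Prod>l<i. newton_den c3 l))
       * ((\<Prod>l\<in>{k..<K}. newton_num (s + c1) N l) / (\<Prod>l\<in>{k<..K}. - newton_num s k l))"
      using split[of i k "newton_num s k"] k by (simp add: prod_dividef)
    also have "\<dots> = T / ((\<Prod>l\<in>{i..<k}. newton_num s k l) * (\<Prod>l\<in>{k<..K}. - newton_num s k l))"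
      using nz split[of k K "newton_num (s + c1) N"] k by (simp add: T_def)
    also have "(\<Prod>l\<in>{i..<k}. newton_num s k l) * (\<Prod>l\<in>{k<..K}. - newton_num s k l)
       = (\<Prod>l\<in>{i..<K}. (- 1) ^ l) * (\<Prod>l\<in>{i..K} - {k}. y k - y l)"
    proof -
      \<comment> \<open>Each extra minus sign moves (-1)^l to index l - 1, so the signs of the nodes
        above k fill {k..<K} and the total sign does not depend on k.\<close>
      have a: "(\<Prod>l\<in>{k<..K}. - ((- 1 :: real) ^ l)) = (\<Prod>l\<in>{k..<K}. (- 1) ^ l)"
      proof (rule prod.reindex_bij_witness[of _ Suc "\<lambda>l. l - 1"])
        fix l assume "l \<in> {k<..K}"
        then show "(- 1 :: real) ^ (l - 1) = - ((- 1) ^ l)" by (cases l) simp_all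
      qed auto
      have b: "{i..K} - {k} = {i..<k} \<union> {k<..K}" "{i..<k} \<inter> {k<..K} = {}" using k by auto
      have "(\<Prod>l\<in>{k<..K}. - newton_num s k l)
          = (\<Prod>l\<in>{k<..K}. - ((- 1) ^ l)) * (\<Prod>l\<in>{k<..K}. y k - y l)"
        by (simp add: num prod.distrib[symmetric])
      moreover have "(\<Prod>l\<in>{i..<K}. (- 1 :: real) ^ l)
          = (\<Prod>l\<in>{i..<k}. (- 1) ^ l) * (\<Prod>l\<in>{k..<K}. (- 1) ^ l)"
        using k by (simp add: prod.atLeastLessThan_concat)
      ultimately show ?thesis
        unfolding b(1) a by (simp add: num prod.distrib prod.union_disjoint b(2))
    qed
    finally show ?thesis by simp
  qed
  have "(\<Sum>k\<in>{i..K}. (\<Prod>l<k. newton_num (s + c1) N l / newton_num s k l)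
      * (\<Prod>l<i. newton_num s k l / newton_den c3 l)
      * (\<Prod>l<K - k. newton_num (s + real k + c1) (N - k) l / newton_den (s + real k) l))
    = T / (\<Prod>l\<in>{i..<K}. (- 1) ^ l) * (\<Sum>k\<in>{i..K}. 1 / (\<Prod>l\<in>{i..K} - {k}. y k - y l))"
    unfolding sum_distrib_left by (rule sum.cong[OF refl summand])
  also have "\<dots> = (if i = K then \<Prod>l<K. newton_num (s + c1) N l / newton_den c3 l else 0)"
  proof (cases "i = K")
    case True
    then show ?thesis by (simp add: T_def prod_dividef)
  next
    case False
    have "inj_on y {i..K}"
    proof (rule inj_onI, rule ccontr)
      fix k l assume "y k = y l" "k \<noteq> l"
      then show False using newton_num_nonzero[OF assms(2), of k l] num[of k l] by simp
    qed
    moreover have "card {i..K} \<ge> 2" using False assms(3) by simp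
    ultimately show ?thesis using divided_difference_one[of "{i..K}" y] False by simp
  qed
  finally show ?thesis .
qed

text \<open>\<open>node_factor j x y\<close> is the product of x - (-1)^l y over l < j. Read
  backwards, the first factor is the product of x - (-1)^l y over l = i, ..., k - 1, and the second
  continues with l = k, ..., K - 1.\<close>

lemma node_factor_middle:
  assumes "i \<le> k" "k \<le> K"
  shows "node_factor (k - i) x (- ((- 1) ^ k * y)) * node_factor (K - k) x ((- 1) ^ k * y)
    = node_factor (K - i) x ((- 1) ^ i * y)"
proof -
  obtain a where a: "k = i + a" using assms(1) by (auto simp: le_iff_add)
  obtain b where b: "K = k + b" using assms(2) by (auto simp: le_iff_add)
  have sq: "(x - (- 1) ^ k * y) * (x + (- 1) ^ k * y) = x\<^sup>2 - y\<^sup>2" for k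
    by (cases "even k") (simp_all add: power2_eq_square algebra_simps)
  have sq': "x\<^sup>2 - (- ((- 1) ^ k * y))\<^sup>2 = x\<^sup>2 - y\<^sup>2" "x\<^sup>2 - ((- 1) ^ k * y)\<^sup>2 = x\<^sup>2 - y\<^sup>2" for k
    by (simp_all add: power_mult_distrib flip: power_mult)
  consider (ee) p q where "a = 2 * p" "b = 2 * q" | (eo) p q where "a = 2 * p" "b = Suc (2 * q)"
    | (oe) p q where "a = Suc (2 * p)" "b = 2 * q" | (oo) p q where "a = Suc (2 * p)" "b = Suc (2 * q)"
    by (metis nat_even_odd_cases)
  then show ?thesis
  proof cases
    case ee
    then have eqs: "K - i = 2 * (p + q)" "k - i = 2 * p" "K - k = 2 * q" using a b by auto
    show ?thesis unfolding eqs node_factor_even sq' by (simp add: power_add)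
  next
    case eo
    then have eqs: "K - i = Suc (2 * (p + q))" "k - i = 2 * p" "K - k = Suc (2 * q)" using a b by auto
    have "(- 1 :: real) ^ k = (- 1) ^ i" using a eo by (simp add: power_add)
    then show ?thesis unfolding eqs node_factor_even node_factor_odd sq' by (simp add: power_add)
  next
    case oe
    then have eqs: "K - i = Suc (2 * (p + q))" "k - i = Suc (2 * p)" "K - k = 2 * q" using a b by auto
    have "(- 1 :: real) ^ k = - ((- 1) ^ i)" using a oe by (simp add: power_add)
    then show ?thesis unfolding eqs node_factor_even node_factor_odd sq' by (simp add: power_add)
  next
    case oo
    then have eqs: "K - i = 2 * Suc (p + q)" "k - i = Suc (2 * p)" "K - k = Suc (2 * q)" using a b by auto
    show ?thesis unfolding eqs node_factor_even node_factor_odd sq' power_Suc sq[of k, symmetric]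
      by (simp add: power_add)
  qed
qed

text \<open>The expansion coefficients for j12 = 0, in the form that exposes the node differences;
  up to normalization their squares are the weights w_k.\<close>

definition base_coeff :: "real \<Rightarrow> real \<Rightarrow> nat \<Rightarrow> nat \<Rightarrow> real" where
  "base_coeff s c1 N k = (\<Prod>l<k. newton_num (s + c1) N l / newton_num s k l)"

text \<open>The case j12 = 0. Both factors are expanded and the terms sorted by K = k + j. By
  \<open>node_factor_middle\<close> the polynomial part is then independent of k, so the sum over k
  acts on coefficients alone and leaves i = K. This also removes x1, on which the left-hand side
  does not depend.\<close>

lemma jacP_connection:
  assumes "c1 > 0" "c2 > 0" "c3 > 0"
  shows "jacP N c3 (c1 + c2) x3 x2 x0 = (\<Sum>k\<le>N. base_coeff (c2 + c3) c1 N k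
      * jacP k c3 c2 x3 x2 x1
      * jacP (N - k) (c2 + c3 + real k) c1 x3 ((- 1) ^ k * x1) ((- 1) ^ k * x0))"
proof -
  let ?s = "c2 + c3"
  let ?A = "\<lambda>k i. (\<Prod>l<i. newton_num ?s k l / newton_den c3 l)"
  let ?B = "\<lambda>k j. (\<Prod>l<j. newton_num (?s + real k + c1) (N - k) l / newton_den (?s + real k) l)"
  let ?n = "\<lambda>i K. node_factor i x3 x2 * node_factor (K - i) x3 ((- 1) ^ i * x1)
      * node_factor (N - K) x3 (- ((- 1) ^ N * x0))"
  let ?g = "\<lambda>k j. \<Sum>i\<le>k. base_coeff ?s c1 N k * ?A k i * ?B k j * ?n i (k + j)"
  have "(\<Sum>k\<le>N. base_coeff ?s c1 N k * jacP k c3 c2 x3 x2 x1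
      * jacP (N - k) (?s + real k) c1 x3 ((- 1) ^ k * x1) ((- 1) ^ k * x0))
     = (\<Sum>k\<le>N. \<Sum>j\<le>N - k. ?g k j)"
  proof (rule sum.cong[OF refl])
    fix k assume "k \<in> {..N}"
    then have k: "k \<le> N" by simp
    have s: "(- 1) ^ (N - k) * ((- 1) ^ k * x0) = (- 1) ^ N * x0"
      using k by (simp add: mult.assoc[symmetric] power_add[symmetric])
    have P: "jacP k c3 c2 x3 x2 x1 = (\<Sum>i\<le>k. ?A k i * node_factor i x3 x2
        * node_factor (k - i) x3 (- ((- 1) ^ k * x1)))"
      using jacP_newton[OF assms(3,2), of k x3 x2 x1] by (simp add: add.commute)
    have P': "jacP (N - k) (?s + real k) c1 x3 ((- 1) ^ k * x1) ((- 1) ^ k * x0)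
      = (\<Sum>j\<le>N - k. ?B k j * node_factor j x3 ((- 1) ^ k * x1)
        * node_factor (N - k - j) x3 (- ((- 1) ^ N * x0)))"
      using jacP_newton[of "?s + real k" c1 "N - k" x3 "(- 1) ^ k * x1" "(- 1) ^ k * x0"] assms
      by (simp add: s)
    have "base_coeff ?s c1 N k * jacP k c3 c2 x3 x2 x1
      * jacP (N - k) (?s + real k) c1 x3 ((- 1) ^ k * x1) ((- 1) ^ k * x0)
     = (\<Sum>j\<le>N - k. \<Sum>i\<le>k. base_coeff ?s c1 N k * (?A k i * node_factor i x3 x2
        * node_factor (k - i) x3 (- ((- 1) ^ k * x1))) * (?B k j * node_factor j x3 ((- 1) ^ k * x1)
        * node_factor (N - k - j) x3 (- ((- 1) ^ N * x0))))"
      unfolding P P' by (simp add: sum_distrib_left sum_distrib_right)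
    also have "\<dots> = (\<Sum>j\<le>N - k. ?g k j)"
    proof (rule sum.cong[OF refl], rule sum.cong[OF refl])
      fix j i assume "i \<in> {..k}"
      then have m: "node_factor (k - i) x3 (- ((- 1) ^ k * x1)) * node_factor j x3 ((- 1) ^ k * x1)
          = node_factor (k + j - i) x3 ((- 1) ^ i * x1)"
        using node_factor_middle[of i k "k + j" x3 x1] by simp
      have "base_coeff ?s c1 N k * (a * n * p) * (b * q * r)
        = base_coeff ?s c1 N k * a * b * (n * (p * q) * r)" for a b n p q r :: real
        by (simp add: mult_ac)
      then show "base_coeff ?s c1 N k * (?A k i * node_factor i x3 x2
          * node_factor (k - i) x3 (- ((- 1) ^ k * x1))) * (?B k j * node_factor j x3 ((- 1) ^ k * x1)
          * node_factor (N - k - j) x3 (- ((- 1) ^ N * x0)))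
        = base_coeff ?s c1 N k * ?A k i * ?B k j * ?n i (k + j)"
        unfolding m[symmetric] by (simp only: diff_diff_left)
    qed
    finally show "base_coeff ?s c1 N k * jacP k c3 c2 x3 x2 x1
      * jacP (N - k) (?s + real k) c1 x3 ((- 1) ^ k * x1) ((- 1) ^ k * x0) = (\<Sum>j\<le>N - k. ?g k j)" .
  qed
  also have "\<dots> = (\<Sum>(k, j)\<in>(SIGMA k:{..N}. {..N - k}). ?g k j)"
    by (subst sum.Sigma) auto
  also have "(SIGMA k:{..N}. {..N - k}) = {(k, j). k + j \<le> N}" by auto
  also have "(\<Sum>(k, j)\<in>{(k, j). k + j \<le> N}. ?g k j) = (\<Sum>K\<le>N. \<Sum>k\<le>K. ?g k (K - k))"
    by (rule sum.triangle_reindex_eq)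
  also have "\<dots> = (\<Sum>K\<le>N. (\<Prod>l<K. newton_num (?s + c1) N l / newton_den c3 l) * ?n K K)"
  proof (rule sum.cong[OF refl])
    fix K assume "K \<in> {..N}"
    then have K: "K \<le> N" by simp
    have "(\<Sum>k\<le>K. ?g k (K - k))
      = (\<Sum>k\<le>K. \<Sum>i\<le>k. base_coeff ?s c1 N k * ?A k i * ?B k (K - k) * ?n i K)"
      by (rule sum.cong[OF refl]) simp
    also have "\<dots> = (\<Sum>i\<le>K. \<Sum>k\<in>{i..K}. base_coeff ?s c1 N k * ?A k i * ?B k (K - k) * ?n i K)"
      by (simp add: sum.Sigma) (rule sum.reindex_bij_witness[of _ "\<lambda>(i, k). (k, i)" "\<lambda>(k, i). (i, k)"]; auto)
    also have "\<dots> = (\<Sum>i\<le>K. (if i = K then \<Prod>l<K. newton_num (?s + c1) N l / newton_den c3 l else 0) * ?n i K)"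
    proof (rule sum.cong[OF refl])
      fix i assume "i \<in> {..K}"
      then have "(\<Sum>k\<in>{i..K}. base_coeff ?s c1 N k * ?A k i * ?B k (K - k))
        = (if i = K then \<Prod>l<K. newton_num (?s + c1) N l / newton_den c3 l else 0)"
        using newton_connection_sum[of c3 ?s i K N c1] assms K by (simp add: base_coeff_def)
      then show "(\<Sum>k\<in>{i..K}. base_coeff ?s c1 N k * ?A k i * ?B k (K - k) * ?n i K)
        = (if i = K then \<Prod>l<K. newton_num (?s + c1) N l / newton_den c3 l else 0) * ?n i K"
        unfolding sum_distrib_right[symmetric] by (simp only:)
    qed
    also have "\<dots> = (\<Prod>l<K. newton_num (?s + c1) N l / newton_den c3 l) * ?n K K"
      by (simp add: if_distrib[of "\<lambda>x. x * _"] cong: if_cong)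
    finally show "(\<Sum>k\<le>K. ?g k (K - k)) = (\<Prod>l<K. newton_num (?s + c1) N l / newton_den c3 l) * ?n K K" .
  qed
  also have "\<dots> = jacP N c3 (c1 + c2) x3 x2 x0"
    using jacP_newton[of c3 "c1 + c2" N x3 x2 x0] assms by (simp add: node_factor_def add_ac mult.assoc)
  finally show ?thesis ..
qed

section \<open>The unnormalized expansion\<close>

text \<open>
  Here \<open>c\<^sub>i\<close> stands for \<open>\<mu>\<^sub>i + 1/2\<close>, \<open>N\<close> for \<open>j123\<close>, \<open>m123\<close> for \<open>(-1)\<^sup>N \<mu>123\<close>, and \<open>p1, p2, q1, q2\<close> for
  \<open>\<rho>1, \<rho>2, r1, r2\<close>.
\<close>

locale coupling =
  fixes c1 c2 c3 :: real and N :: nat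
  assumes c_gt: "c1 > 1/2" "c2 > 1/2" "c3 > 1/2"
begin

definition "m123 = (-1) ^ N * (c1 + c2 + c3 - 1/2 + real N)"
definition "p1 = (c2 + c3 - 1) / 2"
definition "p2 = (c1 - 1/2 + m123) / 2"
definition "q1 = (c3 - c2) / 2"
definition "q2 = (m123 - (c1 - 1/2)) / 2"

definition step_coeff :: "nat \<Rightarrow> real" where
  "step_coeff n = mid_zeta (N - n) c3 (c1 + c2 + real n) * top_omega n c2 c1 / (c1 + c2 + real n)\<^sup>2"

text \<open>The product of the step coefficients makes the three-term relation monic; the factor in
  front is the one between \<open>jacp\<close> and \<open>jacP\<close> at n = 0.\<close>

definition left_factor :: "nat \<Rightarrow> real" where
  "left_factor n = fact (N div 2) * pochhammer (c1 + c2) ((N + 1) div 2) * (\<Prod>j<n. step_coeff j)"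

definition left_fun :: "real \<Rightarrow> real \<Rightarrow> real \<Rightarrow> nat \<Rightarrow> real \<Rightarrow> real" where
  "left_fun x3 x1 x0 n t = jacp n c2 c1 t x1 x0
      * jacp (N - n) c3 (c1 + c2 + real n) x3 t ((-1) ^ n * x0)"

definition right_fun :: "real \<Rightarrow> real \<Rightarrow> real \<Rightarrow> nat \<Rightarrow> real \<Rightarrow> real" where
  "right_fun x3 x1 x0 k t = jacP k c3 c2 x3 t x1
      * jacP (N - k) (c2 + c3 + real k) c1 x3 ((-1) ^ k * x1) ((-1) ^ k * x0)"

text \<open>The two summands of the diagonal coefficient in \<open>casimir_product\<close> are A_n
  and C_n separately. The sign (-1)^N in \<open>m123\<close> accounts for the dependence on the
  parity of N - n.\<close>

lemma BI_A_eq: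
  assumes "n \<le> N"
  shows "BI_A p1 p2 q1 q2 n
    = mid_psi (N - n) c3 (c1 + c2 + real n) * top_xi n c2 c1 / (c1 + c2 + real n)"
proof -
  have pos: "c1 + c2 + real n > 0" using c_gt by simp
  have par: "even (N - n) \<longleftrightarrow> (even N \<longleftrightarrow> even n)" using assms by auto
  have g: "p1 + p2 - q1 - q2 = c1 + c2 - 1"
    by (simp add: p1_def p2_def q1_def q2_def field_simps)
  have r: "real (N - n) = real N - real n" using assms by (simp add: of_nat_diff)
  have d: "4 * (real n + (p1 + p2 - q1 - q2) + 1) = 4 * (c1 + c2 + real n)" by (simp add: g)
  show ?thesis
    unfolding BI_A_def Let_def d mid_psi_def top_xi_def par r
    using pos
    by (cases "even n"; cases "even N")
       (simp_all add: g p1_def p2_def q1_def q2_def m123_def divide_simps, simp_all add: algebra_simps)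
qed

lemma BI_C_eq:
  assumes "n \<le> N"
  shows "BI_C p1 p2 q1 q2 n
    = top_kappa n c1 * mid_eta (N - n) c3 (c1 + c2 + real n) / (c1 + c2 + real n - 1)"
proof -
  have pos: "c1 + c2 + real n - 1 > 0" using c_gt by simp
  have par: "even (N - n) \<longleftrightarrow> (even N \<longleftrightarrow> even n)" using assms by auto
  have g: "p1 + p2 - q1 - q2 = c1 + c2 - 1"
    by (simp add: p1_def p2_def q1_def q2_def field_simps)
  have r: "real (N - n) = real N - real n" using assms by (simp add: of_nat_diff)
  have d: "4 * (real n + (p1 + p2 - q1 - q2)) = 4 * (c1 + c2 + real n - 1)" by (simp add: g)
  show ?thesis
    unfolding BI_C_def Let_def d mid_eta_def top_kappa_def par r
    using pos
    by (cases "even n"; cases "even N")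
       (simp_all add: g p1_def p2_def q1_def q2_def m123_def divide_simps, simp_all add: algebra_simps)
qed

lemma BI_x_eq: "BI_x p1 k - p1 = - mid_psi k c3 c2"
  by (cases "even k") (simp_all add: BI_x_def p1_def mid_psi_def field_simps)

text \<open>The compatibility by which \<open>left_factor\<close> turns the off-diagonal
  coefficients of the Casimir operator into the coefficient A_n C_(n+1) of the monic
  recurrence.\<close>

lemma BI_AC_eq:
  assumes "Suc n \<le> N"
  shows "BI_A p1 p2 q1 q2 n * BI_C p1 p2 q1 q2 (Suc n) = step_coeff n * mid_y (N - Suc n) c3"
proof -
  define d where "d = c1 + c2 + real n"
  have d: "c1 + c2 + real (Suc n) = d + 1" by (simp add: d_def)
  have M: "N - n = Suc (N - Suc n)" using assms by simp
  define M where "M = N - Suc n"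
  have *: "mid_psi (Suc M) c3 d * top_xi n c2 c1 * (top_kappa (Suc n) c1 * mid_eta M c3 (d + 1))
     = mid_zeta (Suc M) c3 d * top_omega n c2 c1 * mid_y M c3"
    by (cases "even n"; cases "even M")
       (simp_all add: mid_psi_def top_xi_def top_kappa_def mid_eta_def mid_zeta_def top_omega_def
          mid_y_def field_simps)
  have "BI_A p1 p2 q1 q2 n * BI_C p1 p2 q1 q2 (Suc n)
    = mid_psi (Suc M) c3 d * top_xi n c2 c1 * (top_kappa (Suc n) c1 * mid_eta M c3 (d + 1)) / (d * d)"
    using BI_A_eq[of n] BI_C_eq[of "Suc n"] assms unfolding d M M_def[symmetric] d_def[symmetric] by simp
  also have "\<dots> = step_coeff n * mid_y (N - Suc n) c3"
    unfolding * step_coeff_def M M_def[symmetric] d_def[symmetric] by (simp add: power2_eq_square)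
  finally show ?thesis .
qed

lemma right_fun_image:
  assumes "t \<noteq> 0" "t\<^sup>2 \<noteq> x1\<^sup>2" "x3\<^sup>2 \<noteq> t\<^sup>2"
  shows "casimir_image c3 c2 x3 x1 (right_fun x3 x1 x0 k) t
    ((BI_x p1 k - p1) * right_fun x3 x1 x0 k t)"
proof -
  define C where "C = fact (k div 2) * pochhammer c2 ((k + 1) div 2)
    * jacP (N - k) (c2 + c3 + real k) c1 x3 ((-1) ^ k * x1) ((-1) ^ k * x0)"
  have r: "right_fun x3 x1 x0 k s = C * jacp k c3 c2 x3 s x1" for s
    by (simp add: right_fun_def jacP_def C_def)
  have "casimir_image c3 c2 x3 x1 (\<lambda>s. C * jacp k c3 c2 x3 s x1) t
    (C * (- mid_psi k c3 c2 * jacp k c3 c2 x3 t x1))"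
    by (rule casimir_image_cmult, rule casimir_eigenfunction) (use c_gt assms in auto)
  then show ?thesis unfolding r BI_x_eq by (simp add: mult_ac cong: if_cong)
qed

lemma left_fun_image:
  assumes "Suc n \<le> N" "t \<noteq> 0" "x1\<^sup>2 \<noteq> x0\<^sup>2" "t\<^sup>2 \<noteq> x1\<^sup>2" "t\<^sup>2 \<noteq> x0\<^sup>2" "x3\<^sup>2 \<noteq> t\<^sup>2"
  shows "casimir_image c3 c2 x3 x1 (left_fun x3 x1 x0 n) t
    ((if n = 0 then 0 else mid_y (N - n) c3 * left_fun x3 x1 x0 (n - 1) t)
      + step_coeff n * left_fun x3 x1 x0 (Suc n) t
      - (BI_A p1 p2 q1 q2 n + BI_C p1 p2 q1 q2 n) * left_fun x3 x1 x0 n t)"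
proof -
  let ?d = "c1 + c2 + real n" and ?z = "(-1) ^ n * x0"
  have "casimir_image c3 c2 x3 x1 (left_fun x3 x1 x0 n) t
    (mid_y (N - n) c3 * (jacp_prev n c2 c1 t x1 x0 * jacp (Suc (N - n)) c3 (?d - 1) x3 t (- ?z))
     + mid_zeta (N - n) c3 ?d * top_omega n c2 c1 / ?d\<^sup>2 *
         (jacp (Suc n) c2 c1 t x1 x0 * jacp_prev (N - n) c3 (?d + 1) x3 t (- ?z))
     - (top_kappa n c1 * mid_eta (N - n) c3 ?d / (?d - 1) + mid_psi (N - n) c3 ?d * top_xi n c2 c1 / ?d)
         * (jacp n c2 c1 t x1 x0 * jacp (N - n) c3 ?d x3 t ?z))"
    unfolding left_fun_def[abs_def]
    \<comment> \<open>c1 + c2 > 1 gives the required d > 1 also for n = 0.\<close>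
    by (rule casimir_product) (use c_gt assms in auto)
  \<comment> \<open>At n = 0 the lowered first factor is 0 by convention, which removes the term
    whose second factor would have degree N + 1.\<close>
  moreover have e1: "jacp_prev n c2 c1 t x1 x0 * jacp (Suc (N - n)) c3 (?d - 1) x3 t (- ?z)
     = (if n = 0 then 0 else left_fun x3 x1 x0 (n - 1) t)"
  proof (cases n)
    case (Suc m)
    have "Suc (N - Suc m) = N - m" using assms(1) Suc by simp
    then show ?thesis by (simp add: Suc jacp_prev_def left_fun_def algebra_simps)
  qed (simp add: jacp_prev_def)
  moreover have e2: "jacp (Suc n) c2 c1 t x1 x0 * jacp_prev (N - n) c3 (?d + 1) x3 t (- ?z)
     = left_fun x3 x1 x0 (Suc n) t"
    using assms(1) by (simp add: left_fun_def jacp_prev_def algebra_simps)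
  moreover have "(if n = 0 then 0 else a * b) = a * (if n = 0 then 0 else b)" for a b :: real
    by simp
  moreover have nN: "n \<le> N" using assms(1) by simp
  ultimately show ?thesis
    by (simp only: BI_A_eq[OF nN] BI_C_eq[OF nN] step_coeff_def left_fun_def[of x3 x1 x0 n t] add.commute)
qed

text \<open>The three-term relation reaches n + 1 from n and n - 1, hence the strong induction. It
  has to range over all admissible t, because the operator differentiates and reflects the identity
  for the smaller index.\<close>

lemma expansion:
  assumes "n \<le> N" "\<bar>x0\<bar> < \<bar>x1\<bar>" "\<bar>x1\<bar> < \<bar>t\<bar>" "\<bar>t\<bar> < \<bar>x3\<bar>"
  shows "left_factor n * left_fun x3 x1 x0 n t = (\<Sum>k\<le>N. BI p1 p2 q1 q2 n (BI_x p1 k)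
      * base_coeff (c2 + c3) c1 N k * right_fun x3 x1 x0 k t)"
  using assms(1,3,4)
proof (induction n arbitrary: t rule: less_induct)
  case (less n)
  let ?B = "\<lambda>n k. BI p1 p2 q1 q2 n (BI_x p1 k)" and ?D = "base_coeff (c2 + c3) c1 N"
  let ?L = "left_fun x3 x1 x0" and ?R = "right_fun x3 x1 x0"
  show ?case
  proof (cases n)
    case 0
    have "left_factor 0 * ?L 0 t = jacP N c3 (c1 + c2) x3 t x0"
      by (simp add: left_factor_def left_fun_def jacP_def jacp_def Let_def jacS_prev_def)
    then show ?thesis
      using jacP_connection[of c1 c2 c3 N x3 t x0 x1] c_gt by (simp add: 0 right_fun_def mult.assoc)
  next
    case (Suc m)
    define S where "S = {s. \<bar>x1\<bar> < \<bar>s\<bar> \<and> \<bar>s\<bar> < \<bar>x3\<bar>}"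
    have S: "open S" "t \<in> S" "\<And>s. s \<in> S \<Longrightarrow> - s \<in> S"
      using less.prems by (auto simp: S_def intro!: open_Collect_conj open_Collect_less continuous_intros)
    have neq: "t \<noteq> 0" "x1\<^sup>2 \<noteq> x0\<^sup>2" "t\<^sup>2 \<noteq> x1\<^sup>2" "t\<^sup>2 \<noteq> x0\<^sup>2" "x3\<^sup>2 \<noteq> t\<^sup>2"
      using less.prems assms(2) by (auto simp: power2_eq_iff)
    have IH: "left_factor m * ?L m s = (\<Sum>k\<le>N. ?B m k * ?D k * ?R k s)" if "s \<in> S" for s
      using less.IH[of m s] less.prems Suc that by (auto simp: S_def)
    have "casimir_image c3 c2 x3 x1 (\<lambda>s. \<Sum>k\<le>N. (?B m k * ?D k) * ?R k s) t
      (\<Sum>k\<le>N. (?B m k * ?D k) * ((BI_x p1 k - p1) * ?R k t))"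
      by (rule casimir_image_sum) (use right_fun_image neq in auto)
    moreover have "casimir_image c3 c2 x3 x1 (\<lambda>s. \<Sum>k\<le>N. (?B m k * ?D k) * ?R k s) t
      (left_factor m * ((if m = 0 then 0 else mid_y (N - m) c3 * ?L (m - 1) t) + step_coeff m * ?L (Suc m) t
      - (BI_A p1 p2 q1 q2 m + BI_C p1 p2 q1 q2 m) * ?L m t))"
      by (rule casimir_image_cong[OF casimir_image_cmult[OF left_fun_image] S])
         (use less.prems Suc neq IH in auto)
    \<comment> \<open>By the induction hypothesis both values are images of the same function, and
      the operator is single-valued.\<close>
    ultimately have K: "left_factor m * ((if m = 0 then 0 else mid_y (N - m) c3 * ?L (m - 1) t)
        + step_coeff m * ?L (Suc m) t - (BI_A p1 p2 q1 q2 m + BI_C p1 p2 q1 q2 m) * ?L m t)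
      = (\<Sum>k\<le>N. ?B m k * ?D k * ((BI_x p1 k - p1) * ?R k t))"
      by (rule casimir_image_unique[symmetric])
    have low: "left_factor m * (if m = 0 then 0 else mid_y (N - m) c3 * ?L (m - 1) t)
      = (\<Sum>k\<le>N. (if m = 0 then 0 else BI_A p1 p2 q1 q2 (m - 1) * BI_C p1 p2 q1 q2 m * ?B (m - 1) k)
          * ?D k * ?R k t)"
    proof (cases m)
      case (Suc l)
      have "left_factor m * (mid_y (N - m) c3 * ?L l t)
          = BI_A p1 p2 q1 q2 l * BI_C p1 p2 q1 q2 m * (left_factor l * ?L l t)"
        using BI_AC_eq[of l] less.prems \<open>n = Suc m\<close> Suc by (simp add: left_factor_def mult_ac)
      also have "left_factor l * ?L l t = (\<Sum>k\<le>N. ?B l k * ?D k * ?R k t)"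
        using less.IH[of l t] less.prems \<open>n = Suc m\<close> Suc by simp
      finally show ?thesis by (simp add: Suc sum_distrib_left mult.assoc)
    qed simp
    have rec: "?B (Suc m) k = (BI_x p1 k - p1 + (BI_A p1 p2 q1 q2 m + BI_C p1 p2 q1 q2 m)) * ?B m k
       - (if m = 0 then 0 else BI_A p1 p2 q1 q2 (m - 1) * BI_C p1 p2 q1 q2 m * ?B (m - 1) k)" for k
      by (cases m) (simp_all add: algebra_simps)
    have "left_factor (Suc m) * ?L (Suc m) t = left_factor m * (step_coeff m * ?L (Suc m) t)"
      by (simp add: left_factor_def)
    also have "\<dots> = (\<Sum>k\<le>N. ?B m k * ?D k * ((BI_x p1 k - p1) * ?R k t))
        + (BI_A p1 p2 q1 q2 m + BI_C p1 p2 q1 q2 m) * (left_factor m * ?L m t)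
        - left_factor m * (if m = 0 then 0 else mid_y (N - m) c3 * ?L (m - 1) t)"
      unfolding K[symmetric] by (simp add: algebra_simps)
    also have "\<dots> = (\<Sum>k\<le>N. ?B (Suc m) k * ?D k * ?R k t)"
      unfolding low IH[OF S(2)] rec sum_distrib_left sum.distrib[symmetric] sum_subtractf[symmetric]
      by (rule sum.cong[OF refl]) (simp add: algebra_simps)
    finally show ?thesis by (simp only: Suc)
  qed
qed

end

section \<open>Normalization\<close>

text \<open>The constant part of K^2 that remains once its \<Lambda>-dependent part has been
  absorbed into \<open>jacP\<close>.\<close>

definition jacK :: "nat \<Rightarrow> real \<Rightarrow> real \<Rightarrow> real" where
  "jacK n c d = pochhammer c ((n + 1) div 2)
    / (2 ^ n * (pochhammer (c + d + real (n div 2)) ((n + 1) div 2)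
        * pochhammer d ((n + 1) div 2) * fact (n div 2)))"

lemma jacK_pos: "c > 0 \<Longrightarrow> d > 0 \<Longrightarrow> jacK n c d > 0"
  by (auto simp: jacK_def intro!: divide_pos_pos mult_pos_pos pochhammer_pos)

lemma pos_not_nonpos_Int: "z > 0 \<Longrightarrow> z \<notin> \<int>\<^sub>\<le>\<^sub>0" for z :: real
  by (auto dest: nonpos_Ints_nonpos)

lemma Gamma_shift: "z > 0 \<Longrightarrow> Gamma (z + real n) = pochhammer z n * Gamma (z :: real)"
proof -
  assume "z > 0"
  moreover from this have "Gamma z \<noteq> 0" using Gamma_real_pos[of z] by linarith
  ultimately show ?thesis using pochhammer_Gamma[of z n] pos_not_nonpos_Int[of z] by simp
qed

text \<open>All shifted Gamma values reduce by rising factorials, and the unshifted ones cancel. The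
  factor 2^n is the one that the radicand of K divides out.\<close>

lemma bigJ_h_eq_jacK:
  assumes "c > 0" "d > 0"
  shows "Gamma d * Gamma c / (Gamma (c + d + real n) * bigJ_h n (2 * c - 1) (2 * d - 1))
    = 2 ^ n * jacK n c d"
proof (cases n rule: nat_even_odd_cases)
  case (even m)
  have G: "Gamma c > 0" "Gamma d > 0" "Gamma (c + d + real m) > 0" "pochhammer c m > 0" "pochhammer d m > 0"
    "pochhammer (c + d + real m) m > 0" "c + real m > 0"
    using assms by (auto intro!: Gamma_real_pos pochhammer_pos)
  have h: "bigJ_h n (2 * c - 1) (2 * d - 1)
     = 2 * (pochhammer d m * Gamma d) * ((c + real m) * (pochhammer c m * Gamma c)) * fact m
       / (2 * (c + real m) * Gamma (c + d + real m) * (pochhammer c m)\<^sup>2)"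
  proof -
    have args: "(real (2 * m) + (2 * d - 1) + 1) / 2 = d + real m"
      "(real (2 * m) + (2 * c - 1) + 3) / 2 = c + real m + 1"
      "real (2 * m) + (2 * c - 1) + 1 = 2 * (c + real m)"
      "(real (2 * m) + (2 * c - 1) + (2 * d - 1) + 2) / 2 = c + d + real m"
      "(2 * c - 1 + 1) / 2 = c" "2 * m div 2 = m"
      by (simp_all add: field_simps)
    have "Gamma (c + real m + 1) = (c + real m) * Gamma (c + real m)"
      using G(7) pos_not_nonpos_Int by (intro Gamma_plus1) blast
    then show ?thesis
      unfolding bigJ_h_def Let_def even args Gamma_shift[OF assms(1)] Gamma_shift[OF assms(2)]
      by simp
  qed
  have "Gamma (c + d + real n) = pochhammer (c + d + real m) m * Gamma (c + d + real m)"
    using Gamma_shift[of "c + d + real m" m] assms by (simp add: even add_ac)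
  then show ?thesis
    unfolding h jacK_def using G
    by (simp add: even divide_simps) (simp add: power2_eq_square mult_ac)
next
  case (odd m)
  have G: "Gamma c > 0" "Gamma d > 0" "Gamma (c + d + real m) > 0" "pochhammer c (Suc m) > 0"
    "pochhammer d (Suc m) > 0" "pochhammer (c + d + real m) (Suc m) > 0" "c + d + real m > 0"
    using assms by (auto intro!: Gamma_real_pos pochhammer_pos)
  have h: "bigJ_h n (2 * c - 1) (2 * d - 1)
     = 2 * (c + d + real m) * (pochhammer d (Suc m) * Gamma d) * (pochhammer c (Suc m) * Gamma c) * fact m
       / (2 * ((c + d + real m) * Gamma (c + d + real m)) * (pochhammer c (Suc m))\<^sup>2)"
  proof -
    have args: "(real (Suc (2 * m)) + (2 * d - 1) + 2) / 2 = d + real (Suc m)"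
      "(real (Suc (2 * m)) + (2 * c - 1) + 2) / 2 = c + real (Suc m)"
      "(real (Suc (2 * m)) + (2 * c - 1) + (2 * d - 1) + 3) / 2 = c + d + real m + 1"
      "real (Suc (2 * m)) + (2 * c - 1) + (2 * d - 1) + 1 = 2 * (c + d + real m)"
      "(2 * c - 1 + 1) / 2 = c" "(Suc (2 * m) - 1) div 2 = m" "(Suc (2 * m) + 1) div 2 = Suc m"
      by (simp_all add: field_simps)
    have "Gamma (c + d + real m + 1) = (c + d + real m) * Gamma (c + d + real m)"
      using G(7) pos_not_nonpos_Int by (intro Gamma_plus1) blast
    then show ?thesis
      unfolding bigJ_h_def Let_def odd args Gamma_shift[OF assms(1)] Gamma_shift[OF assms(2)]
      by simp
  qed
  have "Gamma (c + d + real n) = pochhammer (c + d + real m) (Suc m) * Gamma (c + d + real m)"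
    using Gamma_shift[of "c + d + real m" "Suc m"] assms by (simp add: odd add_ac)
  moreover have "n div 2 = m" "(n + 1) div 2 = Suc m" using odd by auto
  moreover have "x \<noteq> 0 \<Longrightarrow> y \<noteq> 0 \<Longrightarrow> g \<noteq> 0 \<Longrightarrow> p \<noteq> 0 \<Longrightarrow> q \<noteq> 0 \<Longrightarrow> w \<noteq> 0 \<Longrightarrow> e \<noteq> 0 \<Longrightarrow>
      y * x / (w * g * (2 * e * (q * y) * (p * x) * fact m / (2 * (e * g) * p\<^sup>2)))
      = 2 ^ n * (p / (2 ^ n * (w * q * fact m)))" for x y g p q w e :: real
    by (simp add: divide_simps) (simp add: power2_eq_square)
  from this[of "Gamma c" "Gamma d" "Gamma (c + d + real m)" "pochhammer c (Suc m)"
      "pochhammer d (Suc m)" "pochhammer (c + d + real m) (Suc m)" "c + d + real m"]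
  have "Gamma d * Gamma c / (pochhammer (c + d + real m) (Suc m) * Gamma (c + d + real m)
      * (2 * (c + d + real m) * (pochhammer d (Suc m) * Gamma d) * (pochhammer c (Suc m) * Gamma c) * fact m
       / (2 * ((c + d + real m) * Gamma (c + d + real m)) * (pochhammer c (Suc m))\<^sup>2)))
    = 2 ^ n * (pochhammer c (Suc m) / (2 ^ n * (pochhammer (c + d + real m) (Suc m)
        * pochhammer d (Suc m) * fact m)))"
    using G by linarith
  ultimately show ?thesis
    unfolding h jacK_def by simp
qed

text \<open>The \<Lambda>-dependent part of K^2 is E^2 / 2^n, with the same E that clears the
  denominators of J. In odd degree E has the sign of l because \<bar>z\<bar> < \<bar>l\<bar>, so the
  nonnegative root is sgn l ^ n * E.\<close>

lemma bigJ_K_times_bigJ: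
  assumes "\<beta> > 0" "\<alpha> > 0" "\<bar>c\<bar> < \<bar>l\<bar>" "\<sigma> \<in> {1, -1}"
  shows "bigJ_K n \<sigma> l \<beta> \<alpha> c * bigJ n (x / l) (2 * \<beta>) (2 * \<alpha>) (- (c * \<sigma> / l))
    = sgn l ^ n * sqrt (jacK n (\<beta> + 1/2) (\<alpha> + 1/2)) * jacP n (\<beta> + 1/2) (\<alpha> + 1/2) l x (c * \<sigma>)"
proof -
  define z where "z = c * \<sigma>"
  have z: "\<bar>z\<bar> < \<bar>l\<bar>" "z\<^sup>2 = c\<^sup>2" using assms by (auto simp: z_def)
  have l: "l \<noteq> 0" and neq: "l\<^sup>2 \<noteq> z\<^sup>2" using z by (auto simp: power2_eq_iff)
  have nz: "l - z \<noteq> 0" "l + z \<noteq> 0" using square_neq_factors[OF neq] by auto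
  have v: "l\<^sup>2 - z\<^sup>2 > 0" using z(1) by (metis abs_le_square_iff diff_gt_0_iff_gt not_less)
  define E where "E = (l\<^sup>2 - z\<^sup>2) ^ (n div 2) * (if even n then 1 else l - z)"
  have E: "((l\<^sup>2 - z\<^sup>2) / 2) ^ n * ((l - z) / (l - (- 1) ^ n * z)) = E\<^sup>2 / 2 ^ n"
  proof (cases n rule: nat_even_odd_cases)
    case (even m)
    then show ?thesis using nz
      by (simp add: E_def power_divide power_mult[symmetric] mult.commute)
  next
    case (odd m)
    have "(l\<^sup>2 - z\<^sup>2) ^ n = ((l\<^sup>2 - z\<^sup>2) ^ m)\<^sup>2 * ((l - z) * (l + z))"
    proof -
      have "(l\<^sup>2 - z\<^sup>2) ^ n = ((l\<^sup>2 - z\<^sup>2) ^ m)\<^sup>2 * (l\<^sup>2 - z\<^sup>2)"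
        by (simp add: odd power_mult[symmetric] mult.commute)
      moreover have "l\<^sup>2 - z\<^sup>2 = (l - z) * (l + z)" by algebra
      ultimately show ?thesis by simp
    qed
    moreover have "n div 2 = m" "(- 1 :: real) ^ n = - 1" "odd n" using odd by auto
    ultimately show ?thesis using nz
      by (simp add: E_def power_divide power_mult_distrib power2_eq_square)
  qed
  have absE: "\<bar>E\<bar> = sgn l ^ n * E"
  proof -
    have "\<bar>l - z\<bar> = sgn l * (l - z)" using z(1) by (auto simp: sgn_real_def abs_real_def split: if_splits)
    moreover have "(sgn l)\<^sup>2 = 1" using l by (simp add: sgn_real_def)
    then have "sgn l ^ n = (if even n then 1 else sgn l)"
      by (cases n rule: nat_even_odd_cases) (auto simp: power_mult)
    ultimately show ?thesis using v by (simp add: E_def abs_mult)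
  qed
  have "bigJ_K n \<sigma> l \<beta> \<alpha> c = sqrt (E\<^sup>2 * jacK n (\<beta> + 1/2) (\<alpha> + 1/2))"
  proof -
    have "Gamma (\<alpha> + 1/2) * Gamma (\<beta> + 1/2) / (Gamma (\<alpha> + \<beta> + real n + 1) * bigJ_h n (2 * \<beta>) (2 * \<alpha>))
      = 2 ^ n * jacK n (\<beta> + 1/2) (\<alpha> + 1/2)"
      using bigJ_h_eq_jacK[of "\<beta> + 1/2" "\<alpha> + 1/2" n] assms by (simp add: algebra_simps)
    moreover have "l - c * \<sigma> = l - z" "l - (- 1) ^ n * c * \<sigma> = l - (- 1) ^ n * z"
      by (simp_all add: z_def)
    ultimately show ?thesis unfolding bigJ_K_def z(2)[symmetric] by (simp only: E) simp
  qed
  also have "\<dots> = sgn l ^ n * E * sqrt (jacK n (\<beta> + 1/2) (\<alpha> + 1/2))"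
    by (simp add: real_sqrt_mult absE)
  finally have K: "bigJ_K n \<sigma> l \<beta> \<alpha> c = sgn l ^ n * E * sqrt (jacK n (\<beta> + 1/2) (\<alpha> + 1/2))" .
  have "bigJ n (x / l) (2 * \<beta>) (2 * \<alpha>) (- (z / l)) * E = jacP n (\<beta> + 1/2) (\<alpha> + 1/2) l x z"
    using bigJ_eq_jacP[of "\<beta> + 1/2" "\<alpha> + 1/2" l z n x] assms l neq
    by (simp add: E_def distrib_left)
  then show ?thesis unfolding K z_def[symmetric] by (simp add: mult_ac)
qed

section \<open>Closed forms of the coefficients, weights and normalization factors\<close>

lemma newton_num_prod_even:
  "k \<le> 2 * m \<Longrightarrow> (\<Prod>l<k. newton_num s (2 * m) l)
    = 2 ^ ((k + 1) div 2) * (fact m / fact (m - (k + 1) div 2))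
      * ((- 2) ^ (k div 2) * pochhammer (s + real m) (k div 2))"
proof (induction k)
  case (Suc k)
  show ?case
  proof (cases k rule: nat_even_odd_cases)
    case (even i)
    define r where "r = real m - real i"
    have "fact (m - i) = r * (fact (m - Suc i) :: real)"
      using Suc.prems even unfolding r_def by (subst fact_reduce) (auto simp: of_nat_diff)
    moreover have "newton_num s (2 * m) k = 2 * r"
      by (simp add: newton_num_def even r_def)
    moreover have "r \<noteq> 0" using Suc.prems even by (simp add: r_def)
    moreover have "(Suc k + 1) div 2 = Suc i" "(k + 1) div 2 = i" "Suc k div 2 = i" "k div 2 = i" using even by auto
    ultimately show ?thesis using Suc by simp
  next
    case (odd i)
    define r where "r = s + real m + real i"
    have "newton_num s (2 * m) k = - 2 * r"
      by (simp add: newton_num_def odd r_def)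
    moreover have "pochhammer (s + real m) (Suc i) = pochhammer (s + real m) i * r"
      by (simp add: pochhammer_Suc r_def)
    moreover have "(Suc k + 1) div 2 = (k + 1) div 2" "Suc k div 2 = Suc i" "k div 2 = i" using odd by auto
    ultimately show ?thesis using Suc by simp
  qed
qed simp

lemma newton_num_prod_odd:
  "k \<le> Suc (2 * m) \<Longrightarrow> (\<Prod>l<k. newton_num s (Suc (2 * m)) l)
    = 2 ^ (k div 2) * (fact m / fact (m - k div 2))
      * ((- 2) ^ ((k + 1) div 2) * pochhammer (s + real m) ((k + 1) div 2))"
proof (induction k)
  case (Suc k)
  show ?case
  proof (cases k rule: nat_even_odd_cases)
    case (odd i)
    define r where "r = real m - real i"
    have "fact (m - i) = r * (fact (m - Suc i) :: real)"
      using Suc.prems odd unfolding r_def by (subst fact_reduce) (auto simp: of_nat_diff)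
    moreover have "newton_num s (Suc (2 * m)) k = 2 * r"
      by (simp add: newton_num_def odd r_def)
    moreover have "r \<noteq> 0" using Suc.prems odd by (simp add: r_def)
    moreover have "(Suc k + 1) div 2 = (k + 1) div 2" "Suc k div 2 = Suc i" "k div 2 = i" using odd by auto
    ultimately show ?thesis using Suc by simp
  next
    case (even i)
    define r where "r = s + real m + real i"
    have "newton_num s (Suc (2 * m)) k = - 2 * r"
      by (simp add: newton_num_def even r_def)
    moreover have "pochhammer (s + real m) (Suc i) = pochhammer (s + real m) i * r"
      by (simp add: pochhammer_Suc r_def)
    moreover have "(Suc k + 1) div 2 = Suc i" "(k + 1) div 2 = i" "Suc k div 2 = i" "k div 2 = i" using even by auto
    ultimately show ?thesis using Suc by simp
  qed
qed simp

lemma newton_num_prod_diag: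
  "(\<Prod>l<k. newton_num s k l) = 2 ^ (k div 2) * fact (k div 2)
      * ((- 2) ^ ((k + 1) div 2) * pochhammer (s + real (k div 2)) ((k + 1) div 2))"
proof (cases k rule: nat_even_odd_cases)
  case (even i)
  then show ?thesis using newton_num_prod_even[of k i s] by simp
next
  case (odd i)
  then have "(k + 1) div 2 = Suc i" "k div 2 = i" by auto
  then show ?thesis using newton_num_prod_odd[of k i s] odd by simp
qed

lemma frac_eqI: "b \<noteq> 0 \<Longrightarrow> d \<noteq> 0 \<Longrightarrow> a * d = c * b \<Longrightarrow> a / b = c / d" for a b c d :: real
  by (simp add: frac_eq_eq)

text \<open>The truncation condition puts negative arguments into w; this trades them for rising
  factorials at positive arguments and a sign.\<close>

lemma pochhammer_reflect_quotient:
  assumes "c > 0" "b \<le> L"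
  shows "pochhammer (1 - c - real L) b = (- 1) ^ b * pochhammer c L / pochhammer c (L - b)"
proof -
  have "pochhammer c L = pochhammer c (L - b) * pochhammer (c + real L - real b) b"
    using pochhammer_product[of "L - b" L c] assms by (simp add: of_nat_diff algebra_simps)
  moreover have "pochhammer c (L - b) > 0" using assms by (simp add: pochhammer_pos)
  ultimately show ?thesis
    using pochhammer_reflect[of "c + real L" b] by (simp add: diff_diff_eq)
qed

context coupling
begin

text \<open>
  With these indices the closed forms of \<open>w\<^sub>k\<close>, \<open>h\<^sub>n\<close> and of the two factors below have the same shape for
  even and for odd \<open>N\<close>.
\<close>

definition "half k = k div 2"
definition "half_up k = (k + 1) div 2"
definition "idx_a k = (if even N then half_up k else half k)"
definition "idx_b k = (if even N then half k else half_up k)"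
definition "half_N = N div 2"
definition "half_up_N = (N + 1) div 2"

lemma idx_facts:
  assumes "k \<le> N"
  shows "idx_a k \<le> half_N" "idx_b k \<le> half_up_N" "half_up k \<le> half_up_N" "half k \<le> half_up_N" "(N - k) div 2 = half_N - idx_a k" "(N - k + 1) div 2 = half_up_N - idx_b k"
    "idx_a k + idx_b k = k" "half k + half_up k = k"
proof -
  obtain i r where k: "k = 2 * i + r" "r < 2" by (metis div_mult_mod_eq mult.commute mod_less_divisor pos2)
  obtain j t where N: "N = 2 * j + t" "t < 2" by (metis div_mult_mod_eq mult.commute mod_less_divisor pos2)
  have "r = 0 \<or> r = 1" "t = 0 \<or> t = 1" using k N by auto
  then show "idx_a k \<le> half_N" "idx_b k \<le> half_up_N" "half_up k \<le> half_up_N" "half k \<le> half_up_N" "(N - k) div 2 = half_N - idx_a k" "(N - k + 1) div 2 = half_up_N - idx_b k"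
    "idx_a k + idx_b k = k" "half k + half_up k = k"
    using assms unfolding idx_a_def idx_b_def half_N_def half_up_N_def half_def half_up_def unfolding k(1) N(1) by auto
qed

lemma c_pos: "c1 > 0" "c2 > 0" "c3 > 0"
  using c_gt by auto

lemma N_even: "even N \<Longrightarrow> N = 2 * half_N \<and> half_up_N = half_N" and N_odd: "odd N \<Longrightarrow> N = Suc (2 * half_N) \<and> half_up_N = Suc half_N"
  by (auto simp: half_N_def half_up_N_def)

abbreviation "s23 \<equiv> c2 + c3"
abbreviation "s123 \<equiv> c1 + c2 + c3"
abbreviation "s12 \<equiv> c1 + c2"

text \<open>The sign compares the powers of -2 in the two products: for even N their exponents are
  \<open>half k\<close> and \<open>half_up k\<close>, for odd N they agree.\<close>

lemma base_coeff_closed: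
  assumes "k \<le> N"
  shows "base_coeff s23 c1 N k = (if even N then (- 1) ^ k else 1) *
    (fact half_N * pochhammer (s123 + real half_N) (idx_b k)
      / (fact (half_N - idx_a k) * fact (half k) * pochhammer (s23 + real (half k)) (half_up k)))"
proof -
  have s: "s23 + c1 + real half_N = s123 + real half_N" by simp
  have q: "(- 2 :: real) ^ j = (- 1) ^ j * 2 ^ j" for j by (simp add: power_mult_distrib[symmetric])
  have p: "pochhammer (s23 + real (half k)) (half_up k) > 0" using c_pos by (simp add: pochhammer_pos)
  have sign: "(- 1 :: real) ^ half k = (- 1) ^ k * (- 1) ^ half_up k"
  proof -
    have "(- 1 :: real) ^ (half k + half_up k) * (- 1) ^ half_up k = (- 1) ^ half k"
      by (simp add: power_add mult.assoc)
    then show ?thesis unfolding idx_facts(8)[OF assms] ..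
  qed
  have diag: "(\<Prod>l<k. newton_num s23 k l) = 2 ^ half k * fact (half k)
      * ((- 2) ^ half_up k * pochhammer (s23 + real (half k)) (half_up k))"
    using newton_num_prod_diag[of s23 k] by (simp add: half_def half_up_def)
  show ?thesis
  proof (cases "even N")
    case True
    have "(\<Prod>l<k. newton_num (s23 + c1) N l) = 2 ^ half_up k * (fact half_N / fact (half_N - half_up k))
      * ((- 2) ^ half k * pochhammer (s123 + real half_N) (half k))"
      using newton_num_prod_even[of k half_N "s23 + c1"] assms N_even[OF True] s
      by (simp add: half_def half_up_def)
    then show ?thesis using True p
      unfolding base_coeff_def prod_dividef diag q sign by (simp add: idx_a_def idx_b_def divide_simps)
  next
    case False
    have "(\<Prod>l<k. newton_num (s23 + c1) N l) = 2 ^ half k * (fact half_N / fact (half_N - half k))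
      * ((- 2) ^ half_up k * pochhammer (s123 + real half_N) (half_up k))"
      using newton_num_prod_odd[of k half_N "s23 + c1"] assms N_odd[OF False] s
      by (simp add: half_def half_up_def)
    then show ?thesis using False p
      unfolding base_coeff_def prod_dividef diag q by (simp add: idx_a_def idx_b_def divide_simps)
  qed
qed

text \<open>Truncation turns one rising factorial in the numerator into (-half_N)_a and one in the
  denominator into (1 - c1 - half_up_N)_b, with a = \<open>idx_a k\<close> and b =
  \<open>idx_b k\<close>. Since a + b = k, their signs cancel (-1)^k and everything left is
  positive.\<close>

lemma BI_w_closed:
  assumes "k \<le> N"
  shows "BI_w p1 p2 q1 q2 k = pochhammer c2 (half_up k) * fact half_N * pochhammer (s123 + real half_N) (idx_b k)
      * pochhammer s23 (half k) * pochhammer c1 (half_up_N - idx_b k)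
    / (fact (half k) * fact (half_N - idx_a k) * pochhammer c3 (half_up k) * pochhammer c1 half_up_N * pochhammer (s23 + real half_up_N) (idx_a k))"
proof -
  have kk: "k div 2 = half k" "half k + k mod 2 = half_up k" unfolding half_up_def half_def by presburger+
  have args: "p1 - q1 + 1/2 = c2" "2 * p1 + 1 = s23" "p1 + q1 + 1/2 = c3"
    by (simp_all add: p1_def q1_def field_simps)
  have neg: "pochhammer (- real half_N) (idx_a k) = (- 1) ^ idx_a k * fact half_N / fact (half_N - idx_a k)"
    by (rule pochhammer_neg_nat[OF idx_facts(1)[OF assms]])
  have refl: "pochhammer (1 - c1 - real half_up_N) (idx_b k) = (- 1) ^ idx_b k * pochhammer c1 half_up_N / pochhammer c1 (half_up_N - idx_b k)"
    by (rule pochhammer_reflect_quotient[OF c_pos(1) idx_facts(2)[OF assms]])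
  have sign: "(- 1 :: real) ^ k = (- 1) ^ idx_a k * (- 1) ^ idx_b k"
    by (simp add: power_add[symmetric] idx_facts(7)[OF assms])
  have pos: "pochhammer c1 (half_up_N - idx_b k) > 0" using c_pos by (simp add: pochhammer_pos)
  show ?thesis
  proof (cases "even N")
    case True
    have args2: "p1 - q2 + 1/2 = - real half_N" "p1 + p2 + 1 = s123 + real half_N" "p1 + q2 + 1/2 = s23 + real half_up_N"
      "p1 - p2 + 1 = 1 - c1 - real half_up_N"
      using N_even[OF True] True by (auto simp: p1_def p2_def q2_def m123_def field_simps)
    have ab: "half_up k = idx_a k" "half k = idx_b k" using True by (simp_all add: idx_a_def idx_b_def)
    show ?thesis
      unfolding BI_w_def Let_def kk args args2 unfolding ab neg refl sign
      using pos by (simp add: divide_simps)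
  next
    case False
    have args2: "p1 - q2 + 1/2 = s123 + real half_N" "p1 + p2 + 1 = - real half_N" "p1 + q2 + 1/2 = 1 - c1 - real half_up_N"
      "p1 - p2 + 1 = s23 + real half_up_N"
      using N_odd[OF False] False by (auto simp: p1_def p2_def q2_def m123_def field_simps)
    have ab: "half_up k = idx_b k" "half k = idx_a k" using False by (simp_all add: idx_a_def idx_b_def)
    show ?thesis
      unfolding BI_w_def Let_def kk args args2 unfolding ab neg refl sign
      using pos by (simp add: divide_simps)
  qed
qed

lemma BI_h_closed:
  assumes "n \<le> N"
  shows "BI_h N p1 p2 q1 q2 n = fact (half n) * fact half_N * pochhammer s23 half_up_N * pochhammer (s123 + real half_N) (idx_b n)
      * pochhammer (s12 + real (half n)) (half_up_N - half n) * pochhammer c2 (half_up n) * pochhammer (s12 + real half_up_N) (idx_a n)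
    / (fact (half_N - idx_a n) * pochhammer c3 (half_up_N - idx_b n) * pochhammer (c1 + real (half_up n)) (half_up_N - half_up n)
      * (pochhammer (s12 + real (half n)) (half_up n))\<^sup>2)"
proof -
  have nn: "n div 2 = half n" "half n + n mod 2 = half_up n" unfolding half_up_def half_def by presburger+
  have nr: "real (half n) + real (n mod 2) = real (half_up n)" using nn by linarith
  have args: "1/2 + p1 - q1 = c2" "1 + 2 * p1 = s23" "1/2 + p1 + q1 = c3"
    "1 + real (half n) + (p1 + p2 - q1 - q2) = s12 + real (half n)"
    "1/2 + real (half n) + real (n mod 2) + p2 - q2 = c1 + real (half_up n)"
    unfolding nr[symmetric] by (simp_all add: p1_def q1_def p2_def q2_def field_simps)
  show ?thesis
  proof (cases "even N")
    case True
    have args2: "1 + p1 + p2 = s123 + real half_N" "1/2 + p2 - q1 = s12 + real half_up_N"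
      using N_even[OF True] True by (auto simp: p1_def p2_def q1_def m123_def field_simps)
    have l: "N div 2 = half_N" "half_up_N = half_N" "half_N - half n - n mod 2 = half_N - half_up n" using N_even[OF True] nn by (auto simp: half_N_def)
    show ?thesis
      unfolding BI_h_def Let_def nn args args2 l idx_a_def idx_b_def using True by (simp add: l mult_ac)
  next
    case False
    have args2: "1 - q1 - q2 = s12 + real half_up_N" "1/2 + p1 - q2 = s123 + real half_N"
      using N_odd[OF False] False by (auto simp: p1_def q1_def q2_def m123_def field_simps)
    have l: "N div 2 = half_N" "half_up_N = half_N + 1" "half_N + 1 - half n - n mod 2 = half_N + 1 - half_up n" using N_odd[OF False] nn by (auto simp: half_N_def)
    show ?thesis
      unfolding BI_h_def Let_def nn args args2 l idx_a_def idx_b_def using False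
      by (simp add: l mult_ac del: pochhammer_Suc)
  qed
qed

text \<open>A step n -> n + 1 advances exactly one of the two indices, and \<open>mid_zeta\<close>
  is, up to sign, the next factor of the rising factorial with that index.\<close>

lemma step_coeff_index:
  assumes "Suc n \<le> N"
  shows "(even N \<longleftrightarrow> even n) \<Longrightarrow> idx_a (Suc n) = Suc (idx_a n) \<and> idx_b (Suc n) = idx_b n
      \<and> mid_zeta (N - n) c3 (s12 + real n) = - (s12 + real half_up_N + real (idx_a n))"
    "(even N \<longleftrightarrow> odd n) \<Longrightarrow> idx_b (Suc n) = Suc (idx_b n) \<and> idx_a (Suc n) = idx_a n
      \<and> mid_zeta (N - n) c3 (s12 + real n) = s123 + real half_N + real (idx_b n)"
proof -
  have r: "real (N - n) = real N - real n" using assms by (simp add: of_nat_diff)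
  have par: "even (N - n) \<longleftrightarrow> (even N \<longleftrightarrow> even n)" using assms by auto
  show "(even N \<longleftrightarrow> even n) \<Longrightarrow> idx_a (Suc n) = Suc (idx_a n) \<and> idx_b (Suc n) = idx_b n
      \<and> mid_zeta (N - n) c3 (s12 + real n) = - (s12 + real half_up_N + real (idx_a n))"
    unfolding mid_zeta_def par r
    by (cases n rule: nat_even_odd_cases; cases "even N")
       (use N_even N_odd in \<open>auto simp: idx_a_def idx_b_def half_def half_up_def field_simps\<close>)
  show "(even N \<longleftrightarrow> odd n) \<Longrightarrow> idx_b (Suc n) = Suc (idx_b n) \<and> idx_a (Suc n) = idx_a n
      \<and> mid_zeta (N - n) c3 (s12 + real n) = s123 + real half_N + real (idx_b n)"
    unfolding mid_zeta_def par r
    by (cases n rule: nat_even_odd_cases; cases "even N")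
       (use N_even N_odd in \<open>auto simp: idx_a_def idx_b_def half_def half_up_def field_simps\<close>)
qed

lemma prod_mid_zeta:
  "n \<le> N \<Longrightarrow> (\<Prod>j<n. mid_zeta (N - j) c3 (s12 + real j))
    = (- 1) ^ idx_a n * pochhammer (s12 + real half_up_N) (idx_a n) * pochhammer (s123 + real half_N) (idx_b n)"
proof (induction n)
  case 0
  show ?case by (simp add: idx_a_def idx_b_def half_def half_up_def)
next
  case (Suc n)
  have IH: "(\<Prod>j<n. mid_zeta (N - j) c3 (s12 + real j))
    = (- 1) ^ idx_a n * pochhammer (s12 + real half_up_N) (idx_a n) * pochhammer (s123 + real half_N) (idx_b n)"
    using Suc by simp
  show ?case
  proof (cases "even N \<longleftrightarrow> even n")
    case True
    have "s * P * Q * - w = - 1 * s * (P * w) * Q" for s P Q w :: real by simp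
    then show ?thesis
      using step_coeff_index(1)[OF Suc.prems True]
      by (simp only: prod.lessThan_Suc IH pochhammer_Suc power_Suc)
  next
    case False
    then have "even N \<longleftrightarrow> odd n" by blast
    then show ?thesis
      using step_coeff_index(2)[OF Suc.prems] by (simp add: IH pochhammer_Suc)
  qed
qed

lemma prod_top_omega:
  "(\<Prod>j<n. top_omega j c2 c1)
    = pochhammer c2 (half_up n) * pochhammer c1 (half_up n) * fact (half n) * pochhammer s12 (half n)"
proof (induction n)
  case 0
  show ?case by (simp add: half_def half_up_def)
next
  case (Suc n)
  show ?case
  proof (cases n rule: nat_even_odd_cases)
    case (even i)
    then have "half n = i" "half_up n = i" "half (Suc n) = i" "half_up (Suc n) = Suc i" by (auto simp: half_def half_up_def)
    then show ?thesis using Suc by (simp add: top_omega_def even pochhammer_Suc add.commute)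
  next
    case (odd i)
    then have i: "half n = i" "half_up n = Suc i" "half (Suc n) = Suc i" "half_up (Suc n) = Suc i" by (auto simp: half_def half_up_def)
    have "top_omega n c2 c1 = real (Suc i) * (s12 + real i)"
      by (simp add: top_omega_def odd add_divide_distrib algebra_simps)
    then show ?thesis using Suc unfolding i
      by (simp add: pochhammer_Suc[of s12 i] del: pochhammer_Suc of_nat_Suc)
  qed
qed

lemma prod_shift: "(\<Prod>j<n. z + real j) = pochhammer z n"
  by (induction n) (simp_all add: pochhammer_Suc)

lemma left_factor_closed:
  assumes "n \<le> N"
  shows "left_factor n = (- 1) ^ idx_a n * (fact half_N * pochhammer s12 half_up_N
    * (pochhammer c2 (half_up n) * pochhammer c1 (half_up n) * fact (half n) * pochhammer s12 (half n))
    * (pochhammer (s12 + real half_up_N) (idx_a n) * pochhammer (s123 + real half_N) (idx_b n)) / (pochhammer s12 n)\<^sup>2)"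
proof -
  have "(\<Prod>j<n. step_coeff j) = (\<Prod>j<n. mid_zeta (N - j) c3 (s12 + real j)) * (\<Prod>j<n. top_omega j c2 c1)
    / (\<Prod>j<n. s12 + real j)\<^sup>2"
    by (simp add: step_coeff_def prod_dividef prod.distrib prod_power_distrib)
  then show ?thesis
    unfolding left_factor_def half_N_def[symmetric] half_up_N_def[symmetric] prod_shift prod_mid_zeta[OF assms] prod_top_omega
    by simp
qed

text \<open>It makes the coefficients between normalized polynomials equal to sqrt(w_k) in modulus,
  up to a factor free of k. The decisive cancellation splits one rising factorial of
  \<open>s23\<close> in two ways, using half_up_N + a = k + (half_up_N - b) with a =
  \<open>idx_a k\<close> and b = \<open>idx_b k\<close>.\<close>

lemma base_coeff_square:
  assumes "k \<le> N"
  shows "(base_coeff s23 c1 N k)\<^sup>2 * jacK N s23 c1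
    = BI_w p1 p2 q1 q2 k * (jacK k c3 c2 * jacK (N - k) (s23 + real k) c1)"
proof -
  note ix = idx_facts[OF assms]
  define P1 P2 S0 S1 S2 SL SA C CL H2 H3 where defs:
    "P1 = pochhammer (s123 + real half_N) (idx_b k)" "P2 = pochhammer (s123 + real half_N + real (idx_b k)) (half_up_N - idx_b k)"
    "S0 = pochhammer s23 (half k)" "S1 = pochhammer (s23 + real (half k)) (half_up k)"
    "S2 = pochhammer (s23 + real k) (half_up_N - idx_b k)" "SL = pochhammer s23 half_up_N"
    "SA = pochhammer (s23 + real half_up_N) (idx_a k)" "C = pochhammer c1 half_up_N" "CL = pochhammer c1 (half_up_N - idx_b k)"
    "H2 = pochhammer c2 (half_up k)" "H3 = pochhammer c3 (half_up k)"
  have pos: "P1 > 0" "P2 > 0" "S0 > 0" "S1 > 0" "S2 > 0" "SL > 0" "SA > 0" "C > 0" "CL > 0" "H2 > 0" "H3 > 0"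
    unfolding defs using c_pos by (auto intro!: pochhammer_pos add_pos_nonneg)
  have P: "pochhammer (s23 + c1 + real half_N) half_up_N = P1 * P2"
    using pochhammer_product[OF ix(2), of "s123 + real half_N"] by (simp add: defs add_ac)
  have S: "SL * SA = S0 * S1 * S2"
  proof -
    have "SL * SA = pochhammer s23 (half_up_N + idx_a k)" by (simp add: defs pochhammer_product')
    also have "half_up_N + idx_a k = k + (half_up_N - idx_b k)" using ix by linarith
    also have "pochhammer s23 \<dots> = S0 * S1 * S2"
      using pochhammer_product'[of s23 "half k" "half_up k"] ix(8) by (simp add: pochhammer_product' defs(3-5))
    finally show ?thesis .
  qed
  have K1: "jacK N s23 c1 = SL / (2 ^ N * (P1 * P2 * C * fact half_N))"
    unfolding jacK_def half_up_N_def[symmetric] half_N_def[symmetric] P by (simp add: defs)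
  have K2: "jacK k c3 c2 = H3 / (2 ^ k * (S1 * H2 * fact (half k)))"
    unfolding jacK_def half_up_def[symmetric] unfolding half_def[symmetric] by (simp add: defs add_ac)
  have K3: "jacK (N - k) (s23 + real k) c1 = S2 / (2 ^ (N - k) * (P2 * CL * fact (half_N - idx_a k)))"
  proof -
    have "real k = real (idx_a k) + real (idx_b k)" using ix(7) by linarith
    then have e: "s23 + real k + c1 + real (half_N - idx_a k) = s123 + real half_N + real (idx_b k)"
      using ix(1) by (simp add: of_nat_diff)
    show ?thesis unfolding jacK_def ix(5,6) e by (simp add: defs)
  qed
  have D: "(base_coeff s23 c1 N k)\<^sup>2 = (fact half_N * P1 / (fact (half_N - idx_a k) * fact (half k) * S1))\<^sup>2"
  proof -
    have "(if even N then (- 1) ^ k else 1 :: real)\<^sup>2 = 1" by (simp add: power2_eq_square)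
    then show ?thesis
      unfolding base_coeff_closed[OF assms] defs by (simp only: power_mult_distrib mult_1)
  qed
  have W: "BI_w p1 p2 q1 q2 k = H2 * fact half_N * P1 * S0 * CL
    / (fact (half k) * fact (half_N - idx_a k) * H3 * C * SA)"
    unfolding BI_w_closed[OF assms] by (simp add: defs)
  have two: "(2 :: real) ^ N = 2 ^ k * 2 ^ (N - k)" using assms by (simp add: power_add[symmetric])
  have SL: "SL = S0 * S1 * S2 / SA" using S pos by (simp add: field_simps)
  show ?thesis
    unfolding D W K1 K2 K3 two SL power_divide times_divide_times_eq divide_divide_eq_left
    by (rule frac_eqI) (use pos in simp, use pos in simp, simp only: power2_eq_square mult_ac)
qed

text \<open>The counterpart for h_n, relative to the same constant \<open>jacK N s23 c1\<close>,
  which therefore drops out of the quotient. The squared symbol in h starts at 1 + ne + g = s12 +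
  half n, where the rising factorial (s12)_n is cut.\<close>

lemma left_factor_square:
  assumes "n \<le> N"
  shows "(left_factor n)\<^sup>2 * jacK N s23 c1
    = jacK n c2 c1 * (fact (n div 2) * pochhammer c1 ((n + 1) div 2))\<^sup>2
      * (jacK (N - n) c3 (s12 + real n)
        * (fact ((N - n) div 2) * pochhammer (s12 + real n) ((N - n + 1) div 2))\<^sup>2)
      * BI_h N p1 p2 q1 q2 n"
proof -
  note ix = idx_facts[OF assms]
  define P1 P2 S E0 X Y V EA H1 H1' H2 H3 where defs:
    "P1 = pochhammer (s123 + real half_N) (idx_b n)" "P2 = pochhammer (s123 + real half_N + real (idx_b n)) (half_up_N - idx_b n)"
    "S = pochhammer s23 half_up_N" "E0 = pochhammer s12 (half n)" "X = pochhammer (s12 + real (half n)) (half_up n)"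
    "Y = pochhammer (s12 + real (half n)) (half_up_N - half n)" "V = pochhammer (s12 + real n) (half_up_N - idx_b n)"
    "EA = pochhammer (s12 + real half_up_N) (idx_a n)" "H1 = pochhammer c1 (half_up n)"
    "H1' = pochhammer (c1 + real (half_up n)) (half_up_N - half_up n)" "H2 = pochhammer c2 (half_up n)"
    "H3 = pochhammer c3 (half_up_N - idx_b n)"
  have pos: "P1 > 0" "P2 > 0" "S > 0" "E0 > 0" "X > 0" "Y > 0" "V > 0" "EA > 0" "H1 > 0" "H1' > 0" "H2 > 0" "H3 > 0"
    unfolding defs using c_pos by (auto intro!: pochhammer_pos add_pos_nonneg)
  have P: "pochhammer (s23 + c1 + real half_N) half_up_N = P1 * P2"
    using pochhammer_product[OF ix(2), of "s123 + real half_N"] by (simp add: defs add_ac)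
  have C: "pochhammer c1 half_up_N = H1 * H1'"
    unfolding defs by (rule pochhammer_product[OF ix(3)])
  have EL: "pochhammer s12 half_up_N = E0 * Y"
    unfolding defs by (rule pochhammer_product[OF ix(4)])
  have En: "pochhammer s12 n = E0 * X"
    using pochhammer_product'[of s12 "half n" "half_up n"] ix(8) by (simp add: defs)
  have EA: "E0 * Y * EA = E0 * X * V"
  proof -
    have "E0 * Y * EA = pochhammer s12 (half_up_N + idx_a n)" by (simp add: EL[symmetric] defs(8) pochhammer_product')
    also have "half_up_N + idx_a n = n + (half_up_N - idx_b n)" using ix by linarith
    also have "pochhammer s12 \<dots> = E0 * X * V" by (simp add: pochhammer_product' En defs(7))
    finally show ?thesis .
  qed
  have K1: "jacK N s23 c1 = S / (2 ^ N * (P1 * P2 * (H1 * H1') * fact half_N))"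
    unfolding jacK_def half_up_N_def[symmetric] half_N_def[symmetric] P C by (simp add: defs)
  have K2: "jacK n c2 c1 = H2 / (2 ^ n * (X * H1 * fact (half n)))"
    unfolding jacK_def half_up_def[symmetric] unfolding half_def[symmetric] by (simp add: defs add_ac)
  have K3: "jacK (N - n) c3 (s12 + real n) = H3 / (2 ^ (N - n) * (P2 * V * fact (half_N - idx_a n)))"
  proof -
    have "real n = real (idx_a n) + real (idx_b n)" using ix(7) by linarith
    then have e: "c3 + (s12 + real n) + real (half_N - idx_a n) = s123 + real half_N + real (idx_b n)"
      using ix(1) by (simp add: of_nat_diff)
    show ?thesis unfolding jacK_def ix(5,6) e by (simp add: defs)
  qed
  have Z: "(left_factor n)\<^sup>2 = (fact half_N * (E0 * Y) * (H2 * H1 * fact (half n) * E0) * (EA * P1) / (E0 * X)\<^sup>2)\<^sup>2"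
  proof -
    have "((- 1 :: real) ^ idx_a n)\<^sup>2 = 1" by (simp add: power2_eq_square)
    then show ?thesis
      unfolding left_factor_closed[OF assms] EL En defs(1,8,9,11)[symmetric] defs(4)[symmetric]
      by (simp only: power_mult_distrib mult_1)
  qed
  have h: "BI_h N p1 p2 q1 q2 n = fact (half n) * fact half_N * S * P1 * Y * H2 * EA
    / (fact (half_N - idx_a n) * H3 * H1' * X\<^sup>2)"
    unfolding BI_h_closed[OF assms] by (simp add: defs)
  have two: "(2 :: real) ^ N = 2 ^ n * 2 ^ (N - n)" using assms by (simp add: power_add[symmetric])
  have EA': "EA = X * V / Y" using EA pos by (simp add: field_simps)
  show ?thesis
    unfolding Z h K1 K2 K3 two EA' ix(5,6)
    unfolding half_up_def[symmetric]
    unfolding half_def[symmetric] defs(7,9)[symmetric] power_divide times_divide_times_eq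
      divide_divide_eq_left times_divide_eq_left times_divide_eq_right divide_divide_eq_right
    by (rule frac_eqI) (use pos in simp, use pos in simp, simp only: power2_eq_square mult_ac)
qed

end

text \<open>\<open>jacP\<close> is homogeneous of degree n in its three variables; scaling by a sign
  is what moves \<epsilon>3 out of the first factor of the claim.\<close>

lemma jacP_sign_homogeneous:
  assumes "e \<in> {1, - 1}"
  shows "jacP n c d (e * x2) (e * x1) (e * x0) = e ^ n * jacP n c d x2 x1 x0"
proof -
  have e: "e * e = 1" using assms by auto
  then have sq: "(e * x)\<^sup>2 = x\<^sup>2" for x by algebra
  show ?thesis
  proof (cases n rule: nat_even_odd_cases)
    case (even m)
    have "(e * x1 - e * x0) * (e * x2 - e * x1) = (x1 - x0) * (x2 - x1)" using e by algebra
    moreover have "e ^ n = 1" using assms by (auto simp: even)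
    ultimately show ?thesis by (simp add: even jacP_def jacp_even sq)
  next
    case (odd m)
    have lin: "(e * x1 - e * x0) * X - (e * x2 - e * x1) * Y = e * ((x1 - x0) * X - (x2 - x1) * Y)" for X Y
      by algebra
    have pow: "e ^ Suc (2 * m) = e" using assms by auto
    show ?thesis unfolding odd jacP_def jacp_odd sq lin pow by (simp only: mult_ac)
  qed
qed

section \<open>Signs of the coefficients and the normalized expansion\<close>

context coupling
begin

lemma base_coeff_sign:
  assumes "k \<le> N"
  shows "base_coeff s23 c1 N k = (if even N then (- 1) ^ k else 1) * \<bar>base_coeff s23 c1 N k\<bar>"
proof -
  define q where "q = fact half_N * pochhammer (s123 + real half_N) (idx_b k)
      / (fact (half_N - idx_a k) * fact (half k) * pochhammer (s23 + real (half k)) (half_up k))"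
  have "q > 0"
    unfolding q_def using c_pos by (intro divide_pos_pos mult_pos_pos pochhammer_pos) auto
  then show ?thesis
    unfolding base_coeff_closed[OF assms] q_def[symmetric] by (simp add: abs_mult power_abs)
qed

lemma left_factor_sign:
  assumes "n \<le> N"
  shows "left_factor n = (- 1) ^ idx_a n * \<bar>left_factor n\<bar>" "left_factor n \<noteq> 0"
proof -
  define q where "q = fact half_N * pochhammer s12 half_up_N
    * (pochhammer c2 (half_up n) * pochhammer c1 (half_up n) * fact (half n) * pochhammer s12 (half n))
    * (pochhammer (s12 + real half_up_N) (idx_a n) * pochhammer (s123 + real half_N) (idx_b n)) / (pochhammer s12 n)\<^sup>2"
  have "q > 0"
    unfolding q_def using c_pos
    by (intro divide_pos_pos mult_pos_pos pochhammer_pos zero_less_power) auto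
  then show "left_factor n = (- 1) ^ idx_a n * \<bar>left_factor n\<bar>" "left_factor n \<noteq> 0"
    unfolding left_factor_closed[OF assms] q_def[symmetric] by (simp_all add: abs_mult power_abs)
qed

text \<open>Modulo 2, (n - 1)n/2 is \<open>half n\<close> and (n + 1)n/2 is
  \<open>half_up n\<close>, the values of \<open>idx_a n\<close> for odd and for even N. The
  truncated n - 1 is harmless at n = 0 because of the factor n.\<close>

lemma sign_exponent:
  "(if even N then (- 1) ^ k else 1 :: real) * (- 1) ^ idx_a n
    = (- 1) ^ (N * ((n - 1) * n div 2) + (N + 1) * (k + (n + 1) * n div 2))"
proof -
  have 1: "even ((n - 1) * n div 2) \<longleftrightarrow> even (half n)"
  proof (cases n rule: nat_even_odd_cases)
    case (even i)
    have "(n - 1) * n div 2 = (2 * i - 1) * i" by (simp add: even)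
    then show ?thesis by (cases i) (auto simp: even half_def)
  next
    case (odd i)
    have "(n - 1) * n div 2 = i * n" by (simp add: odd)
    then show ?thesis by (simp add: odd half_def)
  qed
  have 2: "even ((n + 1) * n div 2) \<longleftrightarrow> even (half_up n)"
  proof (cases n rule: nat_even_odd_cases)
    case (even i)
    have "(n + 1) * n div 2 = (n + 1) * i" by (simp add: even)
    then show ?thesis by (simp add: even half_up_def)
  next
    case (odd i)
    have "(n + 1) * n div 2 = (i + 1) * n" by (simp add: odd)
    then show ?thesis by (simp add: odd half_up_def)
  qed
  show ?thesis
    using 1 2 by (cases "even N"; cases "even k"; cases "even (half n)"; cases "even (half_up n)")
      (simp_all add: idx_a_def minus_one_power_iff)
qed

text \<open>A collects all constants between the normalized left-hand side and
  \<open>left_fun\<close>. The resulting coefficient is identified in modulus by the two square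
  identities and in sign by \<open>sign_exponent\<close>.\<close>

lemma normalized_expansion:
  assumes "n \<le> N" "\<bar>x0\<bar> < \<bar>x1\<bar>" "\<bar>x1\<bar> < \<bar>t\<bar>" "\<bar>t\<bar> < \<bar>x3\<bar>"
  shows "sqrt (jacK n c2 c1) * jacP n c2 c1 t x1 x0
      * (sqrt (jacK (N - n) c3 (s12 + real n)) * jacP (N - n) c3 (s12 + real n) x3 t ((- 1) ^ n * x0))
    = (\<Sum>k\<le>N. (- 1) ^ (N * ((n - 1) * n div 2) + (N + 1) * (k + (n + 1) * n div 2))
        * sqrt (BI_w p1 p2 q1 q2 k / BI_h N p1 p2 q1 q2 n) * BI p1 p2 q1 q2 n (BI_x p1 k)
        * (sqrt (jacK k c3 c2) * jacP k c3 c2 x3 t x1)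
        * (sqrt (jacK (N - k) (s23 + real k) c1)
            * jacP (N - k) (s23 + real k) c1 x3 ((- 1) ^ k * x1) ((- 1) ^ k * x0)))"
proof -
  define h where "h = BI_h N p1 p2 q1 q2 n"
  define A where "A = sqrt (jacK n c2 c1) * (fact (n div 2) * pochhammer c1 ((n + 1) div 2))
    * (sqrt (jacK (N - n) c3 (s12 + real n))
      * (fact ((N - n) div 2) * pochhammer (s12 + real n) ((N - n + 1) div 2)))"
  have K: "jacK n c2 c1 > 0" "jacK (N - n) c3 (s12 + real n) > 0" "jacK N s23 c1 > 0"
    using c_pos by (auto intro!: jacK_pos add_pos_nonneg)
  have A: "A > 0"
    unfolding A_def using K c_pos
    by (intro mult_pos_pos pochhammer_pos) (auto intro: add_pos_nonneg)
  have A2: "A\<^sup>2 * h = (left_factor n)\<^sup>2 * jacK N s23 c1"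
    using K unfolding left_factor_square[OF assms(1)] A_def h_def by (simp add: power_mult_distrib mult_ac)
  have z: "left_factor n \<noteq> 0" "left_factor n = (- 1) ^ idx_a n * \<bar>left_factor n\<bar>" using left_factor_sign[OF assms(1)] by auto
  \<comment> \<open>Positivity is read off the square identity, whose other side is a nonzero square
    times a positive constant.\<close>
  have h: "h > 0"
  proof -
    have "A\<^sup>2 * h > 0" unfolding A2 using z(1) K(3) by simp
    then show ?thesis using A by (simp add: zero_less_mult_iff)
  qed
  have Ah: "A * sqrt h = \<bar>left_factor n\<bar> * sqrt (jacK N s23 c1)"
    using arg_cong[OF A2, of sqrt] A by (simp add: real_sqrt_mult)
  have coeff: "A * base_coeff s23 c1 N k / left_factor n
    = (- 1) ^ (N * ((n - 1) * n div 2) + (N + 1) * (k + (n + 1) * n div 2))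
      * sqrt (BI_w p1 p2 q1 q2 k / h) * sqrt (jacK k c3 c2) * sqrt (jacK (N - k) (s23 + real k) c1)"
    if "k \<le> N" for k
  proof -
    define D where "D = base_coeff s23 c1 N k"
    have "sqrt (BI_w p1 p2 q1 q2 k) * (sqrt (jacK k c3 c2) * sqrt (jacK (N - k) (s23 + real k) c1))
       = \<bar>D\<bar> * sqrt (jacK N s23 c1)"
      using arg_cong[OF base_coeff_square[OF that], of sqrt] by (simp add: D_def real_sqrt_mult)
    then have "sqrt (BI_w p1 p2 q1 q2 k / h) * sqrt (jacK k c3 c2) * sqrt (jacK (N - k) (s23 + real k) c1)
       = \<bar>D\<bar> * (sqrt (jacK N s23 c1) / sqrt h)"
      by (simp add: real_sqrt_divide mult_ac)
    also have "sqrt (jacK N s23 c1) / sqrt h = A / \<bar>left_factor n\<bar>"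
      using Ah h z(1) by (simp add: field_simps)
    finally have R: "sqrt (BI_w p1 p2 q1 q2 k / h) * sqrt (jacK k c3 c2) * sqrt (jacK (N - k) (s23 + real k) c1)
       = \<bar>D\<bar> * A / \<bar>left_factor n\<bar>" by simp
    have "D = (if even N then (- 1) ^ k else 1) * \<bar>D\<bar>"
      unfolding D_def by (rule base_coeff_sign[OF that])
    moreover have "1 / left_factor n = (- 1) ^ idx_a n / \<bar>left_factor n\<bar>"
    proof -
      have "\<bar>left_factor n\<bar> = ((- 1) ^ idx_a n * (- 1) ^ idx_a n) * \<bar>left_factor n\<bar>" by simp
      also have "\<dots> = (- 1) ^ idx_a n * left_factor n" by (simp only: mult.assoc z(2)[symmetric])
      finally show ?thesis by simp
    qed
    ultimately have q: "D * (1 / left_factor n) = ((if even N then (- 1) ^ k else 1) * \<bar>D\<bar>) * ((- 1) ^ idx_a n / \<bar>left_factor n\<bar>)"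
      by (rule arg_cong2)
    have "A * D / left_factor n = A * (D * (1 / left_factor n))" by simp
    also have "\<dots> = (if even N then (- 1) ^ k else 1) * (- 1) ^ idx_a n * (\<bar>D\<bar> * A / \<bar>left_factor n\<bar>)"
      unfolding q by (simp only: times_divide_eq_right times_divide_eq_left mult_ac)
    finally have "A * D / left_factor n
      = (if even N then (- 1) ^ k else 1) * (- 1) ^ idx_a n * (\<bar>D\<bar> * A / \<bar>left_factor n\<bar>)" .
    then show ?thesis unfolding sign_exponent R[symmetric] unfolding D_def
      by (simp only: mult.assoc)
  qed
  have "sqrt (jacK n c2 c1) * jacP n c2 c1 t x1 x0
      * (sqrt (jacK (N - n) c3 (s12 + real n)) * jacP (N - n) c3 (s12 + real n) x3 t ((- 1) ^ n * x0))
    = A / left_factor n * (left_factor n * left_fun x3 x1 x0 n t)"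
    using z(1) by (simp add: A_def jacP_def left_fun_def mult_ac)
  also have "\<dots> = (\<Sum>k\<le>N. (A * base_coeff s23 c1 N k / left_factor n) * BI p1 p2 q1 q2 n (BI_x p1 k)
      * right_fun x3 x1 x0 k t)"
    unfolding expansion[OF assms] sum_distrib_left by (simp add: mult_ac)
  also have "\<dots> = (\<Sum>k\<le>N. (- 1) ^ (N * ((n - 1) * n div 2) + (N + 1) * (k + (n + 1) * n div 2))
        * sqrt (BI_w p1 p2 q1 q2 k / BI_h N p1 p2 q1 q2 n) * BI p1 p2 q1 q2 n (BI_x p1 k)
        * (sqrt (jacK k c3 c2) * jacP k c3 c2 x3 t x1)
        * (sqrt (jacK (N - k) (s23 + real k) c1)
            * jacP (N - k) (s23 + real k) c1 x3 ((- 1) ^ k * x1) ((- 1) ^ k * x0)))"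
    by (rule sum.cong[OF refl]) (simp only: coeff atMost_iff right_fun_def h_def mult_ac)
  finally show ?thesis .
qed

end

text \<open>Each K J equals its normalized polynomial times the sign of its \<Lambda> to the power
  of the degree. On the right the degrees at \<Lambda>3 add up to j123; on the left they are j12 at
  \<Lambda>2 and j123 - j12 at \<Lambda>3. The discrepancy is the sign in front of the sum, which is
  1 when \<Lambda>2 and \<Lambda>3 have equal signs.\<close>

theorem proposition4p7:
  fixes \<mu>1 \<mu>2 \<mu>3 \<epsilon>1 \<epsilon>2 \<epsilon>3 c \<Lambda>1 \<Lambda>2 \<Lambda>3 \<mu>12 \<epsilon>12 \<mu>123 \<rho>1 \<rho>2 r1 r2 :: real
    and j12 j123 j12_3 :: nat
    and j1_23 \<phi> :: "nat \<Rightarrow> nat"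
    and \<mu>23 \<epsilon>23 :: "nat \<Rightarrow> real"
  assumes "\<mu>1 > 0" and "\<mu>2 > 0" and "\<mu>3 > 0"
    and "\<epsilon>1 \<in> {1, -1}" and "\<epsilon>2 \<in> {1, -1}" and "\<epsilon>3 \<in> {1, -1}"
    and "j12 \<le> j123"
    and "j12_3 = j123 - j12"
    and "\<mu>12 = \<mu>1 + \<mu>2 + real j12 + 1/2"
    and "\<epsilon>12 = \<epsilon>1 * \<epsilon>2 * (-1) ^ j12"
    and "\<mu>123 = \<mu>1 + \<mu>2 + \<mu>3 + 1 + real j123"
    and "j1_23 = (\<lambda>j23. j123 - j23)"
    and "\<mu>23 = (\<lambda>j23. \<mu>2 + \<mu>3 + real j23 + 1/2)"
    and "\<epsilon>23 = (\<lambda>j23. \<epsilon>2 * \<epsilon>3 * (-1) ^ j23)"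
    and "\<bar>\<Lambda>3\<bar> > \<bar>\<Lambda>2\<bar>" and "\<bar>\<Lambda>2\<bar> > \<bar>\<Lambda>1\<bar>" and "\<bar>\<Lambda>1\<bar> > \<bar>c\<bar>"
    and "\<rho>1 = (\<mu>2 + \<mu>3) / 2"
    and "\<rho>2 = (\<mu>1 + (-1) ^ j123 * \<mu>123) / 2"
    and "r1 = (\<mu>3 - \<mu>2) / 2"
    and "r2 = ((-1) ^ j123 * \<mu>123 - \<mu>1) / 2"
    and "\<phi> = (\<lambda>j23. j123 * ((j12 - 1) * j12 div 2)
                    + (j123 + 1) * (j23 + (j12 + 1) * j12 div 2))"
  shows "bigJ_K j12 (\<epsilon>1 * \<epsilon>2) \<Lambda>2 \<mu>2 \<mu>1 c
       * bigJ j12 (\<epsilon>2 * \<Lambda>1 / \<Lambda>2) (2 * \<mu>2) (2 * \<mu>1) (- (c * \<epsilon>1 * \<epsilon>2 / \<Lambda>2))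
       * bigJ_K j12_3 (\<epsilon>12 * \<epsilon>3) \<Lambda>3 \<mu>3 \<mu>12 c
       * bigJ j12_3 (\<epsilon>3 * \<Lambda>2 / \<Lambda>3) (2 * \<mu>3) (2 * \<mu>12) (- (c * \<epsilon>12 * \<epsilon>3 / \<Lambda>3))
     = sgn (\<Lambda>2 * \<Lambda>3) ^ j12
       * (\<Sum>j23 = 0..j123.
           (-1) ^ \<phi> j23 * \<epsilon>3 ^ j12
           * sqrt (BI_w \<rho>1 \<rho>2 r1 r2 j23 / BI_h j123 \<rho>1 \<rho>2 r1 r2 j12)
           * BI \<rho>1 \<rho>2 r1 r2 j12 (BI_x \<rho>1 j23)
           * bigJ_K j23 (\<epsilon>2 * \<epsilon>3) \<Lambda>3 \<mu>3 \<mu>2 \<Lambda>1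
           * bigJ j23 (\<epsilon>3 * \<Lambda>2 / \<Lambda>3) (2 * \<mu>3) (2 * \<mu>2) (- (\<Lambda>1 * \<epsilon>2 * \<epsilon>3 / \<Lambda>3))
           * bigJ_K (j1_23 j23) (\<epsilon>1 * \<epsilon>23 j23) \<Lambda>3 (\<mu>23 j23) \<mu>1 c
           * bigJ (j1_23 j23) (\<epsilon>23 j23 * \<Lambda>1 / \<Lambda>3) (2 * \<mu>23 j23) (2 * \<mu>1)
               (- (c * \<epsilon>1 * \<epsilon>23 j23 / \<Lambda>3)))"
proof -
  interpret coupling "\<mu>1 + 1/2" "\<mu>2 + 1/2" "\<mu>3 + 1/2" j123
    by unfold_locales (use assms(1-3) in auto)
  \<comment> \<open>With these signs the second, third and fourth product take the form of
    \<open>normalized_expansion\<close> at once; the first is off by an overall \<epsilon>3 in its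
    three variables, which yields \<epsilon>3 ^ j12.\<close>
  define t x1 x0 where "t = \<epsilon>3 * \<Lambda>2" and "x1 = \<epsilon>2 * \<epsilon>3 * \<Lambda>1" and "x0 = \<epsilon>1 * \<epsilon>2 * \<epsilon>3 * c"
  note xs = this
  have sq: "\<epsilon>3 * \<epsilon>3 = 1" using assms(6) by auto
  have abs: "\<bar>x0\<bar> < \<bar>x1\<bar>" "\<bar>x1\<bar> < \<bar>t\<bar>" "\<bar>t\<bar> < \<bar>\<Lambda>3\<bar>"
    using assms(4-6,15-17) by (auto simp: xs abs_mult)
  have par: "p1 = \<rho>1" "p2 = \<rho>2" "q1 = r1" "q2 = r2"
    unfolding p1_def p2_def q1_def q2_def m123_def assms(11,18-21) by (simp_all add: field_simps)
  have sgn3: "sgn \<Lambda>3 * sgn \<Lambda>3 = 1" using assms(15-17) by (auto simp: sgn_real_def)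
  let ?c1 = "\<mu>1 + 1/2" and ?c2 = "\<mu>2 + 1/2" and ?c3 = "\<mu>3 + 1/2"
  have T1: "bigJ_K j12 (\<epsilon>1 * \<epsilon>2) \<Lambda>2 \<mu>2 \<mu>1 c
       * bigJ j12 (\<epsilon>2 * \<Lambda>1 / \<Lambda>2) (2 * \<mu>2) (2 * \<mu>1) (- (c * \<epsilon>1 * \<epsilon>2 / \<Lambda>2))
     = sgn \<Lambda>2 ^ j12 * \<epsilon>3 ^ j12 * (sqrt (jacK j12 ?c2 ?c1) * jacP j12 ?c2 ?c1 t x1 x0)"
  proof -
    have "\<Lambda>2 = \<epsilon>3 * t" "\<epsilon>2 * \<Lambda>1 = \<epsilon>3 * x1" "c * (\<epsilon>1 * \<epsilon>2) = \<epsilon>3 * x0"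
      using sq unfolding xs by algebra+
    then have P: "jacP j12 ?c2 ?c1 \<Lambda>2 (\<epsilon>2 * \<Lambda>1) (c * (\<epsilon>1 * \<epsilon>2)) = \<epsilon>3 ^ j12 * jacP j12 ?c2 ?c1 t x1 x0"
      using jacP_sign_homogeneous[OF assms(6)] by metis
    have "\<epsilon>1 * \<epsilon>2 \<in> {1, - 1}" "\<bar>c\<bar> < \<bar>\<Lambda>2\<bar>" using assms(4,5,16,17) by auto
    from bigJ_K_times_bigJ[OF assms(2,1) this(2,1), of j12 "\<epsilon>2 * \<Lambda>1"] show ?thesis
      unfolding P by (simp only: mult_ac)
  qed
  have T2: "bigJ_K j12_3 (\<epsilon>12 * \<epsilon>3) \<Lambda>3 \<mu>3 \<mu>12 c
       * bigJ j12_3 (\<epsilon>3 * \<Lambda>2 / \<Lambda>3) (2 * \<mu>3) (2 * \<mu>12) (- (c * \<epsilon>12 * \<epsilon>3 / \<Lambda>3))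
     = sgn \<Lambda>3 ^ (j123 - j12) * (sqrt (jacK (j123 - j12) ?c3 (?c1 + ?c2 + real j12))
        * jacP (j123 - j12) ?c3 (?c1 + ?c2 + real j12) \<Lambda>3 t ((- 1) ^ j12 * x0))"
  proof -
    have m: "\<mu>12 + 1/2 = ?c1 + ?c2 + real j12" and pos: "\<mu>12 > 0" using assms(1,2,9) by auto
    have z: "c * (\<epsilon>12 * \<epsilon>3) = (- 1) ^ j12 * x0" unfolding assms(10) xs by (simp only: mult_ac)
    have "\<epsilon>12 * \<epsilon>3 \<in> {1, - 1}" "\<bar>c\<bar> < \<bar>\<Lambda>3\<bar>"
      using assms(4-6,15-17) unfolding assms(10) by (auto simp: minus_one_power_iff)
    from bigJ_K_times_bigJ[OF assms(3) pos this(2,1), of j12_3 t] show ?thesis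
      unfolding m z assms(8) xs(1)[symmetric] mult.assoc[of c] by (simp only: mult.assoc)
  qed
  have T3: "bigJ_K k (\<epsilon>2 * \<epsilon>3) \<Lambda>3 \<mu>3 \<mu>2 \<Lambda>1
       * bigJ k (\<epsilon>3 * \<Lambda>2 / \<Lambda>3) (2 * \<mu>3) (2 * \<mu>2) (- (\<Lambda>1 * \<epsilon>2 * \<epsilon>3 / \<Lambda>3))
     = sgn \<Lambda>3 ^ k * (sqrt (jacK k ?c3 ?c2) * jacP k ?c3 ?c2 \<Lambda>3 t x1)" for k
  proof -
    have z: "\<Lambda>1 * (\<epsilon>2 * \<epsilon>3) = x1" unfolding xs by (simp only: mult_ac)
    have "\<epsilon>2 * \<epsilon>3 \<in> {1, - 1}" "\<bar>\<Lambda>1\<bar> < \<bar>\<Lambda>3\<bar>" using assms(5,6,15,16) by auto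
    from bigJ_K_times_bigJ[OF assms(3,2) this(2,1), of k t] show ?thesis
      unfolding z xs(1)[symmetric] mult.assoc[of \<Lambda>1] by (simp only: mult.assoc)
  qed
  have T4: "bigJ_K (j1_23 k) (\<epsilon>1 * \<epsilon>23 k) \<Lambda>3 (\<mu>23 k) \<mu>1 c
       * bigJ (j1_23 k) (\<epsilon>23 k * \<Lambda>1 / \<Lambda>3) (2 * \<mu>23 k) (2 * \<mu>1) (- (c * \<epsilon>1 * \<epsilon>23 k / \<Lambda>3))
     = sgn \<Lambda>3 ^ (j123 - k) * (sqrt (jacK (j123 - k) (?c2 + ?c3 + real k) ?c1)
        * jacP (j123 - k) (?c2 + ?c3 + real k) ?c1 \<Lambda>3 ((- 1) ^ k * x1) ((- 1) ^ k * x0))" for k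
  proof -
    have m: "\<mu>23 k + 1/2 = ?c2 + ?c3 + real k" and pos: "\<mu>23 k > 0"
      using assms(2,3) unfolding assms(13) by auto
    have z: "c * (\<epsilon>1 * \<epsilon>23 k) = (- 1) ^ k * x0" "\<epsilon>23 k * \<Lambda>1 = (- 1) ^ k * x1" "j1_23 k = j123 - k"
      unfolding assms(12,14) xs by (simp_all only: mult_ac)
    have "\<epsilon>1 * \<epsilon>23 k \<in> {1, - 1}" "\<bar>c\<bar> < \<bar>\<Lambda>3\<bar>"
      using assms(4-6,15-17) unfolding assms(14) by (auto simp: minus_one_power_iff)
    from bigJ_K_times_bigJ[OF pos assms(1) this(2,1), of "j123 - k" "\<epsilon>23 k * \<Lambda>1"] show ?thesis
      unfolding m z mult.assoc[of c] by (simp only: mult.assoc)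
  qed
  let ?P1 = "sqrt (jacK j12 ?c2 ?c1) * jacP j12 ?c2 ?c1 t x1 x0"
  let ?P2 = "sqrt (jacK (j123 - j12) ?c3 (?c1 + ?c2 + real j12))
        * jacP (j123 - j12) ?c3 (?c1 + ?c2 + real j12) \<Lambda>3 t ((- 1) ^ j12 * x0)"
  let ?P3 = "\<lambda>k. sqrt (jacK k ?c3 ?c2) * jacP k ?c3 ?c2 \<Lambda>3 t x1"
  let ?P4 = "\<lambda>k. sqrt (jacK (j123 - k) (?c2 + ?c3 + real k) ?c1)
        * jacP (j123 - k) (?c2 + ?c3 + real k) ?c1 \<Lambda>3 ((- 1) ^ k * x1) ((- 1) ^ k * x0)"
  let ?W = "\<lambda>k. (- 1) ^ \<phi> k * sqrt (BI_w \<rho>1 \<rho>2 r1 r2 k / BI_h j123 \<rho>1 \<rho>2 r1 r2 j12)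
     * BI \<rho>1 \<rho>2 r1 r2 j12 (BI_x \<rho>1 k)"
  have exp: "?P1 * ?P2 = (\<Sum>k\<le>j123. ?W k * ?P3 k * ?P4 k)"
    using normalized_expansion[OF assms(7) abs] unfolding par assms(22) .
  have s: "sgn \<Lambda>2 ^ j12 * sgn \<Lambda>3 ^ (j123 - j12) = sgn (\<Lambda>2 * \<Lambda>3) ^ j12 * sgn \<Lambda>3 ^ j123"
  proof -
    have "sgn \<Lambda>3 ^ j123 = sgn \<Lambda>3 ^ j12 * sgn \<Lambda>3 ^ (j123 - j12)"
      using assms(7) by (simp add: power_add[symmetric])
    moreover have "sgn \<Lambda>3 ^ j12 * sgn \<Lambda>3 ^ j12 = 1"
      by (simp only: power_mult_distrib[symmetric] sgn3 power_one)
    ultimately show ?thesis by (simp add: sgn_mult power_mult_distrib)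
  qed
  have "bigJ_K j12 (\<epsilon>1 * \<epsilon>2) \<Lambda>2 \<mu>2 \<mu>1 c
       * bigJ j12 (\<epsilon>2 * \<Lambda>1 / \<Lambda>2) (2 * \<mu>2) (2 * \<mu>1) (- (c * \<epsilon>1 * \<epsilon>2 / \<Lambda>2))
       * bigJ_K j12_3 (\<epsilon>12 * \<epsilon>3) \<Lambda>3 \<mu>3 \<mu>12 c
       * bigJ j12_3 (\<epsilon>3 * \<Lambda>2 / \<Lambda>3) (2 * \<mu>3) (2 * \<mu>12) (- (c * \<epsilon>12 * \<epsilon>3 / \<Lambda>3))
     = (sgn \<Lambda>2 ^ j12 * \<epsilon>3 ^ j12 * ?P1) * (sgn \<Lambda>3 ^ (j123 - j12) * ?P2)"
    unfolding T1[symmetric] T2[symmetric] by (simp only: mult.assoc)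
  also have "\<dots> = (sgn \<Lambda>2 ^ j12 * sgn \<Lambda>3 ^ (j123 - j12)) * \<epsilon>3 ^ j12 * (?P1 * ?P2)"
    by (simp only: mult_ac)
  also have "\<dots> = sgn (\<Lambda>2 * \<Lambda>3) ^ j12 * (\<Sum>k\<le>j123. sgn \<Lambda>3 ^ j123 * \<epsilon>3 ^ j12 * (?W k * ?P3 k * ?P4 k))"
    unfolding s exp by (simp only: sum_distrib_left mult.assoc)
  also have "(\<Sum>k\<le>j123. sgn \<Lambda>3 ^ j123 * \<epsilon>3 ^ j12 * (?W k * ?P3 k * ?P4 k))
    = (\<Sum>j23 = 0..j123.
           (-1) ^ \<phi> j23 * \<epsilon>3 ^ j12
           * sqrt (BI_w \<rho>1 \<rho>2 r1 r2 j23 / BI_h j123 \<rho>1 \<rho>2 r1 r2 j12)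
           * BI \<rho>1 \<rho>2 r1 r2 j12 (BI_x \<rho>1 j23)
           * bigJ_K j23 (\<epsilon>2 * \<epsilon>3) \<Lambda>3 \<mu>3 \<mu>2 \<Lambda>1
           * bigJ j23 (\<epsilon>3 * \<Lambda>2 / \<Lambda>3) (2 * \<mu>3) (2 * \<mu>2) (- (\<Lambda>1 * \<epsilon>2 * \<epsilon>3 / \<Lambda>3))
           * bigJ_K (j1_23 j23) (\<epsilon>1 * \<epsilon>23 j23) \<Lambda>3 (\<mu>23 j23) \<mu>1 c
           * bigJ (j1_23 j23) (\<epsilon>23 j23 * \<Lambda>1 / \<Lambda>3) (2 * \<mu>23 j23) (2 * \<mu>1)
               (- (c * \<epsilon>1 * \<epsilon>23 j23 / \<Lambda>3)))"
    unfolding atLeast0AtMost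
  proof (rule sum.cong[OF refl])
    fix k assume "k \<in> {..j123}"
    then have "sgn \<Lambda>3 ^ j123 = sgn \<Lambda>3 ^ k * sgn \<Lambda>3 ^ (j123 - k)"
      by (simp add: power_add[symmetric])
    then have "sgn \<Lambda>3 ^ j123 * \<epsilon>3 ^ j12 * (?W k * ?P3 k * ?P4 k)
      = (-1) ^ \<phi> k * \<epsilon>3 ^ j12
           * sqrt (BI_w \<rho>1 \<rho>2 r1 r2 k / BI_h j123 \<rho>1 \<rho>2 r1 r2 j12)
           * BI \<rho>1 \<rho>2 r1 r2 j12 (BI_x \<rho>1 k)
           * (sgn \<Lambda>3 ^ k * ?P3 k) * (sgn \<Lambda>3 ^ (j123 - k) * ?P4 k)"
      by (simp only: mult_ac)
    then show "sgn \<Lambda>3 ^ j123 * \<epsilon>3 ^ j12 * (?W k * ?P3 k * ?P4 k) =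
           (-1) ^ \<phi> k * \<epsilon>3 ^ j12
           * sqrt (BI_w \<rho>1 \<rho>2 r1 r2 k / BI_h j123 \<rho>1 \<rho>2 r1 r2 j12)
           * BI \<rho>1 \<rho>2 r1 r2 j12 (BI_x \<rho>1 k)
           * bigJ_K k (\<epsilon>2 * \<epsilon>3) \<Lambda>3 \<mu>3 \<mu>2 \<Lambda>1
           * bigJ k (\<epsilon>3 * \<Lambda>2 / \<Lambda>3) (2 * \<mu>3) (2 * \<mu>2) (- (\<Lambda>1 * \<epsilon>2 * \<epsilon>3 / \<Lambda>3))
           * bigJ_K (j1_23 k) (\<epsilon>1 * \<epsilon>23 k) \<Lambda>3 (\<mu>23 k) \<mu>1 c
           * bigJ (j1_23 k) (\<epsilon>23 k * \<Lambda>1 / \<Lambda>3) (2 * \<mu>23 k) (2 * \<mu>1)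
               (- (c * \<epsilon>1 * \<epsilon>23 k / \<Lambda>3))"
      unfolding T3[symmetric] T4[symmetric] by (simp only: mult.assoc)
  qed
  finally show ?thesis .
qed

end
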